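(* For each $s\in(0,\frac12)\cap\mathbb Q$, write $s=p/q$ with $p,q$ coprime integers, $0<2p<q$, and let $a_1,a_2,a_3\in\mathbb Z$ be defined from $p,q$ as in the context. Then the construction of the context, with these values of $a_1,a_2,a_3$, yields a family of closed special Lagrangian $3$-folds in $\mathbb C^3$ depending on $E_1,E_2,E_3\in\mathbb C$ and on $C,D,C',D'\in\mathbb C$ satisfying $$\operatorname{Im}(C\bar C')(c_1^2-c_2^2-c_3^2-d_1^2+d_2^2+d_3^2)+\operatorname{Im}(D\bar D')(e_1^2-e_2^2-e_3^2-f_1^2+f_2^2+f_3^2)=0.$$ Generic members of the family are nonsingular immersed $3$-submanifolds diffeomorphic to $\mathcal S^1\times\mathbb R^2$. Each $3$-fold is weakly asymptotic, to order $O(r^{1/2})$ at infinity in $\mathbb C^3$, to a double cover of the special Lagrangian $T^2$-cone $$\bigl\{(ie^{ia_1t}x_1,e^{ia_2t}x_2,e^{ia_3t}x_3):x_j,t\in\mathbb R,\ x_1\ge0,\ a_1x_1^2+a_2x_2^2+a_3x_3^2=0\bigr\}.$$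
   Context: Constants. If $p+q\not\equiv0\bmod 3$ put $a_1=p^2-q^2$, $a_2=q^2-2pq$, $a_3=2pq-p^2$, $\lambda=p^2-pq+q^2$; if $p+q\equiv0\bmod3$ divide all four of these by $3$. Then $a_1+a_2+a_3=0$, and $\alpha_1,\alpha_2,\alpha_3>0$ are determined uniquely by $a_1=-\alpha_1^{-1/2}(\alpha_2\alpha_3)^{1/2}$, $a_2=\alpha_2^{-1/2}(\alpha_3\alpha_1)^{1/2}$, $a_3=\alpha_3^{-1/2}(\alpha_1\alpha_2)^{1/2}$; they satisfy $\frac1{\alpha_1}=\frac1{\alpha_2}+\frac1{\alpha_3}$. Let $$M=\begin{pmatrix}-2a_1&0&0&0&-\sqrt{\alpha_3}&-\sqrt{\alpha_2}\\0&-2a_2&0&\sqrt{\alpha_3}&0&\sqrt{\alpha_1}\\0&0&-2a_3&\sqrt{\alpha_2}&\sqrt{\alpha_1}&0\\0&\sqrt{\alpha_3}&\sqrt{\alpha_2}&2a_1&0&0\\-\sqrt{\alpha_3}&0&-\sqrt{\alpha_1}&0&2a_2&0\\-\sqrt{\alpha_2}&-\sqrt{\alpha_1}&0&0&0&2a_3\end{pmatrix},$$ with eigenvalues $0$ (twice), $\pm\lambda,\pm3\lambda$, and let $(c_j),(d_j),(e_j),(f_j)$ be nonzero vectors in $\mathbb R^3$ such that $(c_1,c_2,c_3,d_1,d_2,d_3)^T$ and $(e_1,e_2,e_3,f_1,f_2,f_3)^T$ are eigenvectors of $M$ with eigenvalues $\lambda$ and $3\lambda$ respectively. None of $\pm\lambda,\pm3\lambda$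 equals $a_1,a_2$ or $a_3$. Construction. Define functions $\mathbb R\to\mathbb C$ of $t$ as follows. Put $w_1=i\sqrt{\alpha_1}e^{ia_1t}$, $w_2=\sqrt{\alpha_2}e^{ia_2t}$, $w_3=\sqrt{\alpha_3}e^{ia_3t}$; $$p_1=i\bigl(Cc_1e^{i(a_1+\lambda/2)t}+\bar Cd_1e^{i(a_1-\lambda/2)t}+De_1e^{i(a_1+3\lambda/2)t}+\bar Df_1e^{i(a_1-3\lambda/2)t}\bigr),$$ $$p_j=Cc_je^{i(a_j+\lambda/2)t}+\bar Cd_je^{i(a_j-\lambda/2)t}+De_je^{i(a_j+3\lambda/2)t}+\bar Df_je^{i(a_j-3\lambda/2)t}\quad(j=2,3);$$ let $q_1,q_2,q_3$ be given by the same formulas as $p_1,p_2,p_3$ with $C,D$ replaced by $C',D'$; and put $$\begin{aligned}r_1={}&-\tfrac{i}{2(a_1+3\lambda)}(D^2+D'^2)f_2f_3e^{i(a_1+3\lambda)t}-\tfrac{i}{2(a_1-3\lambda)}(\bar D^2+\bar D'^2)e_2e_3e^{i(a_1-3\lambda)t}\\&-\tfrac{i}{2(a_1+\lambda)}\bigl((C^2+C'^2)d_2d_3+(\bar CD+\bar C'D')(c_2f_3+f_2c_3)\bigr)e^{i(a_1+\lambda)t}\\&-\tfrac{i}{2(a_1-\lambda)}\bigl((\bar C^2+\bar C'^2)c_2c_3+(C\bar D+C'\bar D')(d_2e_3+e_2d_3)\bigr)e^{i(a_1-\lambda)t}+E_1,\end{aligned}$$ $$\begin{aligned}r_2={}&\tfrac{1}{2(a_2+3\lambda)}(D^2-D'^2)f_1f_3e^{i(a_2+3\lambda)t}+\tfrac{1}{2(a_2-3\lambda)}(\bar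 D^2-\bar D'^2)e_1e_3e^{i(a_2-3\lambda)t}\\&+\tfrac{1}{2(a_2+\lambda)}\bigl((C^2-C'^2)d_1d_3+(\bar CD-\bar C'D')(c_1f_3+f_1c_3)\bigr)e^{i(a_2+\lambda)t}\\&+\tfrac{1}{2(a_2-\lambda)}\bigl((\bar C^2-\bar C'^2)c_1c_3+(C\bar D-C'\bar D')(d_1e_3+e_1d_3)\bigr)e^{i(a_2-\lambda)t}+E_2,\end{aligned}$$ $$\begin{aligned}r_3={}&\tfrac{1}{a_3+3\lambda}DD'f_1f_2e^{i(a_3+3\lambda)t}+\tfrac{1}{a_3-3\lambda}\bar D\bar D'e_1e_2e^{i(a_3-3\lambda)t}\\&+\tfrac{1}{2(a_3+\lambda)}\bigl(2CC'd_1d_2+(\bar CD'+\bar C'D)(c_1f_2+f_1c_2)\bigr)e^{i(a_3+\lambda)t}\\&+\tfrac{1}{2(a_3-\lambda)}\bigl(2\bar C\bar C'c_1c_2+(C\bar D'+C'\bar D)(d_1e_2+e_1d_2)\bigr)e^{i(a_3-\lambda)t}+E_3.\end{aligned}$$ Let $\Phi:\mathbb R^3\to\mathbb C^3$, $$\Phi(y_1,y_2,t)=\bigl(\tfrac12(y_1^2+y_2^2)w_1+y_1p_1+y_2q_1+r_1,\ \tfrac12(y_1^2-y_2^2)w_2+y_1p_2-y_2q_2+r_2,\ y_1y_2w_3+y_1q_3+y_2p_3+r_3\bigr)(t).$$ The $3$-fold constructed is $N=\operatorname{Image}\Phi$. One has $\Phi(y_1,y_2,t+2\pi)=\Phi(-y_1,-y_2,t)$,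 so $\Phi$ descends to $\mathbb R^3/\mathbb Z$, where $n\in\mathbb Z$ acts by $(y_1,y_2,t)\mapsto((-1)^ny_1,(-1)^ny_2,t+2\pi n)$, and $\mathbb R^3/\mathbb Z\cong\mathcal S^1\times\mathbb R^2$; if $\Phi$ is an immersion, $N$ is an immersed copy of $\mathbb R^3/\mathbb Z$. A special Lagrangian $3$-fold in $\mathbb C^3$ is a real $3$-submanifold, suitably oriented, on which $\omega=\frac i2\sum_j dz_j\wedge d\bar z_j$ and $\operatorname{Im}(dz_1\wedge dz_2\wedge dz_3)$ vanish (equivalently, calibrated by $\operatorname{Re}(dz_1\wedge dz_2\wedge dz_3)$); members of the family may have singular points, and the assertion that they are special Lagrangian is made wherever they are nonsingular. "Generic" means outside a subset of positive real codimension in the space of parameters. "Weakly asymptotic to order $O(r^{1/2})$ to a double cover of the cone": let $\Phi_0(y_1,y_2,t)=\bigl(\frac i2(y_1^2+y_2^2)\sqrt{\alpha_1}e^{ia_1t},\frac12(y_1^2-y_2^2)\sqrt{\alpha_2}e^{ia_2t},y_1y_2\sqrt{\alpha_3}e^{ia_3t}\bigr)$, whose image is the cone and which, as a map from $\mathbb R^3/\mathbb Z$ onto it, is generically $2{:}1$; then $\Phi-\Phi_0=O(r^{1/2})$ for large $r$, where $r$ is the radius function on $\mathbb C^3$.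
   Formalization: The printed r_1, r_2, r_3 lack terms of frequency a_j and a_j±2λ, without which N is not special Lagrangian; these are added. For p, q both odd Φ_0 is 4:1 onto the cone as a set, so there the double cover is of the cone parametrised by (x, t mod 2π). *)

theory Defs
  imports "HOL-Analysis.Analysis" "HOL-Library.Landau_Symbols"
begin

section \<open>Smooth maps, immersions, special Lagrangian planes\<close>

text \<open>On a finite-dimensional domain, C^(k+1) means differentiable with all directional
  derivatives of class C^k.\<close>

primrec Ck :: "nat \<Rightarrow> ('a::euclidean_space \<Rightarrow> 'b::euclidean_space) \<Rightarrow> bool" where
  "Ck 0 f \<longleftrightarrow> continuous_on UNIV f"
| "Ck (Suc k) f \<longleftrightarrow> f differentiable_on UNIV \<and> (\<forall>v. Ck k (\<lambda>x. frechet_derivative f (at x) v))"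

definition smooth_map :: "('a::euclidean_space \<Rightarrow> 'b::euclidean_space) \<Rightarrow> bool" where
  "smooth_map f \<longleftrightarrow> (\<forall>k. Ck k f)"

definition immersive_at :: "('a::euclidean_space \<Rightarrow> 'b::euclidean_space) \<Rightarrow> 'a \<Rightarrow> bool" where
  "immersive_at f x \<longleftrightarrow> f differentiable (at x) \<and> inj (frechet_derivative f (at x))"

text \<open>The forms omega = (i/2) sum_j dz_j /\ d zbar_j and Omega = dz_1 /\ dz_2 /\ dz_3,
  evaluated on tangent vectors.\<close>

definition kaehler_form :: "complex^3 \<Rightarrow> complex^3 \<Rightarrow> complex" where
  "kaehler_form u v = \<i> / 2 * (\<Sum>j\<in>UNIV. u $ j * cnj (v $ j) - v $ j * cnj (u $ j))"

definition holo_volume_form :: "complex^3 \<Rightarrow> complex^3 \<Rightarrow> complex^3 \<Rightarrow> complex" where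
  "holo_volume_form u v w = det (vector [u, v, w] :: complex^3^3)"

definition special_Lagrangian_plane :: "(complex^3) set \<Rightarrow> bool" where
  "special_Lagrangian_plane V \<longleftrightarrow> subspace V \<and> dim V = 3 \<and>
     (\<forall>u\<in>V. \<forall>v\<in>V. kaehler_form u v = 0) \<and>
     (\<forall>u\<in>V. \<forall>v\<in>V. \<forall>w\<in>V. Im (holo_volume_form u v w) = 0)"

definition special_Lagrangian_at :: "('a::euclidean_space \<Rightarrow> complex^3) \<Rightarrow> 'a \<Rightarrow> bool" where
  "special_Lagrangian_at f x \<longleftrightarrow>
     immersive_at f x \<and> special_Lagrangian_plane (range (frechet_derivative f (at x)))"

text \<open>The image of \<open>f\<close> is a special Lagrangian 3-fold, possibly with singularities: points
  where \<open>f\<close> fails to be an immersion have empty interior, and at all other points the tangent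
  space is special Lagrangian.\<close>

definition special_Lagrangian_3fold :: "('a::euclidean_space \<Rightarrow> complex^3) \<Rightarrow> bool" where
  "special_Lagrangian_3fold f \<longleftrightarrow> smooth_map f \<and>
     closure {x. immersive_at f x} = UNIV \<and>
     (\<forall>x. immersive_at f x \<longrightarrow> special_Lagrangian_at f x)"

text \<open>\<open>K\<close> is the cone on a torus T^2 = (R / 2 pi Z)^2 embedded in the unit sphere
  by \<open>g\<close>, and is special Lagrangian away from its vertex.\<close>

definition special_Lagrangian_T2_cone :: "(complex^3) set \<Rightarrow> bool" where
  "special_Lagrangian_T2_cone K \<longleftrightarrow> (\<exists>g :: real \<times> real \<Rightarrow> complex^3.
     smooth_map g \<and> (\<forall>x. norm (g x) = 1) \<and>
     (\<forall>u v u' v'. g (u, v) = g (u', v') \<longleftrightarrow> cis u = cis u' \<and> cis v = cis v') \<and>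
     K = {r *\<^sub>R g x | r x. 0 \<le> r} \<and>
     (\<forall>r>0. \<forall>x. special_Lagrangian_at (\<lambda>(r, x). r *\<^sub>R g x) (r, x)))"

section \<open>Positive codimension\<close>

text \<open>\<open>B\<close> is covered by countably many differentiable images of subsets of \<open>k\<close>-dimensional
  linear spaces. Pointwise differentiability on the subset is enough to bound the Hausdorff
  dimension of \<open>B\<close> by \<open>k\<close>, the image being a countable union of Lipschitz images.\<close>

definition dim_at_most :: "nat \<Rightarrow> 'a::euclidean_space set \<Rightarrow> bool" where
  "dim_at_most k B \<longleftrightarrow> (\<exists>(f :: nat \<Rightarrow> 'a \<Rightarrow> 'a) S.
     (\<forall>n. dim (S n) \<le> k \<and> f n differentiable_on S n) \<and> B \<subseteq> (\<Union>n. f n ` S n))"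

text \<open>\<open>P\<close> need not be a manifold: \<open>B\<close> has dimension at most \<open>k\<close> for some \<open>k\<close> strictly smaller
  than the dimension of \<open>P\<close> near each of its points.\<close>

definition positive_codim_in :: "'a::euclidean_space set \<Rightarrow> 'a set \<Rightarrow> bool" where
  "positive_codim_in P B \<longleftrightarrow> B \<subseteq> P \<and> (\<exists>k. dim_at_most k B \<and>
     (\<forall>U. open U \<and> U \<inter> P \<noteq> {} \<longrightarrow> \<not> dim_at_most k (U \<inter> P)))"

section \<open>Constants\<close>

definition a_const :: "int \<Rightarrow> int \<Rightarrow> int^3" where
  "a_const p q = (if 3 dvd p + q
     then vector [(p^2 - q^2) div 3, (q^2 - 2*p*q) div 3, (2*p*q - p^2) div 3]
     else vector [p^2 - q^2, q^2 - 2*p*q, 2*p*q - p^2])"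

definition lam_const :: "int \<Rightarrow> int \<Rightarrow> int" where
  "lam_const p q = (if 3 dvd p + q then (p^2 - p*q + q^2) div 3 else p^2 - p*q + q^2)"

definition alpha_rel :: "real^3 \<Rightarrow> real^3 \<Rightarrow> bool" where
  "alpha_rel a \<alpha> \<longleftrightarrow> (\<forall>j. \<alpha> $ j > 0) \<and>
     a $ 1 = - (\<alpha> $ 1 powr (- 1/2)) * (\<alpha> $ 2 * \<alpha> $ 3) powr (1/2) \<and>
     a $ 2 = \<alpha> $ 2 powr (- 1/2) * (\<alpha> $ 3 * \<alpha> $ 1) powr (1/2) \<and>
     a $ 3 = \<alpha> $ 3 powr (- 1/2) * (\<alpha> $ 1 * \<alpha> $ 2) powr (1/2)"

definition M_mat :: "real^3 \<Rightarrow> real^3 \<Rightarrow> real^6^6" where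
  "M_mat a \<alpha> = vector [
     vector [- 2 * a$1, 0, 0, 0, - sqrt (\<alpha>$3), - sqrt (\<alpha>$2)],
     vector [0, - 2 * a$2, 0, sqrt (\<alpha>$3), 0, sqrt (\<alpha>$1)],
     vector [0, 0, - 2 * a$3, sqrt (\<alpha>$2), sqrt (\<alpha>$1), 0],
     vector [0, sqrt (\<alpha>$3), sqrt (\<alpha>$2), 2 * a$1, 0, 0],
     vector [- sqrt (\<alpha>$3), 0, - sqrt (\<alpha>$1), 0, 2 * a$2, 0],
     vector [- sqrt (\<alpha>$2), - sqrt (\<alpha>$1), 0, 0, 0, 2 * a$3]]"

definition join6 :: "real^3 \<Rightarrow> real^3 \<Rightarrow> real^6" where
  "join6 c d = vector [c$1, c$2, c$3, d$1, d$2, d$3]"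

definition eigenvector_of :: "real^'n^'n \<Rightarrow> real^'n \<Rightarrow> real \<Rightarrow> bool" where
  "eigenvector_of A v k \<longleftrightarrow> v \<noteq> 0 \<and> A *v v = k *\<^sub>R v"

section \<open>The family of maps\<close>

text \<open>Parameters \<open>(C, D, C', D', E)\<close>.\<close>

type_synonym param = "complex \<times> complex \<times> complex \<times> complex \<times> (complex^3)"

definition w_fun :: "real^3 \<Rightarrow> real^3 \<Rightarrow> real \<Rightarrow> complex^3" where
  "w_fun a \<alpha> t = vector
     [\<i> * sqrt (\<alpha>$1) * cis (a$1 * t), sqrt (\<alpha>$2) * cis (a$2 * t), sqrt (\<alpha>$3) * cis (a$3 * t)]"

definition lin_term :: "real^3 \<Rightarrow> real \<Rightarrow> real^3 \<Rightarrow> real^3 \<Rightarrow> real^3 \<Rightarrow> real^3 \<Rightarrow>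
    complex \<Rightarrow> complex \<Rightarrow> 3 \<Rightarrow> real \<Rightarrow> complex" where
  "lin_term a l c d e f C D j t =
     C * c$j * cis ((a$j + l/2) * t) + cnj C * d$j * cis ((a$j - l/2) * t) +
     D * e$j * cis ((a$j + 3*l/2) * t) + cnj D * f$j * cis ((a$j - 3*l/2) * t)"
  for C D :: complex

definition p_fun :: "real^3 \<Rightarrow> real \<Rightarrow> real^3 \<Rightarrow> real^3 \<Rightarrow> real^3 \<Rightarrow> real^3 \<Rightarrow>
    complex \<Rightarrow> complex \<Rightarrow> real \<Rightarrow> complex^3" where
  "p_fun a l c d e f C D t = vector
     [\<i> * lin_term a l c d e f C D 1 t, lin_term a l c d e f C D 2 t, lin_term a l c d e f C D 3 t]"

definition r_main :: "real^3 \<Rightarrow> real \<Rightarrow> real^3 \<Rightarrow> real^3 \<Rightarrow> real^3 \<Rightarrow> real^3 \<Rightarrow>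
    complex \<Rightarrow> complex \<Rightarrow> complex \<Rightarrow> complex \<Rightarrow> complex^3 \<Rightarrow> real \<Rightarrow> complex^3" where
  "r_main a l c d e f C D C' D' E t =
     vector [
     - \<i> / (2 * (a$1 + 3*l)) * (D^2 + D'^2) * f$2 * f$3 * cis ((a$1 + 3*l) * t)
     - \<i> / (2 * (a$1 - 3*l)) * ((cnj D)^2 + (cnj D')^2) * e$2 * e$3 * cis ((a$1 - 3*l) * t)
     - \<i> / (2 * (a$1 + l)) * ((C^2 + C'^2) * d$2 * d$3
         + (cnj C * D + cnj C' * D') * (c$2 * f$3 + f$2 * c$3)) * cis ((a$1 + l) * t)
     - \<i> / (2 * (a$1 - l)) * (((cnj C)^2 + (cnj C')^2) * c$2 * c$3
         + (C * cnj D + C' * cnj D') * (d$2 * e$3 + e$2 * d$3)) * cis ((a$1 - l) * t)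
     + E$1,
     1 / (2 * (a$2 + 3*l)) * (D^2 - D'^2) * f$1 * f$3 * cis ((a$2 + 3*l) * t)
     + 1 / (2 * (a$2 - 3*l)) * ((cnj D)^2 - (cnj D')^2) * e$1 * e$3 * cis ((a$2 - 3*l) * t)
     + 1 / (2 * (a$2 + l)) * ((C^2 - C'^2) * d$1 * d$3
         + (cnj C * D - cnj C' * D') * (c$1 * f$3 + f$1 * c$3)) * cis ((a$2 + l) * t)
     + 1 / (2 * (a$2 - l)) * (((cnj C)^2 - (cnj C')^2) * c$1 * c$3
         + (C * cnj D - C' * cnj D') * (d$1 * e$3 + e$1 * d$3)) * cis ((a$2 - l) * t)
     + E$2,
     1 / (a$3 + 3*l) * D * D' * f$1 * f$2 * cis ((a$3 + 3*l) * t)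
     + 1 / (a$3 - 3*l) * cnj D * cnj D' * e$1 * e$2 * cis ((a$3 - 3*l) * t)
     + 1 / (2 * (a$3 + l)) * (2 * C * C' * d$1 * d$2
         + (cnj C * D' + cnj C' * D) * (c$1 * f$2 + f$1 * c$2)) * cis ((a$3 + l) * t)
     + 1 / (2 * (a$3 - l)) * (2 * cnj C * cnj C' * c$1 * c$2
         + (C * cnj D' + C' * cnj D) * (d$1 * e$2 + e$1 * d$2)) * cis ((a$3 - l) * t)
     + E$3]"
  for C D C' D' :: complex

text \<open>The functions \<open>r\<^sub>j\<close> have to be antiderivatives:
  r_1' = cnj (p_2 p_3 + q_2 q_3) / 2, r_2' = - cnj (p_1 p_3 - q_1 q_3) / 2,
  r_3' = - cnj (p_1 q_2 + p_2 q_1) / 2. Expanding the products gives, besides the frequencies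
  a_j + 3l, a_j - 3l, a_j + l, a_j - l in \<open>r_main\<close>, the frequencies a_j + 2l,
  a_j - 2l, a_j. These do not cancel; they are missing from the published formulas, and
  without them the image is not special Lagrangian.\<close>

definition r_even :: "real^3 \<Rightarrow> real \<Rightarrow> real^3 \<Rightarrow> real^3 \<Rightarrow> real^3 \<Rightarrow> real^3 \<Rightarrow>
    complex \<Rightarrow> complex \<Rightarrow> complex \<Rightarrow> complex \<Rightarrow> real \<Rightarrow> complex^3" where
  "r_even a l c d e f C D C' D' t =
     vector [
     - \<i> / (2 * (a$1 + 2*l)) * (C * D + C' * D') * (d$2 * f$3 + f$2 * d$3) * cis ((a$1 + 2*l) * t)
     - \<i> / (2 * (a$1 - 2*l)) * (cnj C * cnj D + cnj C' * cnj D') * (c$2 * e$3 + e$2 * c$3)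
         * cis ((a$1 - 2*l) * t)
     - \<i> / (2 * a$1) * ((C * cnj C + C' * cnj C') * (c$2 * d$3 + d$2 * c$3)
         + (D * cnj D + D' * cnj D') * (e$2 * f$3 + f$2 * e$3)) * cis (a$1 * t),
     1 / (2 * (a$2 + 2*l)) * (C * D - C' * D') * (d$1 * f$3 + f$1 * d$3) * cis ((a$2 + 2*l) * t)
     + 1 / (2 * (a$2 - 2*l)) * (cnj C * cnj D - cnj C' * cnj D') * (c$1 * e$3 + e$1 * c$3)
         * cis ((a$2 - 2*l) * t)
     + 1 / (2 * a$2) * ((C * cnj C - C' * cnj C') * (c$1 * d$3 + d$1 * c$3)
         + (D * cnj D - D' * cnj D') * (e$1 * f$3 + f$1 * e$3)) * cis (a$2 * t),
     1 / (2 * (a$3 + 2*l)) * (C * D' + C' * D) * (d$1 * f$2 + f$1 * d$2) * cis ((a$3 + 2*l) * t)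
     + 1 / (2 * (a$3 - 2*l)) * (cnj C * cnj D' + cnj C' * cnj D) * (c$1 * e$2 + e$1 * c$2)
         * cis ((a$3 - 2*l) * t)
     + 1 / (2 * a$3) * ((C * cnj C' + cnj C * C') * (c$1 * d$2 + d$1 * c$2)
         + (D * cnj D' + cnj D * D') * (e$1 * f$2 + f$1 * e$2)) * cis (a$3 * t)]"
  for C D C' D' :: complex

definition Phi :: "real^3 \<Rightarrow> real \<Rightarrow> real^3 \<Rightarrow> real^3 \<Rightarrow> real^3 \<Rightarrow> real^3 \<Rightarrow> real^3 \<Rightarrow>
    param \<Rightarrow> real \<times> real \<times> real \<Rightarrow> complex^3" where
  "Phi a l \<alpha> c d e f = (\<lambda>(C, D, C', D', E) (y1 :: real, y2 :: real, t :: real).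
     let w = w_fun a \<alpha> t;
         p = p_fun a l c d e f C D t;
         q = p_fun a l c d e f C' D' t;
         r = r_main a l c d e f C D C' D' E t + r_even a l c d e f C D C' D' t
     in vector
       [1/2 * (y1^2 + y2^2) * w$1 + y1 * p$1 + y2 * q$1 + r$1,
        1/2 * (y1^2 - y2^2) * w$2 + y1 * p$2 - y2 * q$2 + r$2,
        y1 * y2 * w$3 + y1 * q$3 + y2 * p$3 + r$3])"

definition K_const :: "real^3 \<Rightarrow> real^3 \<Rightarrow> real" where
  "K_const c d = (c$1)^2 - (c$2)^2 - (c$3)^2 - (d$1)^2 + (d$2)^2 + (d$3)^2"

definition param_space :: "real^3 \<Rightarrow> real^3 \<Rightarrow> real^3 \<Rightarrow> real^3 \<Rightarrow> param set" where
  "param_space c d e f = {(C, D, C', D', E).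
     Im (C * cnj C') * K_const c d + Im (D * cnj D') * K_const e f = 0}"

section \<open>The quotient of R^3 by Z\<close>

definition deck :: "int \<Rightarrow> real \<times> real \<times> real \<Rightarrow> real \<times> real \<times> real" where
  "deck n = (\<lambda>(y1, y2, t). ((-1) powi n * y1, (-1) powi n * y2, t + 2 * pi * n))"

definition deck_orbit :: "real \<times> real \<times> real \<Rightarrow> (real \<times> real \<times> real) set" where
  "deck_orbit x = range (\<lambda>n. deck n x)"

text \<open>\<open>\<pi>\<close> identifies R^3 / Z with \<open>X\<close>. When \<open>X\<close> is an embedded 3-dimensional submanifold,
  \<open>\<pi>\<close> is a local diffeomorphism onto it, so this identification is a diffeomorphism.\<close>

definition exhibits_quotient ::
    "(real \<times> real \<times> real \<Rightarrow> 'b::euclidean_space) \<Rightarrow> 'b set \<Rightarrow> bool" where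
  "exhibits_quotient \<pi> X \<longleftrightarrow> smooth_map \<pi> \<and> (\<forall>x. immersive_at \<pi> x) \<and> range \<pi> = X \<and>
     (\<forall>x x'. \<pi> x = \<pi> x' \<longleftrightarrow> deck_orbit x = deck_orbit x')"

text \<open>\<open>\<Phi>\<close> is a smooth immersion that descends to R^3 / Z, which is diffeomorphic to
  S^1 x R^2 (realised as the submanifold S^1 x C of C x C); \<open>F\<close> is the induced immersion
  of S^1 x R^2.\<close>

definition immersed_S1xR2 :: "(real \<times> real \<times> real \<Rightarrow> complex^3) \<Rightarrow> bool" where
  "immersed_S1xR2 \<Phi> \<longleftrightarrow> smooth_map \<Phi> \<and> (\<forall>x. immersive_at \<Phi> x) \<and>
     (\<exists>(\<pi> :: real \<times> real \<times> real \<Rightarrow> complex \<times> complex) F.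
        exhibits_quotient \<pi> (sphere 0 1 \<times> UNIV) \<and> (\<forall>x. \<Phi> x = F (\<pi> x)))"

section \<open>The cone and its double cover\<close>

definition quadric_cone :: "real^3 \<Rightarrow> (real^3) set" where
  "quadric_cone a = {x. 0 \<le> x$1 \<and> a$1 * (x$1)^2 + a$2 * (x$2)^2 + a$3 * (x$3)^2 = 0}"

definition cone_point :: "real^3 \<Rightarrow> real^3 \<Rightarrow> real \<Rightarrow> complex^3" where
  "cone_point a x t = vector [\<i> * cis (a$1 * t) * x$1, cis (a$2 * t) * x$2, cis (a$3 * t) * x$3]"

definition T2_cone :: "real^3 \<Rightarrow> (complex^3) set" where
  "T2_cone a = {cone_point a x t | x t. x \<in> quadric_cone a}"

definition Phi0 :: "real^3 \<Rightarrow> real^3 \<Rightarrow> real \<times> real \<times> real \<Rightarrow> complex^3" where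
  "Phi0 a \<alpha> = (\<lambda>(y1, y2, t). vector
     [\<i> / 2 * (y1^2 + y2^2) * sqrt (\<alpha>$1) * cis (a$1 * t),
      1/2 * (y1^2 - y2^2) * sqrt (\<alpha>$2) * cis (a$2 * t),
      y1 * y2 * sqrt (\<alpha>$3) * cis (a$3 * t)])"

definition quad_point :: "real^3 \<Rightarrow> real \<Rightarrow> real \<Rightarrow> real^3" where
  "quad_point \<alpha> y1 y2 = vector
     [1/2 * (y1^2 + y2^2) * sqrt (\<alpha>$1), 1/2 * (y1^2 - y2^2) * sqrt (\<alpha>$2), y1 * y2 * sqrt (\<alpha>$3)]"

text \<open>\<open>Phi0\<close> double covers the cone as parametrised by \<open>x \<in> quadric_cone a\<close> and
  t in R / 2 pi Z, away from the vertex: over each (x, t mod 2 pi) with x \<noteq> 0 there lie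
  exactly two points of R^3 / Z. This is not the same as counting preimages of points of the
  set \<open>T2_cone a\<close>: if \<open>a$1\<close> is even, the parametrisation itself is 2:1, because
  (x_1, x_2, x_3, t) and (x_1, -x_2, -x_3, t + pi) give the same point.\<close>

definition double_covers_parametrised_cone :: "real^3 \<Rightarrow> real^3 \<Rightarrow> bool" where
  "double_covers_parametrised_cone a \<alpha> \<longleftrightarrow>
     (\<forall>y1 y2 t. Phi0 a \<alpha> (y1, y2, t) = cone_point a (quad_point \<alpha> y1 y2) t) \<and>
     (\<forall>x \<in> quadric_cone a - {0}. \<forall>t.
        card (deck_orbit ` {(y1, y2, t'). quad_point \<alpha> y1 y2 = x \<and> cis t' = cis t}) = 2)"

definition two_to_one_onto :: "(real \<times> real \<times> real \<Rightarrow> complex^3) \<Rightarrow> (complex^3) set \<Rightarrow> bool" where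
  "two_to_one_onto \<Psi> K \<longleftrightarrow> (\<forall>z \<in> K - {0}. card (deck_orbit ` {v. \<Psi> v = z}) = 2)"

text \<open>\<open>\<Phi> - \<Psi> = O(r^(1/2))\<close> as \<open>r = |\<Psi>|\<close> tends to infinity, both maps being defined on
  R^3 / Z.\<close>

definition weakly_asymptotic_half ::
    "(real \<times> real \<times> real \<Rightarrow> complex^3) \<Rightarrow> (real \<times> real \<times> real \<Rightarrow> complex^3) \<Rightarrow> bool" where
  "weakly_asymptotic_half \<Phi> \<Psi> \<longleftrightarrow>
     (\<forall>n x. \<Phi> (deck n x) = \<Phi> x \<and> \<Psi> (deck n x) = \<Psi> x) \<and>
     (\<lambda>x. norm (\<Phi> x - \<Psi> x))
       \<in> O[filtercomap (\<lambda>x. norm (\<Psi> x)) at_top](\<lambda>x. norm (\<Psi> x) powr (1/2))"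

end

theory Submission
  imports Defs
begin

text \<open>Two independent vectors \<open>u\<close>, \<open>v\<close> of C^3 with omega(u, v) = 0 lie in exactly one special Lagrangian
  plane: the third direction is the conjugate of their complex cross product \<open>u \<times> v\<close>. At a point
  (y_1, y_2, t) let \<open>u\<close>, \<open>v\<close> be the derivatives of Phi in y_1 and y_2; they are affine in
  (y_1, y_2). So Phi is special Lagrangian wherever it is an immersion as soon as
  d Phi / dt = cnj (u \<times> v) / 2 and omega(u, v) = 0 everywhere, and then it is an immersion exactly
  where \<open>u \<times> v\<close> is nonzero.

  Comparing coefficients of y_1 and y_2, the first condition is a system of ordinary differential
  equations: quadratic for w, linear over w for p and q, and an antiderivative for r. After the
  phases cis (a_j t) are split off, the linear equation has constant coefficients and becomes the
  eigenvalue equation of the matrix M; only the combinations C cis (l t / 2) and D cis (3 l t / 2)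
  enter. The second condition follows from the fact that M is self-adjoint for the indefinite form
  diag (1, -1, -1, -1, 1, 1): distinct eigenspaces are orthogonal, so omega(u, v) depends
  neither on y_1, y_2 nor on t, and its value is, up to sign, the left-hand side of the equation
  that defines the parameter space (\<open>isotropic_modes\<close>).

  For the generic statement, the form just mentioned is positive on the two eigenvectors
  (\<open>K_const_pos\<close>), so the parameter space is a real hypersurface, of dimension 13 near each of its
  points. A member that is not immersed has m u + n v = 0 at some point, for real (m, n) on the unit
  circle. Without the phases this is a real linear system, whose solutions can be written down:
  they are parametrised by t, by the angle of (m, n) and by four real numbers. Together with E this
  gives a smooth image of a 12-dimensional space (\<open>degenerate_of_not_immersive\<close>).

  The cone is the image of the member with all parameters zero. The other members differ from it
  by terms affine in (y_1, y_2) with coefficients bounded in t, while its own norm grows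
  quadratically; this gives the asymptotics and, since Phi is then proper modulo the deck
  transformations, the closedness of the image. Its symmetries are a matter of arithmetic: since
  a_1 and a_2 are coprime, the only coincidence between points with different t modulo 2 pi is
  the shift of t by pi, and it occurs exactly when a_1 is even. This governs both the number of
  preimages and the choice of the lattice in the torus that parametrises the link.\<close>

section \<open>Calculus of smooth maps\<close>

text \<open>The predicate \<open>Ck\<close> speaks of the chosen derivative; this lets any known derivative be used.\<close>

lemma Ck_SucI:
  assumes "\<And>x. (f has_derivative f' x) (at x)" "\<And>v. Ck k (\<lambda>x. f' x v)"
  shows "Ck (Suc k) f"
proof -
  have "frechet_derivative f (at x) = f' x" for x
    using frechet_derivative_at[OF assms(1)] by simp
  moreover have "f differentiable_on UNIV"
    using assms(1) by (auto simp: differentiable_on_def differentiable_def)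
  ultimately show ?thesis using assms(2) by simp
qed

lemma Ck_Suc_has_derivative:
  assumes "Ck (Suc k) f"
  shows "(f has_derivative frechet_derivative f (at x)) (at x)"
  using assms by (simp add: differentiable_on_def frechet_derivative_works)

lemma Ck_Suc_imp_Ck: "Ck (Suc k) f \<Longrightarrow> Ck k f"
proof (induction k arbitrary: f)
  case 0
  then show ?case by (simp add: differentiable_imp_continuous_on)
next
  case (Suc k)
  then show ?case by (metis Ck.simps(2))
qed

lemma Ck_const: "Ck k (\<lambda>x. c)"
proof (induction k arbitrary: c)
  case (Suc k)
  show ?case by (rule Ck_SucI[where f' = "\<lambda>x v. 0"]) (auto intro: Suc)
qed simp

lemma Ck_linear: "bounded_linear L \<Longrightarrow> Ck k L"
proof (cases k)
  case (Suc n)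
  assume "bounded_linear L"
  then show ?thesis unfolding Suc
    by (intro Ck_SucI[where f' = "\<lambda>x. L"]) (auto intro: Ck_const bounded_linear_imp_has_derivative)
qed (simp add: linear_continuous_on)

lemma Ck_linear_comp: "bounded_linear L \<Longrightarrow> Ck k f \<Longrightarrow> Ck k (\<lambda>x. L (f x))"
proof (induction k arbitrary: f)
  case 0
  then show ?case by (simp add: bounded_linear.continuous_on)
next
  case (Suc k)
  show ?case
    by (rule Ck_SucI[OF bounded_linear.has_derivative[OF Suc.prems(1) Ck_Suc_has_derivative[OF Suc.prems(2)]]])
       (use Suc in auto)
qed

text \<open>Together with bilinear maps, \<open>cis\<close> and positive powers, composition with linear maps generates
  all maps whose smoothness is needed below, so that no general chain rule for \<open>Ck\<close> is developed.\<close>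

lemma Ck_comp_linear: "bounded_linear L \<Longrightarrow> Ck k f \<Longrightarrow> Ck k (\<lambda>x. f (L x))"
proof (induction k arbitrary: f)
  case 0
  then show ?case
    using continuous_on_compose2[of UNIV f UNIV L] by (auto intro: linear_continuous_on)
next
  case (Suc k)
  have "((\<lambda>x. f (L x)) has_derivative (\<lambda>v. frechet_derivative f (at (L x)) (L v))) (at x)" for x
    by (rule has_derivative_compose[OF bounded_linear_imp_has_derivative Ck_Suc_has_derivative])
       (use Suc in auto)
  then show ?case using Suc by (intro Ck_SucI) auto
qed

lemma Ck_add: "Ck k f \<Longrightarrow> Ck k g \<Longrightarrow> Ck k (\<lambda>x. f x + g x)"
proof (induction k arbitrary: f g)
  case 0
  then show ?case by (auto intro: continuous_intros)
next
  case (Suc k)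
  show ?case
    by (rule Ck_SucI[OF has_derivative_add[OF Ck_Suc_has_derivative Ck_Suc_has_derivative]])
       (use Suc in auto)
qed

text \<open>The product rule lowers the order of one factor at a time, so the induction needs both factors
  also at the lower order, which is where \<open>Ck_Suc_imp_Ck\<close> enters.\<close>

lemma Ck_bilinear:
  assumes B: "bounded_bilinear B"
  shows "Ck k f \<Longrightarrow> Ck k g \<Longrightarrow> Ck k (\<lambda>x. B (f x) (g x))"
proof (induction k arbitrary: f g)
  case 0
  then show ?case by (auto intro: bounded_bilinear.continuous_on[OF B])
next
  case (Suc k)
  show ?case
    by (rule Ck_SucI[OF bounded_bilinear.FDERIV[OF B Ck_Suc_has_derivative Ck_Suc_has_derivative]])
       (use Suc Ck_Suc_imp_Ck[OF Suc.prems(1)] Ck_Suc_imp_Ck[OF Suc.prems(2)] in \<open>auto intro!: Ck_add Suc.IH\<close>)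
qed

lemma Ck_cis:
  fixes f :: "'a::euclidean_space \<Rightarrow> real"
  shows "Ck k f \<Longrightarrow> Ck k (\<lambda>x. cis (f x))"
proof (induction k)
  case 0
  then show ?case by (auto intro!: continuous_intros)
next
  case (Suc k)
  have "((\<lambda>x. cis (f x)) has_derivative
      (\<lambda>v. of_real (frechet_derivative f (at x) v) * (\<i> * cis (f x)))) (at x)" for x
    by (rule has_derivative_eq_rhs[OF has_derivative_cis[OF Ck_Suc_has_derivative[OF Suc.prems]]])
       (auto simp: scaleR_conv_of_real)
  then show ?case
    by (rule Ck_SucI) (use Suc Ck_Suc_imp_Ck[OF Suc.prems(1)] in \<open>auto intro!: Ck_bilinear[OF bounded_bilinear_mult]
      Ck_linear_comp[OF bounded_linear_of_real] Ck_const\<close>)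
qed

lemma Ck_powr:
  fixes f :: "'a::euclidean_space \<Rightarrow> real"
  assumes pos: "\<And>x. f x > 0"
  shows "Ck k f \<Longrightarrow> Ck k (\<lambda>x. f x powr s)"
proof (induction k arbitrary: s)
  case 0
  have "\<And>x. f x \<noteq> 0" using pos by (metis less_irrefl)
  with 0 show ?case by (auto intro!: continuous_intros)
next
  case (Suc k)
  have "((\<lambda>x. f x powr s) has_derivative
      (\<lambda>v. (s * f x powr (s - 1)) * frechet_derivative f (at x) v)) (at x)" for x
  proof -
    have "((\<lambda>y. y powr s) has_derivative (\<lambda>h. (s * f x powr (s - 1)) * h)) (at (f x))"
      using has_real_derivative_powr[OF pos, of s x] by (simp add: has_field_derivative_def)
    from has_derivative_compose[OF Ck_Suc_has_derivative[OF Suc.prems] this]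
    show ?thesis .
  qed
  then show ?case
    by (rule Ck_SucI) (use Suc Ck_Suc_imp_Ck[OF Suc.prems(1)] in \<open>auto intro!: Ck_bilinear[OF bounded_bilinear_mult] Ck_const\<close>)
qed

lemma smooth_const: "smooth_map (\<lambda>x. c)"
  and smooth_linear: "bounded_linear L \<Longrightarrow> smooth_map L"
  and smooth_linear_comp: "bounded_linear L \<Longrightarrow> smooth_map f \<Longrightarrow> smooth_map (\<lambda>x. L (f x))"
  and smooth_comp_linear: "bounded_linear L' \<Longrightarrow> smooth_map f' \<Longrightarrow> smooth_map (\<lambda>x. f' (L' x))"
  and smooth_add: "smooth_map f \<Longrightarrow> smooth_map g \<Longrightarrow> smooth_map (\<lambda>x. f x + g x)"
  and smooth_bilinear: "bounded_bilinear B \<Longrightarrow> smooth_map f \<Longrightarrow> smooth_map h \<Longrightarrow> smooth_map (\<lambda>x. B (f x) (h x))"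
  by (simp_all add: smooth_map_def Ck_const Ck_linear Ck_linear_comp Ck_comp_linear Ck_add Ck_bilinear)

lemma smooth_cis: "smooth_map f \<Longrightarrow> smooth_map (\<lambda>x. cis (f x))"
  and smooth_powr: "(\<And>x. f x > 0) \<Longrightarrow> smooth_map f \<Longrightarrow> smooth_map (\<lambda>x. f x powr s)"
  by (simp_all add: smooth_map_def Ck_cis Ck_powr)

lemmas smooth_mult = smooth_bilinear[OF bounded_bilinear_mult]
  and smooth_of_real = smooth_linear_comp[OF bounded_linear_of_real]

lemma smooth_cos:
  fixes f :: "'a::euclidean_space \<Rightarrow> real"
  shows "smooth_map f \<Longrightarrow> smooth_map (\<lambda>x. cos (f x))"
  using smooth_linear_comp[OF bounded_linear_Re smooth_cis, of f] by simp

lemma smooth_sin: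
  fixes f :: "'a::euclidean_space \<Rightarrow> real"
  shows "smooth_map f \<Longrightarrow> smooth_map (\<lambda>x. sin (f x))"
  using smooth_linear_comp[OF bounded_linear_Im smooth_cis, of f] by simp

lemma smooth_minus:
  assumes "smooth_map f" shows "smooth_map (\<lambda>x. - f x)"
  using smooth_linear_comp[OF bounded_linear_minus[OF bounded_linear_ident] assms] by simp

lemma smooth_diff:
  assumes "smooth_map f" "smooth_map g" shows "smooth_map (\<lambda>x. f x - g x)"
  using smooth_add[OF assms(1) smooth_minus[OF assms(2)]] by simp

lemma smooth_power2:
  fixes f :: "'a::euclidean_space \<Rightarrow> 'b::{euclidean_space, real_normed_algebra_1}"
  assumes "smooth_map f" shows "smooth_map (\<lambda>x. (f x)^2)"
  unfolding power2_eq_square by (intro smooth_mult assms)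

lemma smooth_Pair:
  assumes "smooth_map f" "smooth_map g" shows "smooth_map (\<lambda>x. (f x, g x))"
proof -
  have "(\<lambda>x. (f x, g x)) = (\<lambda>x. (f x, 0) + (0, g x))" by simp
  moreover have "smooth_map (\<lambda>x. (f x, 0 :: 'c))"
    by (intro smooth_linear_comp[OF _ assms(1)] bounded_linear_Pair bounded_linear_ident bounded_linear_zero)
  moreover have "smooth_map (\<lambda>x. (0 :: 'b, g x))"
    by (intro smooth_linear_comp[OF _ assms(2)] bounded_linear_Pair bounded_linear_ident bounded_linear_zero)
  ultimately show ?thesis using smooth_add by metis
qed

text \<open>Writing a vector as a sum of linear images of its components reduces analysis in C^3 to C.\<close>

lemma vector3_eq_axis:
  fixes x y z :: complex
  shows "vector [x, y, z] = (axis 1 x + axis 2 y + axis 3 z :: complex^3)"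
  by (simp add: vec_eq_iff forall_3 axis_def)

lemma bounded_linear_axis: "bounded_linear (axis k :: complex \<Rightarrow> complex^3)"
  by (intro linear_conv_bounded_linear[THEN iffD1] linearI) (auto simp: axis_def vec_eq_iff)

lemma smooth_vector3:
  assumes "smooth_map x" "smooth_map y" "smooth_map z"
  shows "smooth_map (\<lambda>t. vector [x t, y t, z t] :: complex^3)"
  unfolding vector3_eq_axis
  by (intro smooth_add smooth_linear_comp[OF bounded_linear_axis] assms)

lemma has_derivative_vector3:
  assumes "(x has_derivative x') F" "(y has_derivative y') F" "(z has_derivative z') F"
  shows "((\<lambda>t. vector [x t, y t, z t] :: complex^3) has_derivative (\<lambda>h. vector [x' h, y' h, z' h])) F"
  unfolding vector3_eq_axis
  by (intro has_derivative_add bounded_linear.has_derivative[OF bounded_linear_axis] assms)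

lemmas smooth_intros = smooth_const smooth_add smooth_diff smooth_minus smooth_mult smooth_of_real
  smooth_power2 smooth_cis smooth_vector3 smooth_Pair
  smooth_linear[OF bounded_linear_ident] smooth_linear[OF bounded_linear_fst] smooth_linear[OF bounded_linear_snd]
  smooth_linear_comp[OF bounded_linear_fst] smooth_linear_comp[OF bounded_linear_snd]

section \<open>Special Lagrangian planes spanned by two vectors and their conjugate cross product\<close>

definition ccross :: "complex^3 \<Rightarrow> complex^3 \<Rightarrow> complex^3" where
  "ccross u v = vector [u$2 * v$3 - u$3 * v$2, u$3 * v$1 - u$1 * v$3, u$1 * v$2 - u$2 * v$1]"

definition cconj :: "complex^3 \<Rightarrow> complex^3" where
  "cconj v = (\<chi> j. cnj (v $ j))"

definition comb3 :: "complex^3 \<Rightarrow> complex^3 \<Rightarrow> complex^3 \<Rightarrow> real \<times> real \<times> real \<Rightarrow> complex^3" where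
  "comb3 u v w = (\<lambda>(h1, h2, h3). h1 *\<^sub>R u + h2 *\<^sub>R v + h3 *\<^sub>R w)"

lemmas scaleR_complex = scaleR_conv_of_real[where 'a = complex]

lemma kaehler_form_eq_sum_Im: "kaehler_form u v = - complex_of_real (\<Sum>j\<in>UNIV. Im (u $ j * cnj (v $ j)))"
proof -
  have "z * cnj z' - z' * cnj z = 2 * \<i> * complex_of_real (Im (z * cnj z'))" for z z'
    by (simp add: complex_eq_iff algebra_simps)
  then show ?thesis unfolding kaehler_form_def
    by (simp only: sum_distrib_left[symmetric] of_real_sum) simp
qed

lemma bounded_linear_comb3: "bounded_linear (comb3 u v w)"
proof -
  have "comb3 u v w = (\<lambda>h. fst h *\<^sub>R u + fst (snd h) *\<^sub>R v + snd (snd h) *\<^sub>R w)"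
    by (auto simp: comb3_def)
  moreover have "bounded_linear (\<lambda>h. fst h *\<^sub>R u + fst (snd h) *\<^sub>R v + snd (snd h) *\<^sub>R w)"
    by (intro bounded_linear_add bounded_linear_scaleR_const bounded_linear_fst
        bounded_linear_fst_comp bounded_linear_snd_comp bounded_linear_snd)
  ultimately show ?thesis by simp
qed

text \<open>The form is alternating and real bilinear, so on a span it is determined by the pairs of generators.\<close>

lemma kaehler_form_comb3:
  "kaehler_form (comb3 u v w h) (comb3 u v w k) =
     of_real (fst h * fst (snd k) - fst (snd h) * fst k) * kaehler_form u v +
     of_real (fst h * snd (snd k) - snd (snd h) * fst k) * kaehler_form u w +
     of_real (fst (snd h) * snd (snd k) - snd (snd h) * fst (snd k)) * kaehler_form v w"
proof -
  have "(\<Sum>j\<in>UNIV. comb3 u v w h $ j * cnj (comb3 u v w k $ j) - comb3 u v w k $ j * cnj (comb3 u v w h $ j)) =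
     of_real (fst h * fst (snd k) - fst (snd h) * fst k) * (\<Sum>j\<in>UNIV. u $ j * cnj (v $ j) - v $ j * cnj (u $ j)) +
     of_real (fst h * snd (snd k) - snd (snd h) * fst k) * (\<Sum>j\<in>UNIV. u $ j * cnj (w $ j) - w $ j * cnj (u $ j)) +
     of_real (fst (snd h) * snd (snd k) - snd (snd h) * fst (snd k)) *
       (\<Sum>j\<in>UNIV. v $ j * cnj (w $ j) - w $ j * cnj (v $ j))"
    by (cases h, cases k) (simp add: comb3_def sum_3 scaleR_complex algebra_simps)
  then show ?thesis unfolding kaehler_form_def by (simp only: ring_distribs mult_ac)
qed

lemma holo_volume_form_comb3:
  "\<exists>d::real. holo_volume_form (comb3 u v w h) (comb3 u v w k) (comb3 u v w m) = of_real d * holo_volume_form u v w"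
proof -
  obtain h1 h2 h3 k1 k2 k3 m1 m2 m3 where
    "h = (h1, h2, h3)" "k = (k1, k2, k3)" "m = (m1, m2, m3)" by (metis prod_cases3)
  then have "holo_volume_form (comb3 u v w h) (comb3 u v w k) (comb3 u v w m) =
    of_real (h1*(k2*m3-k3*m2) - h2*(k1*m3-k3*m1) + h3*(k1*m2-k2*m1)) * holo_volume_form u v w"
    by (simp add: comb3_def holo_volume_form_def det_3 scaleR_complex) (simp add: algebra_simps)
  then show ?thesis by blast
qed

text \<open>Pairing with \<open>u \<times> v\<close> kills \<open>u\<close> and \<open>v\<close>, which isolates the third coefficient; crossing with \<open>u\<close> or
  \<open>v\<close> isolates the other two.\<close>

lemma inj_comb3_ccross_iff:
  fixes k :: real
  assumes om: "kaehler_form u v = 0" and k: "k \<noteq> 0"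
  shows "inj (comb3 u v (k *\<^sub>R cconj (ccross u v))) \<longleftrightarrow> ccross u v \<noteq> 0"
proof
  assume i: "inj (comb3 u v (k *\<^sub>R cconj (ccross u v)))"
  show "ccross u v \<noteq> 0"
  proof
    assume "ccross u v = 0"
    then have "comb3 u v (k *\<^sub>R cconj (ccross u v)) (0, 0, 1) = comb3 u v (k *\<^sub>R cconj (ccross u v)) (0, 0, 0)"
      by (simp add: comb3_def cconj_def vec_eq_iff)
    with injD[OF i this] show False by simp
  qed
next
  assume nz: "ccross u v \<noteq> 0"
  let ?n = "ccross u v"
  let ?S = "\<Sum>j\<in>UNIV. ?n $ j * cnj (?n $ j)"
  have S: "?S \<noteq> 0"
  proof -
    have "?S = of_real (\<Sum>j\<in>UNIV. (cmod (?n $ j))^2)"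
      by (simp only: complex_norm_square[symmetric] of_real_sum)
    moreover have "(\<Sum>j\<in>UNIV. (cmod (?n $ j))^2) \<noteq> 0"
      using nz by (auto simp: sum_nonneg_eq_0_iff vec_eq_iff)
    ultimately show ?thesis by (metis of_real_eq_0_iff)
  qed
  show "inj (comb3 u v (k *\<^sub>R cconj ?n))"
  proof (rule linear_injective_0[THEN iffD2, rule_format])
    show "linear (comb3 u v (k *\<^sub>R cconj ?n))" by (rule bounded_linear.linear[OF bounded_linear_comb3])
  next
    fix h assume z: "comb3 u v (k *\<^sub>R cconj ?n) h = 0"
    obtain h1 h2 h3 where h: "h = (h1, h2, h3)" by (metis prod_cases3)
    have c: "of_real h1 * u $ j + of_real h2 * v $ j + of_real h3 * of_real k * cnj (?n $ j) = 0" for j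
      using arg_cong[OF z, of "\<lambda>x. x $ j"]
      by (simp add: h comb3_def cconj_def scaleR_complex)
    have "0 = (\<Sum>j\<in>UNIV. (of_real h1 * u $ j + of_real h2 * v $ j + of_real h3 * of_real k * cnj (?n $ j)) * ?n $ j)"
      by (simp add: c)
    also have "\<dots> = of_real h3 * of_real k * ?S"
      by (simp add: sum_3 ccross_def algebra_simps)
    finally have h3: "h3 = 0" using S k by simp
    have c': "of_real h1 * u $ j + of_real h2 * v $ j = 0" for j using c[of j] h3 by simp
    have det0: "a * (x1 * y2 - x2 * y1) = 0 \<and> b * (x1 * y2 - x2 * y1) = 0"
      if "a * x1 + b * y1 = 0" "a * x2 + b * y2 = 0" for a b x1 x2 y1 y2 :: complex
      using that by algebra
    have "of_real h1 * ?n $ j = 0 \<and> of_real h2 * ?n $ j = 0" if "j \<in> {1,2,3}" for j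
      using that det0[OF c'[of 1] c'[of 2]] det0[OF c'[of 2] c'[of 3]] det0[OF c'[of 3] c'[of 1]]
      unfolding ccross_def by auto
    moreover from nz obtain j where "j \<in> {1,2,3}" "?n $ j \<noteq> 0" by (auto simp: vec_eq_iff forall_3)
    ultimately show "h = 0" using h3 by (auto simp: h zero_prod_def)
  qed
qed

text \<open>The conjugate of \<open>u \<times> v\<close> is Hermitian orthogonal to \<open>u\<close> and \<open>v\<close>, and det (u, v, cnj (u \<times> v)) is
  the squared norm of \<open>u \<times> v\<close>, which is real.\<close>

lemma special_Lagrangian_plane_ccross:
  fixes k :: real
  assumes om: "kaehler_form u v = 0" and nz: "ccross u v \<noteq> 0" and k: "k \<noteq> 0"
  shows "special_Lagrangian_plane (range (comb3 u v (k *\<^sub>R cconj (ccross u v))))"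
proof -
  let ?n = "k *\<^sub>R cconj (ccross u v)"
  let ?F = "comb3 u v ?n"
  have lin: "linear ?F" by (rule bounded_linear.linear[OF bounded_linear_comb3])
  have "inj ?F" using inj_comb3_ccross_iff[OF om k] nz by simp
  then have dim: "dim (range ?F) = 3"
    using dim_image_eq[OF lin, of UNIV] by (simp add: dim_UNIV)
  have un: "kaehler_form u ?n = 0" "kaehler_form v ?n = 0"
    by (simp_all add: kaehler_form_def sum_3 cconj_def ccross_def scaleR_complex algebra_simps)
  have vol: "Im (holo_volume_form u v ?n) = 0"
  proof -
    have "holo_volume_form u v ?n = of_real k * (\<Sum>j\<in>UNIV. ccross u v $ j * cnj (ccross u v $ j))"
      by (simp add: holo_volume_form_def det_3 sum_3 cconj_def ccross_def scaleR_complex algebra_simps)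
    also have "\<dots> = of_real (k * (\<Sum>j\<in>UNIV. (cmod (ccross u v $ j))^2))"
      by (simp only: complex_norm_square[symmetric] of_real_sum of_real_mult)
    finally show ?thesis by simp
  qed
  show ?thesis unfolding special_Lagrangian_plane_def
  proof (intro conjI ballI)
    show "subspace (range ?F)" by (rule linear_subspace_image[OF lin subspace_UNIV])
    show "dim (range ?F) = 3" by (rule dim)
    show "kaehler_form x y = 0" if "x \<in> range ?F" "y \<in> range ?F" for x y
      using that by (auto simp: kaehler_form_comb3 om un)
    show "Im (holo_volume_form x y z) = 0" if "x \<in> range ?F" "y \<in> range ?F" "z \<in> range ?F" for x y z
    proof -
      from that obtain h k m where "x = ?F h" "y = ?F k" "z = ?F m" by auto
      with holo_volume_form_comb3[of u v ?n h k m] obtain d :: real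
        where "holo_volume_form x y z = of_real d * holo_volume_form u v ?n" by auto
      then show ?thesis using vol by simp
    qed
  qed
qed

section \<open>Families of quadrics evolving in time\<close>

definition quad_map :: "(real \<Rightarrow> complex^3) \<Rightarrow> (real \<Rightarrow> complex^3) \<Rightarrow> (real \<Rightarrow> complex^3) \<Rightarrow>
    (real \<Rightarrow> complex^3) \<Rightarrow> real \<times> real \<times> real \<Rightarrow> complex^3" where
  "quad_map w p q r = (\<lambda>(y1, y2, t). vector
     [1/2 * (complex_of_real y1^2 + complex_of_real y2^2) * w t$1 + y1 * p t$1 + y2 * q t$1 + r t$1,
      1/2 * (complex_of_real y1^2 - complex_of_real y2^2) * w t$2 + y1 * p t$2 - y2 * q t$2 + r t$2,
      y1 * y2 * w t$3 + y1 * q t$3 + y2 * p t$3 + r t$3])"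

definition quad_d1 :: "(real \<Rightarrow> complex^3) \<Rightarrow> (real \<Rightarrow> complex^3) \<Rightarrow> (real \<Rightarrow> complex^3) \<Rightarrow>
    real \<times> real \<times> real \<Rightarrow> complex^3" where
  "quad_d1 w p q = (\<lambda>(y1, y2, t). vector
     [y1 * w t$1 + p t$1, y1 * w t$2 + p t$2, y2 * w t$3 + q t$3])"

definition quad_d2 :: "(real \<Rightarrow> complex^3) \<Rightarrow> (real \<Rightarrow> complex^3) \<Rightarrow> (real \<Rightarrow> complex^3) \<Rightarrow>
    real \<times> real \<times> real \<Rightarrow> complex^3" where
  "quad_d2 w p q = (\<lambda>(y1, y2, t). vector
     [y2 * w t$1 + q t$1, - (y2 * w t$2 + q t$2), y1 * w t$3 + p t$3])"

text \<open>The symmetric real bilinear right-hand side of the evolution equations: w' is its value at (w, w), and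
  p' its value at (p, w).\<close>

definition evolution_form :: "complex^3 \<Rightarrow> complex^3 \<Rightarrow> complex^3" where
  "evolution_form u v = vector [1/2 * cnj (u$2 * v$3 + u$3 * v$2),
     - 1/2 * cnj (u$1 * v$3 + u$3 * v$1), - 1/2 * cnj (u$1 * v$2 + u$2 * v$1)]"

lemma smooth_quad_map:
  assumes "smooth_map w" "smooth_map p" "smooth_map q" "smooth_map r"
  shows "smooth_map (quad_map w p q r)"
proof -
  have *: "smooth_map (\<lambda>x. (f (snd (snd x)) $ j :: complex))" if "smooth_map f"
    for f :: "real \<Rightarrow> complex^3" and j
    by (intro smooth_linear_comp[OF bounded_linear_vec_nth] smooth_comp_linear[OF _ that]
        bounded_linear_snd_comp bounded_linear_snd)
  have "quad_map w p q r = (\<lambda>x. vector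
     [1/2 * (complex_of_real (fst x)^2 + complex_of_real (fst (snd x))^2) * w (snd (snd x))$1
        + of_real (fst x) * p (snd (snd x))$1 + of_real (fst (snd x)) * q (snd (snd x))$1 + r (snd (snd x))$1,
      1/2 * (complex_of_real (fst x)^2 - complex_of_real (fst (snd x))^2) * w (snd (snd x))$2
        + of_real (fst x) * p (snd (snd x))$2 - of_real (fst (snd x)) * q (snd (snd x))$2 + r (snd (snd x))$2,
      of_real (fst x) * of_real (fst (snd x)) * w (snd (snd x))$3 + of_real (fst x) * q (snd (snd x))$3
        + of_real (fst (snd x)) * p (snd (snd x))$3 + r (snd (snd x))$3])"
    by (simp add: quad_map_def fun_eq_iff)
  then show ?thesis
    by (simp only:) (intro smooth_intros * assms)
qed

text \<open>Quadrics in C^3 moving so that their trace is special Lagrangian. The four differential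
  equations are the coefficients of y_1^2, y_2^2, y_1 y_2, of y_1, of y_2 and of 1 in
  d Phi / dt = cnj (u \<times> v) / 2.\<close>

locale evolving_quadrics =
  fixes w p q r :: "real \<Rightarrow> complex^3"
  assumes smooth: "smooth_map w" "smooth_map p" "smooth_map q" "smooth_map r"
    and w': "\<And>t. (w has_vector_derivative evolution_form (w t) (w t)) (at t)"
    and p': "\<And>t. (p has_vector_derivative evolution_form (p t) (w t)) (at t)"
    and q': "\<And>t. (q has_vector_derivative evolution_form (q t) (w t)) (at t)"
    and r': "\<And>t. (r has_vector_derivative vector
        [1/2 * cnj (p t$2 * p t$3 + q t$2 * q t$3), - 1/2 * cnj (p t$1 * p t$3 - q t$1 * q t$3),
         - 1/2 * cnj (p t$1 * q t$2 + p t$2 * q t$1)]) (at t)"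
    and isotropic: "\<And>x. kaehler_form (quad_d1 w p q x) (quad_d2 w p q x) = 0"
    and w_nz: "\<And>t j. w t $ j \<noteq> 0"
begin

abbreviation "normal_at \<equiv> \<lambda>x. ccross (quad_d1 w p q x) (quad_d2 w p q x)"

lemma has_derivative_quad_map:
  "(quad_map w p q r has_derivative
     comb3 (quad_d1 w p q x) (quad_d2 w p q x) ((1/2) *\<^sub>R cconj (normal_at x))) (at x)"
proof -
  obtain y1 y2 t where x: "x = (y1, y2, t)" by (metis prod_cases3)
  have comp: "((\<lambda>x. f (snd (snd x)) $ j) has_derivative (\<lambda>h. of_real (snd (snd h)) * f' $ j)) (at x)"
    if "(f has_vector_derivative f') (at t)" for f :: "real \<Rightarrow> complex^3" and f' and j :: 3
  proof -
    have "(f has_derivative (\<lambda>h. h *\<^sub>R f')) (at (snd (snd x)))"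
      using that by (simp add: x has_vector_derivative_def)
    then have "((\<lambda>x. f (snd (snd x))) has_derivative (\<lambda>h. snd (snd h) *\<^sub>R f')) (at x)"
      by (rule has_derivative_compose[rotated]) (auto intro!: derivative_eq_intros)
    from bounded_linear.has_derivative[OF bounded_linear_vec_nth this, of j]
    show ?thesis by (simp add: scaleR_complex)
  qed
  note D = comp[OF w'[of t]] comp[OF p'[of t]] comp[OF q'[of t]] comp[OF r'[of t]]
  have e: "quad_map w p q r = (\<lambda>x. vector
     [1/2 * (complex_of_real (fst x)^2 + complex_of_real (fst (snd x))^2) * w (snd (snd x))$1
        + of_real (fst x) * p (snd (snd x))$1 + of_real (fst (snd x)) * q (snd (snd x))$1 + r (snd (snd x))$1,
      1/2 * (complex_of_real (fst x)^2 - complex_of_real (fst (snd x))^2) * w (snd (snd x))$2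
        + of_real (fst x) * p (snd (snd x))$2 - of_real (fst (snd x)) * q (snd (snd x))$2 + r (snd (snd x))$2,
      of_real (fst x) * of_real (fst (snd x)) * w (snd (snd x))$3 + of_real (fst x) * q (snd (snd x))$3
        + of_real (fst (snd x)) * p (snd (snd x))$3 + r (snd (snd x))$3])"
    by (simp add: quad_map_def fun_eq_iff)
  show ?thesis unfolding e
    apply (rule has_derivative_eq_rhs)
     apply (rule has_derivative_vector3)
       apply (rule D derivative_intros has_derivative_of_real)+
    apply (simp add: fun_eq_iff vec_eq_iff forall_3 comb3_def cconj_def ccross_def x quad_d1_def quad_d2_def
      evolution_form_def scaleR_complex)
    apply (simp add: field_simps power2_eq_square)
    done
qed

lemma frechet_derivative_quad_map:
  "frechet_derivative (quad_map w p q r) (at x) =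
     comb3 (quad_d1 w p q x) (quad_d2 w p q x) ((1/2) *\<^sub>R cconj (normal_at x))"
  using frechet_derivative_at[OF has_derivative_quad_map] by simp

lemma immersive_at_quad_map_iff: "immersive_at (quad_map w p q r) x \<longleftrightarrow> normal_at x \<noteq> 0"
  using has_derivative_quad_map[of x] inj_comb3_ccross_iff[OF isotropic[of x], of "1/2"]
  by (auto simp: immersive_at_def frechet_derivative_quad_map differentiable_def)

lemma special_Lagrangian_at_quad_map:
  "immersive_at (quad_map w p q r) x \<Longrightarrow> special_Lagrangian_at (quad_map w p q r) x"
  using special_Lagrangian_plane_ccross[OF isotropic[of x], of "1/2"]
  by (simp add: special_Lagrangian_at_def immersive_at_quad_map_iff frechet_derivative_quad_map)

text \<open>The first component of \<open>u \<times> v\<close> is a polynomial in y_1 with leading coefficient w_2 w_3, which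
  does not vanish. So on every line in the direction of y_1 the immersive points are dense.\<close>

lemma dense_immersive: "closure {x. immersive_at (quad_map w p q r) x} = UNIV"
proof -
  have "x \<in> closure {x. normal_at x \<noteq> 0}" for x
  proof -
    obtain y1 y2 t where x: "x = (y1, y2, t)" by (metis prod_cases3)
    define P where "P = [: normal_at (0, y2, t) $ 1, p t$2 * w t$3 + p t$3 * w t$2, w t$2 * w t$3 :]"
    have P: "normal_at (y, y2, t) $ 1 = poly P (of_real y)" for y
      by (simp add: P_def ccross_def quad_d1_def quad_d2_def algebra_simps)
    have "P \<noteq> 0" using w_nz by (simp add: P_def)
    then have "finite {z. poly P z = 0}" by (rule poly_roots_finite)
    then have "finite (complex_of_real -` {z. poly P z = 0})"
      by (rule finite_vimageI) (simp add: inj_def)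
    then have fin: "finite {y::real. poly P (of_real y) = 0}" by (simp add: vimage_def)
    have "\<exists>z\<in>{x. normal_at x \<noteq> 0}. dist z x < e" if e: "e > 0" for e
    proof -
      have "infinite {y1<..<y1+e}" using e by simp
      then obtain y where y: "y \<in> {y1<..<y1+e}" "poly P (of_real y) \<noteq> 0"
        by (metis (mono_tags, lifting) fin finite_subset mem_Collect_eq subsetI)
      have "normal_at (y, y2, t) \<noteq> 0" using y(2) P[of y] by (metis zero_index)
      moreover have "dist (y, y2, t) x < e" using y(1) by (simp add: x dist_Pair_Pair dist_real_def)
      ultimately show ?thesis by blast
    qed
    then show ?thesis by (simp add: closure_approachable)
  qed
  then show ?thesis by (auto simp: immersive_at_quad_map_iff)
qed

lemma special_Lagrangian_3fold_quad_map: "special_Lagrangian_3fold (quad_map w p q r)"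
  unfolding special_Lagrangian_3fold_def
  using smooth_quad_map[OF smooth] dense_immersive special_Lagrangian_at_quad_map by blast

end

section \<open>Eigenvectors of the frequency matrix\<close>

lemma vector_6:
 "(vector [x1,x2,x3,x4,x5,x6] ::('a::zero)^6)$1 = x1"
 "(vector [x1,x2,x3,x4,x5,x6] ::('a::zero)^6)$2 = x2"
 "(vector [x1,x2,x3,x4,x5,x6] ::('a::zero)^6)$3 = x3"
 "(vector [x1,x2,x3,x4,x5,x6] ::('a::zero)^6)$4 = x4"
 "(vector [x1,x2,x3,x4,x5,x6] ::('a::zero)^6)$5 = x5"
 "(vector [x1,x2,x3,x4,x5,x6] ::('a::zero)^6)$6 = x6"
  unfolding vector_def by simp_all

lemma exhaust_6: "x = 1 \<or> x = 2 \<or> x = 3 \<or> x = 4 \<or> x = 5 \<or> x = (6 :: 6)"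
proof (induct x)
  case (of_int z)
  then have "z = 0 \<or> z = 1 \<or> z = 2 \<or> z = 3 \<or> z = 4 \<or> z = 5" by fastforce
  then show ?case by auto
qed

lemma UNIV_6: "UNIV = {1, 2, 3, 4, 5, 6 :: 6}"
  using exhaust_6 by blast

lemma sum_6: "sum f (UNIV :: 6 set) = f 1 + f 2 + f 3 + f 4 + f 5 + f 6"
  unfolding UNIV_6 by (simp add: ac_simps)

text \<open>Spelling out the rows avoids index arithmetic in six dimensions afterwards.\<close>

definition eigenpair :: "real^3 \<Rightarrow> real^3 \<Rightarrow> real \<Rightarrow> real^3 \<Rightarrow> real^3 \<Rightarrow> bool" where
  "eigenpair a \<alpha> k c d \<longleftrightarrow>
     k * c$1 = - 2 * a$1 * c$1 - sqrt (\<alpha>$3) * d$2 - sqrt (\<alpha>$2) * d$3 \<and>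
     k * c$2 = - 2 * a$2 * c$2 + sqrt (\<alpha>$3) * d$1 + sqrt (\<alpha>$1) * d$3 \<and>
     k * c$3 = - 2 * a$3 * c$3 + sqrt (\<alpha>$2) * d$1 + sqrt (\<alpha>$1) * d$2 \<and>
     k * d$1 = sqrt (\<alpha>$3) * c$2 + sqrt (\<alpha>$2) * c$3 + 2 * a$1 * d$1 \<and>
     k * d$2 = - sqrt (\<alpha>$3) * c$1 - sqrt (\<alpha>$1) * c$3 + 2 * a$2 * d$2 \<and>
     k * d$3 = - sqrt (\<alpha>$2) * c$1 - sqrt (\<alpha>$1) * c$2 + 2 * a$3 * d$3"

lemma eigenvector_of_M_matD:
  assumes "eigenvector_of (M_mat a \<alpha>) (join6 c d) k"
  shows "eigenpair a \<alpha> k c d" "c \<noteq> 0 \<or> d \<noteq> 0"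
proof -
  have "(M_mat a \<alpha> *v join6 c d) $ i = k * join6 c d $ i" for i
    using assms by (simp add: eigenvector_of_def)
  from this[of 1] this[of 2] this[of 3] this[of 4] this[of 5] this[of 6]
  show "eigenpair a \<alpha> k c d"
    unfolding eigenpair_def
    by (simp add: matrix_vector_mult_def sum_6 M_mat_def join6_def vector_6)
  have "join6 c d \<noteq> 0" using assms by (simp add: eigenvector_of_def)
  moreover have "join6 0 0 $ i = 0" for i
    using exhaust_6[of i] by (auto simp: join6_def vector_6)
  then have "join6 0 0 = 0" by (simp add: vec_eq_iff)
  ultimately show "c \<noteq> 0 \<or> d \<noteq> 0" by metis
qed

text \<open>Exchanging the halves of a vector conjugates M into -M.\<close>

lemma eigenpair_swap: "eigenpair a \<alpha> k c d \<Longrightarrow> eigenpair a \<alpha> (- k) d c"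
  unfolding eigenpair_def by auto

text \<open>The matrix M is self-adjoint for the form diag (1, -1, -1, -1, 1, 1), so eigenvectors of different
  eigenvalues are orthogonal for it.\<close>

lemma eigenpair_orthogonal:
  assumes "eigenpair a \<alpha> k c d" "eigenpair a \<alpha> k' e f" "k \<noteq> k'"
  shows "c$1 * e$1 - c$2 * e$2 - c$3 * e$3 - d$1 * f$1 + d$2 * f$2 + d$3 * f$3 = 0"
proof -
  have *: "(k - k') * (c1*e1 - c2*e2 - c3*e3 - d1*f1 + d2*f2 + d3*f3) = 0"
    if "k * c1 = - 2 * a1 * c1 - s3 * d2 - s2 * d3"
     "k * c2 = - 2 * a2 * c2 + s3 * d1 + s1 * d3"
     "k * c3 = - 2 * a3 * c3 + s2 * d1 + s1 * d2"
     "k * d1 = s3 * c2 + s2 * c3 + 2 * a1 * d1"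
     "k * d2 = - s3 * c1 - s1 * c3 + 2 * a2 * d2"
     "k * d3 = - s2 * c1 - s1 * c2 + 2 * a3 * d3"
     "k' * e1 = - 2 * a1 * e1 - s3 * f2 - s2 * f3"
     "k' * e2 = - 2 * a2 * e2 + s3 * f1 + s1 * f3"
     "k' * e3 = - 2 * a3 * e3 + s2 * f1 + s1 * f2"
     "k' * f1 = s3 * e2 + s2 * e3 + 2 * a1 * f1"
     "k' * f2 = - s3 * e1 - s1 * e3 + 2 * a2 * f2"
     "k' * f3 = - s2 * e1 - s1 * e2 + 2 * a3 * f3"
    for c1 c2 c3 d1 d2 d3 e1 e2 e3 f1 f2 f3 s1 s2 s3 a1 a2 a3 :: real
  proof -
    have "(k - k') * (c1*e1 - c2*e2 - c3*e3 - d1*f1 + d2*f2 + d3*f3) =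
      (k*c1)*e1 - (k*c2)*e2 - (k*c3)*e3 - (k*d1)*f1 + (k*d2)*f2 + (k*d3)*f3
      - c1*(k'*e1) + c2*(k'*e2) + c3*(k'*e3) + d1*(k'*f1) - d2*(k'*f2) - d3*(k'*f3)"
      by (simp add: algebra_simps)
    also have "\<dots> = 0" unfolding that by (simp add: algebra_simps)
    finally show ?thesis .
  qed
  have "(k - k') * (c$1 * e$1 - c$2 * e$2 - c$3 * e$3 - d$1 * f$1 + d$2 * f$2 + d$3 * f$3) = 0"
    using assms(1,2) unfolding eigenpair_def by (elim conjE) (rule *)
  with assms(3) show ?thesis by simp
qed

text \<open>What is used of the integers a_j and l, until periodicity in t matters: \<open>l_sq\<close> separates the
  frequencies, and \<open>alpha\<close> fixes the shape of the cone.\<close>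

locale cone_data =
  fixes a \<alpha> :: "real^3" and l :: real
  assumes alpha: "alpha_rel a \<alpha>"
    and a_sum: "a$1 + a$2 + a$3 = 0"
    and l_pos: "l > 0"
    and l_sq: "l^2 = (a$2)^2 + a$2 * a$3 + (a$3)^2"
begin

abbreviation "s1 \<equiv> sqrt (\<alpha>$1)"
abbreviation "s2 \<equiv> sqrt (\<alpha>$2)"
abbreviation "s3 \<equiv> sqrt (\<alpha>$3)"

lemma alpha_pos: "\<alpha> $ j > 0" using alpha by (simp add: alpha_rel_def)

lemma s_pos: "s1 > 0" "s2 > 0" "s3 > 0" using alpha_pos by simp_all

lemma a_s: "a$1 * s1 = - s2 * s3" "a$2 * s2 = s1 * s3" "a$3 * s3 = s1 * s2"
proof -
  have p: "\<alpha> $ j powr (- 1/2) = 1 / sqrt (\<alpha> $ j)" for j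
    using alpha_pos[of j] by (simp add: powr_minus_divide powr_half_sqrt less_imp_le)
  have *: "(x * y) powr (1/2) = sqrt x * sqrt y" if "x > 0" "y > 0" for x y :: real
    using that by (simp add: powr_half_sqrt real_sqrt_mult)
  have "a$1 = - (1 / s1) * (s2 * s3)" "a$2 = 1 / s2 * (s3 * s1)" "a$3 = 1 / s3 * (s1 * s2)"
    using alpha unfolding alpha_rel_def by (simp_all only: p *[OF alpha_pos alpha_pos])
  then show "a$1 * s1 = - s2 * s3" "a$2 * s2 = s1 * s3" "a$3 * s3 = s1 * s2"
    using s_pos by simp_all
qed

lemma a_sign: "a$1 < 0" "a$2 > 0" "a$3 > 0"
proof -
  have "a$1 * s1 < 0" "a$2 * s2 > 0" "a$3 * s3 > 0" using a_s s_pos by simp_all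
  then show "a$1 < 0" "a$2 > 0" "a$3 > 0"
    using s_pos by (simp_all add: mult_less_0_iff zero_less_mult_iff)
qed

lemma alpha_eq: "\<alpha>$1 = a$2 * a$3" "\<alpha>$2 = - a$1 * a$3" "\<alpha>$3 = - a$1 * a$2"
proof -
  have sq: "\<alpha>$1 = s1 * s1" "\<alpha>$2 = s2 * s2" "\<alpha>$3 = s3 * s3" using alpha_pos by (simp_all add: less_imp_le)
  have "(a$2 * a$3 - s1 * s1) * (s2 * s3) = (a$2 * s2) * (a$3 * s3) - s1 * s1 * (s2 * s3)"
    "(- a$1 * a$3 - s2 * s2) * (s1 * s3) = - (a$1 * s1) * (a$3 * s3) - s2 * s2 * (s1 * s3)"
    "(- a$1 * a$2 - s3 * s3) * (s1 * s2) = - (a$1 * s1) * (a$2 * s2) - s3 * s3 * (s1 * s2)"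
    by (simp_all add: algebra_simps del: real_sqrt_mult_self real_sqrt_mult_self)
  then have "(a$2 * a$3 - s1 * s1) * (s2 * s3) = 0" "(- a$1 * a$3 - s2 * s2) * (s1 * s3) = 0"
    "(- a$1 * a$2 - s3 * s3) * (s1 * s2) = 0"
    unfolding a_s by (simp_all only: mult_ac) simp_all
  then have "a$2 * a$3 = s1 * s1" "- a$1 * a$3 = s2 * s2" "- a$1 * a$2 = s3 * s3"
    using s_pos by simp_all
  then show "\<alpha>$1 = a$2 * a$3" "\<alpha>$2 = - a$1 * a$3" "\<alpha>$3 = - a$1 * a$2"
    using sq by simp_all
qed

text \<open>These are the frequencies by which the terms of r are divided. Since a_2 and a_3 are positive,
  \<open>l_sq\<close> puts both below l, and -a_1 = a_2 + a_3 strictly between l and 2 l.\<close>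

lemma nonresonant:
  assumes "k \<in> {0, 1, -1, 2, -2, 3, -3 :: real}"
  shows "a$j + k * l \<noteq> 0"
proof -
  have "a$2 < l" "a$3 < l" 
    using l_sq a_sign l_pos by (auto intro!: power2_less_imp_less[of _ l] simp: add_pos_pos)
  moreover have "l < - a$1" "- a$1 < 2 * l"
  proof -
    have e: "- a$1 = a$2 + a$3" using a_sum by simp
    show "l < - a$1" unfolding e
      using l_sq a_sign mult_pos_pos[OF a_sign(2,3)]
      by (intro power2_less_imp_less[of l]) (auto simp: power2_sum algebra_simps)
    have "(2 * l)^2 - (a$2 + a$3)^2 = 3 * (a$2)^2 + 2 * (a$2 * a$3) + 3 * (a$3)^2"
      unfolding power_mult_distrib l_sq by (simp add: power2_sum algebra_simps)
    moreover have "\<dots> > 0" using a_sign by (intro add_pos_pos mult_pos_pos zero_less_power) auto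
    ultimately show "- a$1 < 2 * l" unfolding e
      using l_pos by (intro power2_less_imp_less[of _ "2 * l"]) auto
  qed
  ultimately show ?thesis using assms a_sign l_pos exhaust_3[of j] by auto
qed

text \<open>In terms of the sum and the difference of the two halves the eigenvalue equation exchanges two
  vectors of R^3, one of which gives the real and the other the imaginary parts of the modes.\<close>

lemma eigenpair_sum_diff:
  assumes "eigenpair a \<alpha> k c d"
  defines "S \<equiv> c + d" and "T \<equiv> c - d"
  shows "k * S$1 = - 2 * a$1 * T$1 + s3 * T$2 + s2 * T$3"
    "k * S$2 = - 2 * a$2 * T$2 - s3 * T$1 - s1 * T$3"
    "k * S$3 = - 2 * a$3 * T$3 - s2 * T$1 - s1 * T$2"
    "k * T$1 = - 2 * a$1 * S$1 - s3 * S$2 - s2 * S$3"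
    "k * T$2 = - 2 * a$2 * S$2 + s3 * S$1 + s1 * S$3"
    "k * T$3 = - 2 * a$3 * S$3 + s2 * S$1 + s1 * S$2"
  using assms(1) unfolding eigenpair_def S_def T_def by (simp_all add: algebra_simps)

text \<open>This is orthogonality to the vector of the kernel of M both of whose halves consist of the
  sqrt (alpha_j). It makes the terms of omega(u, v) that are linear in y_1 and y_2 cancel.\<close>

lemma eigenpair_plane:
  assumes "eigenpair a \<alpha> k c d" "k \<noteq> 0"
  shows "s1 * (c - d)$1 = s2 * (c - d)$2 + s3 * (c - d)$3"
proof -
  note E = eigenpair_sum_diff[OF assms(1)]
  have "k * (s1 * (c - d)$1 - s2 * (c - d)$2 - s3 * (c - d)$3)
      = s1 * (k * (c - d)$1) - s2 * (k * (c - d)$2) - s3 * (k * (c - d)$3)"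
    by (simp add: algebra_simps)
  also have "\<dots> = - 2 * (a$1 * s1) * (c+d)$1 + 2 * (a$2 * s2) * (c+d)$2 + 2 * (a$3 * s3) * (c+d)$3
      - 2 * s2 * s3*(c+d)$1 - 2 * s1 * s3*(c+d)$2 - 2 * s1 * s2*(c+d)$3"
    unfolding E by (simp add: algebra_simps)
  also have "\<dots> = 0" unfolding a_s by (simp add: algebra_simps)
  finally show ?thesis using assms(2) by simp
qed

text \<open>Up to positive factors, K is the sum of squares (X_1 - X_2)^2 + (X_1 - X_3)^2 + (X_2 - X_3)^2.
  It vanishes only on the kernel of M, that is for the eigenvalue 0.\<close>

lemma K_const_pos:
  assumes ep: "eigenpair a \<alpha> k c d" and k: "k > 0" and nz: "c \<noteq> 0 \<or> d \<noteq> 0"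
  shows "K_const c d > 0"
proof -
  define S T where ST: "S = c + d" "T = c - d"
  note E = eigenpair_sum_diff[OF ep, folded ST]
  define X1 X2 X3 where X: "X1 = s2 * s3*S$1" "X2 = s1 * s3*S$2" "X3 = s1 * s2*S$3"
  have K: "K_const c d = S$1 * T$1 - S$2 * T$2 - S$3 * T$3"
    by (simp add: K_const_def ST power2_eq_square algebra_simps)
  have T: "k * (s1 * T$1) = 2 * X1 - X2 - X3" "k * (s2 * T$2) = - 2 * X2 + X1 + X3"
     "k * (s3 * T$3) = - 2 * X3 + X1 + X2"
  proof -
    have "k * (s1 * T$1) = - 2 * (a$1 * s1) * S$1 - s1 * s3*S$2 - s1 * s2*S$3"
      using arg_cong[OF E(4), of "\<lambda>x. s1 * x"] by (simp add: algebra_simps)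
    then show "k * (s1 * T$1) = 2 * X1 - X2 - X3" unfolding a_s by (simp add: X)
    have "k * (s2 * T$2) = - 2 * (a$2 * s2) * S$2 + s2 * s3*S$1 + s1 * s2*S$3"
      using arg_cong[OF E(5), of "\<lambda>x. s2 * x"] by (simp add: algebra_simps)
    then show "k * (s2 * T$2) = - 2 * X2 + X1 + X3" unfolding a_s by (simp add: X)
    have "k * (s3 * T$3) = - 2 * (a$3 * s3) * S$3 + s2 * s3*S$1 + s1 * s3*S$2"
      using arg_cong[OF E(6), of "\<lambda>x. s3 * x"] by (simp add: algebra_simps)
    then show "k * (s3 * T$3) = - 2 * X3 + X1 + X2" unfolding a_s by (simp add: X)
  qed
  have "s1 * s2 * s3 * (k * K_const c d) = X1 * (k * (s1*T$1)) - X2 * (k * (s2*T$2)) - X3 * (k * (s3*T$3))"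
    unfolding K X by (simp add: algebra_simps)
  also have "\<dots> = (X1 - X2)^2 + (X1 - X3)^2 + (X2 - X3)^2"
    unfolding T by (simp add: algebra_simps power2_eq_square)
  finally have KX: "s1 * s2 * s3 * (k * K_const c d) = (X1 - X2)^2 + (X1 - X3)^2 + (X2 - X3)^2" .
  have "\<not> (X1 = X2 \<and> X1 = X3)"
  proof
    assume "X1 = X2 \<and> X1 = X3"
    then have "k * (s1 * T$1) = 0" "k * (s2 * T$2) = 0" "k * (s3 * T$3) = 0" using T by simp_all
    then have T0: "T$1 = 0" "T$2 = 0" "T$3 = 0" using k s_pos by simp_all
    with E(1-3) k have "S$1 = 0" "S$2 = 0" "S$3 = 0" by simp_all
    with T0 have "c = 0" "d = 0" by (auto simp: ST vec_eq_iff forall_3)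
    with nz show False by simp
  qed
  then have "(X1 - X2)^2 > 0 \<or> (X1 - X3)^2 > 0" by auto
  then have "s1 * s2 * s3 * (k * K_const c d) > 0"
    unfolding KX by (smt (verit) zero_le_power2)
  moreover have "s1 * s2 * s3 > 0" using s_pos by simp
  ultimately show ?thesis using k by (meson zero_less_mult_pos)
qed

end

locale special_family = cone_data +
  fixes c d e f :: "real^3"
  assumes ep1: "eigenpair a \<alpha> l c d" and nz1: "c \<noteq> 0 \<or> d \<noteq> 0"
    and ep3: "eigenpair a \<alpha> (3 * l) e f" and nz3: "e \<noteq> 0 \<or> f \<noteq> 0"
begin

lemma K1_pos: "K_const c d > 0" using K_const_pos ep1 nz1 l_pos by blast

lemma K3_pos: "K_const e f > 0" using K_const_pos[OF ep3] nz3 l_pos by simp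

lemma orthogonal_modes:
  "c$1 * e$1 - c$2 * e$2 - c$3 * e$3 - d$1 * f$1 + d$2 * f$2 + d$3 * f$3 = 0"
  "c$1 * f$1 - c$2 * f$2 - c$3 * f$3 - d$1 * e$1 + d$2 * e$2 + d$3 * e$3 = 0"
  using eigenpair_orthogonal[OF ep1 ep3] eigenpair_orthogonal[OF ep1 eigenpair_swap[OF ep3]] l_pos
  by simp_all

end

section \<open>The family solves the evolution equations\<close>

lemma has_vector_derivative_cis:
  "((\<lambda>t. K * cis (\<omega> * t)) has_vector_derivative (\<i> * complex_of_real \<omega> * K * cis (\<omega> * t))) (at t)"
  unfolding has_vector_derivative_def
  by (rule derivative_eq_intros refl)+ (simp add: fun_eq_iff scaleR_complex algebra_simps)

lemma has_vector_derivative_vector3: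
  assumes "(x has_vector_derivative x') F" "(y has_vector_derivative y') F" "(z has_vector_derivative z') F"
  shows "((\<lambda>t. vector [x t, y t, z t] :: complex^3) has_vector_derivative vector [x', y', z']) F"
proof -
  have "(\<lambda>h. vector [h *\<^sub>R x', h *\<^sub>R y', h *\<^sub>R z']) = (\<lambda>h. h *\<^sub>R (vector [x', y', z'] :: complex^3))"
    by (simp add: fun_eq_iff vec_eq_iff forall_3)
  then show ?thesis
    using has_derivative_vector3[OF assms[unfolded has_vector_derivative_def]]
    unfolding has_vector_derivative_def by simp
qed

text \<open>The common shape of p_j and q_j once their phase is split off.\<close>

definition mode :: "real^3 \<Rightarrow> real^3 \<Rightarrow> real^3 \<Rightarrow> real^3 \<Rightarrow> complex \<Rightarrow> complex \<Rightarrow> 3 \<Rightarrow> complex" where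
  "mode c d e f C D j = C * c$j + cnj C * d$j + D * e$j + cnj D * f$j" for C D :: complex

lemma cis_shift:
  "cis ((x + l/2) * t) = cis (x * t) * cis (l/2 * t)"
  "cis ((x - l/2) * t) = cis (x * t) * cnj (cis (l/2 * t))"
  "cis ((x + 3*l/2) * t) = cis (x * t) * cis (3*l/2 * t)"
  "cis ((x - 3*l/2) * t) = cis (x * t) * cnj (cis (3*l/2 * t))"
  by (simp_all add: cis_cnj cis_mult algebra_simps add_divide_distrib diff_divide_distrib)

lemma lin_term_eq_mode:
  "lin_term a l c d e f C D j t = mode c d e f (C * cis (l/2 * t)) (D * cis (3*l/2 * t)) j * cis (a$j * t)"
  unfolding lin_term_def mode_def cis_shift by (simp add: algebra_simps)

text \<open>An antiderivative of \<open>\<i>\<close> times the conjugate of a product of two linear terms: one summand for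
  each pair of frequencies, divided by the resulting frequency. The components of r are sums of
  such terms, and it is simpler to differentiate this bilinear expression once than to
  differentiate them separately.\<close>

definition osc :: "real^3 \<Rightarrow> real \<Rightarrow> real^3 \<Rightarrow> real^3 \<Rightarrow> real^3 \<Rightarrow> real^3 \<Rightarrow> 3 \<Rightarrow> 3 \<Rightarrow> 3 \<Rightarrow>
    complex \<Rightarrow> complex \<Rightarrow> complex \<Rightarrow> complex \<Rightarrow> real \<Rightarrow> complex" where
  "osc a l c d e f j k m C D C' D' t = (let g = \<lambda>\<omega>. cis ((a$j + \<omega>) * t) / complex_of_real (a$j + \<omega>) in
     D * D' * f$k * f$m * g (3*l) + cnj D * cnj D' * e$k * e$m * g (- (3*l))
     + (C * C' * d$k * d$m + cnj C * D' * c$k * f$m + D * cnj C' * f$k * c$m) * g l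
     + (cnj C * cnj C' * c$k * c$m + C * cnj D' * d$k * e$m + cnj D * C' * e$k * d$m) * g (- l)
     + (C * D' * d$k * f$m + D * C' * f$k * d$m) * g (2*l)
     + (cnj C * cnj D' * c$k * e$m + cnj D * cnj C' * e$k * c$m) * g (- (2*l))
     + (cnj C * C' * c$k * d$m + C * cnj C' * d$k * c$m + cnj D * D' * e$k * f$m + D * cnj D' * f$k * e$m) * g 0)"
  for C D C' D' :: complex

text \<open>The terms of odd and of even frequency together are exactly the bilinear oscillations
  of the pairs of linear terms that occur in the evolution equation of r.\<close>

lemma r_fun_eq_osc:
  "r_main a l c d e f C D C' D' E t + r_even a l c d e f C D C' D' t = vector
     [- \<i>/2 * (osc a l c d e f 1 2 3 C D C D t + osc a l c d e f 1 2 3 C' D' C' D' t) + E$1,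
      1/2 * (osc a l c d e f 2 1 3 C D C D t - osc a l c d e f 2 1 3 C' D' C' D' t) + E$2,
      1/2 * (osc a l c d e f 3 1 2 C D C' D' t + osc a l c d e f 3 1 2 C' D' C D t) + E$3]"
proof -
  \<comment> \<open>Matching the summands frequency by frequency keeps the remaining identities short.\<close>
  have collect1: "L1 - L2 - L3 - L4 + E0 + (M1 - M2 - M3) = \<kappa> * ((P1+P2+P3+P4+P5+P6+P7) + (Q1+Q2+Q3+Q4+Q5+Q6+Q7)) + E0"
    if "L1 = \<kappa> * (P1 + Q1)" "L2 = - (\<kappa> * (P2 + Q2))" "L3 = - (\<kappa> * (P3 + Q3))" "L4 = - (\<kappa> * (P4 + Q4))" "M1 = \<kappa> * (P5 + Q5)" "M2 = - (\<kappa> * (P6 + Q6))" "M3 = - (\<kappa> * (P7 + Q7))"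
    for L1 L2 L3 L4 M1 M2 M3 P1 P2 P3 P4 P5 P6 P7 Q1 Q2 Q3 Q4 Q5 Q6 Q7 \<kappa> E0 :: complex
    unfolding that by (simp add: algebra_simps)
  have collect2: "L1 + L2 + L3 + L4 + E0 + (M1 + M2 + M3) = \<kappa> * ((P1+P2+P3+P4+P5+P6+P7) - (Q1+Q2+Q3+Q4+Q5+Q6+Q7)) + E0"
    if "L1 = \<kappa> * (P1 - Q1)" "L2 = \<kappa> * (P2 - Q2)" "L3 = \<kappa> * (P3 - Q3)" "L4 = \<kappa> * (P4 - Q4)" "M1 = \<kappa> * (P5 - Q5)" "M2 = \<kappa> * (P6 - Q6)" "M3 = \<kappa> * (P7 - Q7)"
    for L1 L2 L3 L4 M1 M2 M3 P1 P2 P3 P4 P5 P6 P7 Q1 Q2 Q3 Q4 Q5 Q6 Q7 \<kappa> E0 :: complex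
    unfolding that by (simp add: algebra_simps)
  have collect3: "L1 + L2 + L3 + L4 + E0 + (M1 + M2 + M3) = \<kappa> * ((P1+P2+P3+P4+P5+P6+P7) + (Q1+Q2+Q3+Q4+Q5+Q6+Q7)) + E0"
    if "L1 = \<kappa> * (P1 + Q1)" "L2 = \<kappa> * (P2 + Q2)" "L3 = \<kappa> * (P3 + Q3)" "L4 = \<kappa> * (P4 + Q4)" "M1 = \<kappa> * (P5 + Q5)" "M2 = \<kappa> * (P6 + Q6)" "M3 = \<kappa> * (P7 + Q7)"
    for L1 L2 L3 L4 M1 M2 M3 P1 P2 P3 P4 P5 P6 P7 Q1 Q2 Q3 Q4 Q5 Q6 Q7 \<kappa> E0 :: complex
    unfolding that by (simp add: algebra_simps)
  have quot: "z / complex_of_real (2 * x) = z * (1/2) * inverse (complex_of_real x)"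
    "complex_of_real (1 / (2 * x)) = 1/2 * inverse (complex_of_real x)"
    "complex_of_real (1 / x) = inverse (complex_of_real x)"
    "z / complex_of_real x = z * inverse (complex_of_real x)" for z x
    by (simp_all add: field_simps)
  define I where "I = (\<lambda>j x. inverse (complex_of_real (a$j + x)))"
  define G where "G = (\<lambda>j x. cis ((a$j + x) * t))"
  have I: "inverse (complex_of_real (a$j + x)) = I j x" "inverse (complex_of_real (a$j - x)) = I j (- x)"
    "inverse (complex_of_real (a$j)) = I j 0" for j x
    by (simp_all add: I_def)
  have G: "cis ((a$j + x) * t) = G j x" "cis ((a$j - x) * t) = G j (- x)" "cis (a$j * t) = G j 0" for j x
    by (simp_all add: G_def)
  have vec: "(u :: complex^3) + v = vector [x, y, z]"
    if "u$1 + v$1 = x" "u$2 + v$2 = y" "u$3 + v$3 = z" for u v x y z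
    using that by (simp add: vec_eq_iff forall_3)
  show ?thesis
    unfolding r_main_def r_even_def osc_def Let_def quot(1,2)
    unfolding quot(3,4) I G
    by (rule vec; unfold vector_3; rule collect1 collect2 collect3)
       (simp add: field_simps power2_eq_square)+
qed

lemma has_vector_derivative_osc:
  assumes nr: "\<And>k. k \<in> {0, 1, -1, 2, -2, 3, -3 :: real} \<Longrightarrow> a$j + k * l \<noteq> 0"
  shows "(osc a l c d e f j k m C D C' D' has_vector_derivative
     \<i> * cis (a$j * t) * cnj (mode c d e f (C * cis (l/2 * t)) (D * cis (3*l/2 * t)) k *
       mode c d e f (C' * cis (l/2 * t)) (D' * cis (3*l/2 * t)) m)) (at t)"
proof -
  define A X Y where A: "A = cis (a$j * t)" and X: "X = cis (l/2 * t)" and Y: "Y = cis (3*l/2 * t)"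
  have shift: "cis ((a$j + 3*l) * t) = A * (Y * Y)" "cis ((a$j - 3*l) * t) = A * (cnj Y * cnj Y)"
    "cis ((a$j + 2*l) * t) = A * (X * Y)" "cis ((a$j - 2*l) * t) = A * (cnj X * cnj Y)"
    by (simp_all add: A X Y cis_cnj cis_mult algebra_simps add_divide_distrib)
  have shift1: "cis ((a$j + l) * t) = A * (X * X)" "cis ((a$j - l) * t) = A * (cnj X * cnj X)"
    by (simp_all add: A X Y cis_cnj cis_mult algebra_simps add_divide_distrib)
  have shift0: "X * cnj X = 1" "Y * cnj Y = 1"
    by (simp_all add: X Y cis_cnj cis_mult)
  have osc: "((\<lambda>t. B * (cis ((a$j + k * l) * t) / complex_of_real (a$j + k * l))) has_vector_derivative
      (\<i> * B * cis ((a$j + k * l) * t))) (at t)" if "k \<in> {0, 1, -1, 2, -2, 3, -3 :: real}" for B k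
  proof -
    define \<omega> where "\<omega> = a$j + k * l"
    have "complex_of_real \<omega> \<noteq> 0" using nr[OF that] unfolding \<omega>_def by (metis of_real_eq_0_iff)
    then show ?thesis
      using has_vector_derivative_cis[of "B / complex_of_real \<omega>" \<omega> t]
      unfolding \<omega>_def[symmetric] by simp
  qed
  note osc' = osc[of 3, simplified] osc[of "-3", simplified] osc[of 2, simplified] osc[of "-2", simplified]
     osc[of 1, simplified] osc[of "-1", simplified] osc[of 0, simplified]
  have "(osc a l c d e f j k m C D C' D' has_vector_derivative
     \<i> * (D * D' * f$k * f$m) * cis ((a$j + 3*l) * t) + \<i> * (cnj D * cnj D' * e$k * e$m) * cis ((a$j - 3*l) * t)
     + \<i> * (C * C' * d$k * d$m + cnj C * D' * c$k * f$m + D * cnj C' * f$k * c$m) * cis ((a$j + l) * t)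
     + \<i> * (cnj C * cnj C' * c$k * c$m + C * cnj D' * d$k * e$m + cnj D * C' * e$k * d$m) * cis ((a$j - l) * t)
     + \<i> * (C * D' * d$k * f$m + D * C' * f$k * d$m) * cis ((a$j + 2*l) * t)
     + \<i> * (cnj C * cnj D' * c$k * e$m + cnj D * cnj C' * e$k * c$m) * cis ((a$j - 2*l) * t)
     + \<i> * (cnj C * C' * c$k * d$m + C * cnj C' * d$k * c$m + cnj D * D' * e$k * f$m + D * cnj D' * f$k * e$m) * A) (at t)"
    unfolding osc_def Let_def A
    using osc' by (intro has_vector_derivative_add) simp_all
  also have "\<i> * (D * D' * f$k * f$m) * cis ((a$j + 3*l) * t) + \<i> * (cnj D * cnj D' * e$k * e$m) * cis ((a$j - 3*l) * t)
     + \<i> * (C * C' * d$k * d$m + cnj C * D' * c$k * f$m + D * cnj C' * f$k * c$m) * cis ((a$j + l) * t)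
     + \<i> * (cnj C * cnj C' * c$k * c$m + C * cnj D' * d$k * e$m + cnj D * C' * e$k * d$m) * cis ((a$j - l) * t)
     + \<i> * (C * D' * d$k * f$m + D * C' * f$k * d$m) * cis ((a$j + 2*l) * t)
     + \<i> * (cnj C * cnj D' * c$k * e$m + cnj D * cnj C' * e$k * c$m) * cis ((a$j - 2*l) * t)
     + \<i> * (cnj C * C' * c$k * d$m + C * cnj C' * d$k * c$m + cnj D * D' * e$k * f$m + D * cnj D' * f$k * e$m) * A
     = \<i> * A * ((D * D' * f$k * f$m) * (Y * Y) + (cnj D * cnj D' * e$k * e$m) * (cnj Y * cnj Y)
     + C * C' * d$k * d$m * (X * X) + (cnj C * D' * c$k * f$m + D * cnj C' * f$k * c$m) * (cnj X * Y)
     + cnj C * cnj C' * c$k * c$m * (cnj X * cnj X) + (C * cnj D' * d$k * e$m + cnj D * C' * e$k * d$m) * (X * cnj Y)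
     + (C * D' * d$k * f$m + D * C' * f$k * d$m) * (X * Y)
     + (cnj C * cnj D' * c$k * e$m + cnj D * cnj C' * e$k * c$m) * (cnj X * cnj Y)
     + (cnj C * C' * c$k * d$m + C * cnj C' * d$k * c$m) * (X * cnj X) + (cnj D * D' * e$k * f$m + D * cnj D' * f$k * e$m) * (Y * cnj Y))"
  proof -
    have s: "cnj X * Y = X * X" "X * cnj Y = cnj X * cnj X"
      by (simp_all add: X Y cis_cnj cis_mult algebra_simps add_divide_distrib)
    show ?thesis
      unfolding shift shift1 shift0 s
      by (simp add: algebra_simps)
  qed
  also have "\<dots> = \<i> * A * cnj (mode c d e f (C * X) (D * Y) k * mode c d e f (C' * X) (D' * Y) m)"
    by (simp add: mode_def algebra_simps)
  finally show ?thesis unfolding A X Y .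
qed


lemma has_vector_derivative_lin_term:
  "(lin_term a l c d e f C D j has_vector_derivative
     \<i> * cis (a$j * t) *
       ((C * cis (l/2 * t)) * complex_of_real ((a$j + l/2) * c$j) + cnj (C * cis (l/2 * t)) * complex_of_real ((a$j - l/2) * d$j)
      + (D * cis (3*l/2 * t)) * complex_of_real ((a$j + 3*l/2) * e$j) + cnj (D * cis (3*l/2 * t)) * complex_of_real ((a$j - 3*l/2) * f$j))) (at t)"
proof -
  have "(lin_term a l c d e f C D j has_vector_derivative
      \<i> * complex_of_real (a$j + l/2) * (C * c$j) * cis ((a$j + l/2) * t)
    + \<i> * complex_of_real (a$j - l/2) * (cnj C * d$j) * cis ((a$j - l/2) * t)
    + \<i> * complex_of_real (a$j + 3*l/2) * (D * e$j) * cis ((a$j + 3*l/2) * t)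
    + \<i> * complex_of_real (a$j - 3*l/2) * (cnj D * f$j) * cis ((a$j - 3*l/2) * t)) (at t)"
    unfolding lin_term_def by (intro has_vector_derivative_add has_vector_derivative_cis)
  then show ?thesis unfolding cis_shift
    by (rule has_vector_derivative_eq_rhs) (simp add: algebra_simps)
qed

context special_family
begin

lemma cis_a_product:
  "cnj (cis (a$2 * t)) * cnj (cis (a$3 * t)) = cis (a$1 * t)"
  "cnj (cis (a$1 * t)) * cnj (cis (a$3 * t)) = cis (a$2 * t)"
  "cnj (cis (a$1 * t)) * cnj (cis (a$2 * t)) = cis (a$3 * t)"
proof -
  have a1: "a$1 = - a$2 - a$3" using a_sum by simp
  show "cnj (cis (a$2 * t)) * cnj (cis (a$3 * t)) = cis (a$1 * t)"
  "cnj (cis (a$1 * t)) * cnj (cis (a$3 * t)) = cis (a$2 * t)"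
  "cnj (cis (a$1 * t)) * cnj (cis (a$2 * t)) = cis (a$3 * t)"
    by (simp_all add: cis_cnj cis_mult a1 algebra_simps)
qed

lemma w_fun_deriv: "(w_fun a \<alpha> has_vector_derivative evolution_form (w_fun a \<alpha> t) (w_fun a \<alpha> t)) (at t)"
proof -
  have c: "complex_of_real (a$1) * complex_of_real s1 = - (complex_of_real s2 * complex_of_real s3)"
    "complex_of_real (a$2) * complex_of_real s2 = complex_of_real s1 * complex_of_real s3"
    "complex_of_real (a$3) * complex_of_real s3 = complex_of_real s1 * complex_of_real s2"
    using a_s by (metis of_real_mult of_real_minus mult_minus_left)+
  have *: "evolution_form (w_fun a \<alpha> t) (w_fun a \<alpha> t) = vector
     [\<i> * complex_of_real (a$1) * (\<i> * s1) * (cnj (cis (a$2 * t)) * cnj (cis (a$3 * t))), \<i> * complex_of_real (a$2) * s2 * (cnj (cis (a$1 * t)) * cnj (cis (a$3 * t))),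
      \<i> * complex_of_real (a$3) * s3 * (cnj (cis (a$1 * t)) * cnj (cis (a$2 * t)))]"
    using c unfolding evolution_form_def w_fun_def vector_3 
    by (simp add: vec_eq_iff forall_3 algebra_simps)
  show ?thesis unfolding * cis_a_product unfolding w_fun_def
    by (intro has_vector_derivative_vector3 has_vector_derivative_cis)
qed

text \<open>The left-hand side comes from differentiating a linear term, the right-hand side from the evolution
  equation; that they agree is what the rows of the two eigenvalue equations say.\<close>

lemma mode_row:
  fixes X Y :: complex
  shows "X * complex_of_real ((a$1 + l/2) * c$1) + cnj X * complex_of_real ((a$1 - l/2) * d$1)
     + Y * complex_of_real ((a$1 + 3*l/2) * e$1) + cnj Y * complex_of_real ((a$1 - 3*l/2) * f$1)
     = - 1/2 * (s3 * cnj (mode c d e f X Y 2) + s2 * cnj (mode c d e f X Y 3))"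
   "X * complex_of_real ((a$2 + l/2) * c$2) + cnj X * complex_of_real ((a$2 - l/2) * d$2)
     + Y * complex_of_real ((a$2 + 3*l/2) * e$2) + cnj Y * complex_of_real ((a$2 - 3*l/2) * f$2)
     = 1/2 * (s3 * cnj (mode c d e f X Y 1) + s1 * cnj (mode c d e f X Y 3))"
   "X * complex_of_real ((a$3 + l/2) * c$3) + cnj X * complex_of_real ((a$3 - l/2) * d$3)
     + Y * complex_of_real ((a$3 + 3*l/2) * e$3) + cnj Y * complex_of_real ((a$3 - 3*l/2) * f$3)
     = 1/2 * (s2 * cnj (mode c d e f X Y 1) + s1 * cnj (mode c d e f X Y 2))"
proof -
  have 1: "(a$1 + l/2) * c$1 = - 1/2 * (s3 * d$2 + s2 * d$3)" "(a$1 - l/2) * d$1 = - 1/2 * (s3 * c$2 + s2 * c$3)"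
    "(a$1 + 3*l/2) * e$1 = - 1/2 * (s3 * f$2 + s2 * f$3)" "(a$1 - 3*l/2) * f$1 = - 1/2 * (s3 * e$2 + s2 * e$3)"
   and 2: "(a$2 + l/2) * c$2 = 1/2 * (s3 * d$1 + s1 * d$3)" "(a$2 - l/2) * d$2 = 1/2 * (s3 * c$1 + s1 * c$3)"
    "(a$2 + 3*l/2) * e$2 = 1/2 * (s3 * f$1 + s1 * f$3)" "(a$2 - 3*l/2) * f$2 = 1/2 * (s3 * e$1 + s1 * e$3)"
   and 3: "(a$3 + l/2) * c$3 = 1/2 * (s2 * d$1 + s1 * d$2)" "(a$3 - l/2) * d$3 = 1/2 * (s2 * c$1 + s1 * c$2)"
    "(a$3 + 3*l/2) * e$3 = 1/2 * (s2 * f$1 + s1 * f$2)" "(a$3 - 3*l/2) * f$3 = 1/2 * (s2 * e$1 + s1 * e$2)"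
    using ep1 ep3 unfolding eigenpair_def by (auto simp: algebra_simps)
  show "X * complex_of_real ((a$1 + l/2) * c$1) + cnj X * complex_of_real ((a$1 - l/2) * d$1)
     + Y * complex_of_real ((a$1 + 3*l/2) * e$1) + cnj Y * complex_of_real ((a$1 - 3*l/2) * f$1)
     = - 1/2 * (s3 * cnj (mode c d e f X Y 2) + s2 * cnj (mode c d e f X Y 3))"
    unfolding 1 mode_def by (simp add: field_simps)
  show "X * complex_of_real ((a$2 + l/2) * c$2) + cnj X * complex_of_real ((a$2 - l/2) * d$2)
     + Y * complex_of_real ((a$2 + 3*l/2) * e$2) + cnj Y * complex_of_real ((a$2 - 3*l/2) * f$2)
     = 1/2 * (s3 * cnj (mode c d e f X Y 1) + s1 * cnj (mode c d e f X Y 3))"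
    unfolding 2 mode_def by (simp add: field_simps)
  show "X * complex_of_real ((a$3 + l/2) * c$3) + cnj X * complex_of_real ((a$3 - l/2) * d$3)
     + Y * complex_of_real ((a$3 + 3*l/2) * e$3) + cnj Y * complex_of_real ((a$3 - 3*l/2) * f$3)
     = 1/2 * (s2 * cnj (mode c d e f X Y 1) + s1 * cnj (mode c d e f X Y 2))"
    unfolding 3 mode_def by (simp add: field_simps)
qed

lemma p_fun_deriv:
  "(p_fun a l c d e f C D has_vector_derivative evolution_form (p_fun a l c d e f C D t) (w_fun a \<alpha> t)) (at t)"
proof -
  let ?L = "mode c d e f (C * cis (l/2 * t)) (D * cis (3*l/2 * t))"
  have *: "evolution_form (p_fun a l c d e f C D t) (w_fun a \<alpha> t) = vector
     [\<i> * (\<i> * (cnj (cis (a$2 * t)) * cnj (cis (a$3 * t))) * (- 1/2 * (s3 * cnj (?L 2) + s2 * cnj (?L 3)))),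
      \<i> * (cnj (cis (a$1 * t)) * cnj (cis (a$3 * t))) * (1/2 * (s3 * cnj (?L 1) + s1 * cnj (?L 3))),
      \<i> * (cnj (cis (a$1 * t)) * cnj (cis (a$2 * t))) * (1/2 * (s2 * cnj (?L 1) + s1 * cnj (?L 2)))]"
    unfolding evolution_form_def w_fun_def p_fun_def vector_3 lin_term_eq_mode 
    by (simp add: vec_eq_iff forall_3 algebra_simps)
  show ?thesis unfolding * cis_a_product unfolding p_fun_def
    by (intro has_vector_derivative_vector3 has_vector_derivative_mult_right)
       (use has_vector_derivative_lin_term[of a l c d e f C D _ t, unfolded] mode_row in metis)+
qed

lemma r_fun_deriv:
  fixes C D C' D' E
  defines "p \<equiv> p_fun a l c d e f C D" and "q \<equiv> p_fun a l c d e f C' D'"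
  shows "((\<lambda>t. r_main a l c d e f C D C' D' E t + r_even a l c d e f C D C' D' t) has_vector_derivative vector
        [1/2 * cnj (p t$2 * p t$3 + q t$2 * q t$3), - 1/2 * cnj (p t$1 * p t$3 - q t$1 * q t$3),
         - 1/2 * cnj (p t$1 * q t$2 + p t$2 * q t$1)]) (at t)"
proof -
  let ?L = "mode c d e f (C * cis (l/2 * t)) (D * cis (3*l/2 * t))"
  let ?L' = "mode c d e f (C' * cis (l/2 * t)) (D' * cis (3*l/2 * t))"
  have *: "vector
        [1/2 * cnj (p t$2 * p t$3 + q t$2 * q t$3), - 1/2 * cnj (p t$1 * p t$3 - q t$1 * q t$3),
         - 1/2 * cnj (p t$1 * q t$2 + p t$2 * q t$1)] =
     (vector [- \<i>/2 * (\<i> * (cnj (cis (a$2 * t)) * cnj (cis (a$3 * t))) * cnj (?L 2 * ?L 3) + \<i> * (cnj (cis (a$2 * t)) * cnj (cis (a$3 * t))) * cnj (?L' 2 * ?L' 3)) + 0,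
      1/2 * (\<i> * (cnj (cis (a$1 * t)) * cnj (cis (a$3 * t))) * cnj (?L 1 * ?L 3) - \<i> * (cnj (cis (a$1 * t)) * cnj (cis (a$3 * t))) * cnj (?L' 1 * ?L' 3)) + 0,
      1/2 * (\<i> * (cnj (cis (a$1 * t)) * cnj (cis (a$2 * t))) * cnj (?L 1 * ?L' 2) + \<i> * (cnj (cis (a$1 * t)) * cnj (cis (a$2 * t))) * cnj (?L' 1 * ?L 2)) + 0] :: complex^3)"
    unfolding p_def q_def p_fun_def vector_3 lin_term_eq_mode 
    by (simp add: vec_eq_iff forall_3 algebra_simps)
  show ?thesis unfolding * cis_a_product r_fun_eq_osc
    by (intro has_vector_derivative_vector3 has_vector_derivative_add has_vector_derivative_const
        has_vector_derivative_mult_right has_vector_derivative_diff has_vector_derivative_osc nonresonant)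
qed

end

lemma Re_mode: "Re (mode c d e f X Y j) = Re X * (c + d)$j + Re Y * (e + f)$j"
  and Im_mode: "Im (mode c d e f X Y j) = Im X * (c - d)$j + Im Y * (e - f)$j"
  by (simp_all add: mode_def algebra_simps)

lemma smooth_p_fun: "smooth_map (p_fun a l c d e f C D)"
  unfolding p_fun_def lin_term_def by (intro smooth_intros)

lemma smooth_w_fun: "smooth_map (w_fun a \<alpha>)"
  unfolding w_fun_def by (intro smooth_intros)

lemma smooth_r_fun: "smooth_map (\<lambda>t. r_main a l c d e f C D C' D' E t + r_even a l c d e f C D C' D' t)"
  unfolding r_main_def r_even_def by (intro smooth_intros)

lemma Phi_eq_quad_map:
  "Phi a l \<alpha> c d e f (C, D, C', D', E) = quad_map (w_fun a \<alpha>) (p_fun a l c d e f C D) (p_fun a l c d e f C' D')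
     (\<lambda>t. r_main a l c d e f C D C' D' E t + r_even a l c d e f C D C' D' t)"
  by (simp add: Phi_def quad_map_def Let_def fun_eq_iff)

lemma p_fun_0: "p_fun a l c d e f 0 0 = (\<lambda>t. 0)"
  by (simp add: p_fun_def lin_term_def fun_eq_iff vec_eq_iff forall_3)

lemma r_fun_0: "r_main a l c d e f 0 0 0 0 0 t + r_even a l c d e f 0 0 0 0 t = 0"
  by (simp add: r_main_def r_even_def vec_eq_iff forall_3)

text \<open>Hence everything proved about the family applies to the cone.\<close>

lemma Phi0_eq_Phi: "Phi0 a \<alpha> = Phi a l \<alpha> c d e f (0, 0, 0, 0, 0)"
proof
  fix x :: "real \<times> real \<times> real"
  obtain y1 y2 t where x: "x = (y1, y2, t)" by (metis prod_cases3)
  show "Phi0 a \<alpha> x = Phi a l \<alpha> c d e f (0, 0, 0, 0, 0) x"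
    by (simp add: x Phi_def Let_def p_fun_0 r_main_def r_even_def Phi0_def w_fun_def vec_eq_iff forall_3)
qed

lemma zero_in_param_space: "(0, 0, 0, 0, 0) \<in> param_space c d e f"
  by (simp add: param_space_def)

context special_family
begin

text \<open>This is the value of omega(u, v) with phases removed. Expanding into real and imaginary parts, each
  product of coefficients is multiplied by a value of the indefinite form: those with y_1 or y_2
  vanish by \<open>eigenpair_plane\<close>, the mixed ones by orthogonality, and the others give K.\<close>

lemma isotropic_modes:
  fixes X Y X' Y' :: complex and y1 y2 :: real and L L' :: "3 \<Rightarrow> complex"
  defines "L \<equiv> mode c d e f X Y" and "L' \<equiv> mode c d e f X' Y'"
  shows "Im ((y1 * s1 + L 1) * cnj (y2 * s1 + L' 1)) - Im ((y1 * s2 + L 2) * cnj (y2 * s2 + L' 2))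
       - Im ((y1 * s3 + L 3) * cnj (y2 * s3 + L' 3)) = Im (X * cnj X') * K_const c d + Im (Y * cnj Y') * K_const e f"
proof -
  have "s1 * (c - d)$1 - s2 * (c - d)$2 - s3 * (c - d)$3 = 0"
    "s1 * (e - f)$1 - s2 * (e - f)$2 - s3 * (e - f)$3 = 0"
    using eigenpair_plane[OF ep1] eigenpair_plane[OF ep3] l_pos by simp_all
  moreover have "(c+d)$1 * (c-d)$1 - (c+d)$2 * (c-d)$2 - (c+d)$3 * (c-d)$3 = K_const c d"
    "(e+f)$1 * (e-f)$1 - (e+f)$2 * (e-f)$2 - (e+f)$3 * (e-f)$3 = K_const e f"
    by (simp_all add: K_const_def algebra_simps power2_eq_square)
  moreover have "(c+d)$1 * (e-f)$1 - (c+d)$2 * (e-f)$2 - (c+d)$3 * (e-f)$3 = 0"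
    "(e+f)$1 * (c-d)$1 - (e+f)$2 * (c-d)$2 - (e+f)$3 * (c-d)$3 = 0"
    using orthogonal_modes by (simp_all add: algebra_simps)
  moreover have "(yv * t1 + Yv * T1) * (y2 * z1 + x' * S1 + X' * R1) - (y1 * z1 + x * S1 + Xv * R1) * (y' * t1 + Y' * T1)
     - ((yv * t2 + Yv * T2) * (y2 * z2 + x' * S2 + X' * R2) - (y1 * z2 + x * S2 + Xv * R2) * (y' * t2 + Y' * T2))
     - ((yv * t3 + Yv * T3) * (y2 * z3 + x' * S3 + X' * R3) - (y1 * z3 + x * S3 + Xv * R3) * (y' * t3 + Y' * T3))
     = (yv * x' - x * y') * K + (Yv * X' - Xv * Y') * K'"
    if "z1 * t1 - z2 * t2 - z3 * t3 = 0" "z1 * T1 - z2 * T2 - z3 * T3 = 0"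
     "S1 * t1 - S2 * t2 - S3 * t3 = K" "R1 * T1 - R2 * T2 - R3 * T3 = K'"
     "S1 * T1 - S2 * T2 - S3 * T3 = 0" "R1 * t1 - R2 * t2 - R3 * t3 = 0"
    for z1 z2 z3 t1 t2 t3 T1 T2 T3 S1 S2 S3 R1 R2 R3 K K' yv Yv x' X' x Xv y' Y' :: real
  proof -
    have "(yv * t1 + Yv * T1) * (y2 * z1 + x' * S1 + X' * R1) - (y1 * z1 + x * S1 + Xv * R1) * (y' * t1 + Y' * T1)
     - ((yv * t2 + Yv * T2) * (y2 * z2 + x' * S2 + X' * R2) - (y1 * z2 + x * S2 + Xv * R2) * (y' * t2 + Y' * T2))
     - ((yv * t3 + Yv * T3) * (y2 * z3 + x' * S3 + X' * R3) - (y1 * z3 + x * S3 + Xv * R3) * (y' * t3 + Y' * T3))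
     = (yv * y2 - y1 * y') * (z1 * t1 - z2 * t2 - z3 * t3) + (Yv * y2 - y1 * Y') * (z1 * T1 - z2 * T2 - z3 * T3)
     + (yv * x' - x * y') * (S1 * t1 - S2 * t2 - S3 * t3) + (Yv * X' - Xv * Y') * (R1 * T1 - R2 * T2 - R3 * T3)
     + (Yv * x' - x * Y') * (S1 * T1 - S2 * T2 - S3 * T3) + (yv * X' - Xv * y') * (R1 * t1 - R2 * t2 - R3 * t3)"
      by (simp add: algebra_simps)
    then show ?thesis unfolding that by simp
  qed
  moreover have "Im (u * cnj v) = Im u * Re v - Re u * Im v" for u v by simp
  ultimately show ?thesis unfolding L_def L'_def
    by (simp only: plus_complex.sel Re_mode Im_mode Re_complex_of_real Im_complex_of_real of_real_mult[symmetric] add_0_left add.assoc[symmetric])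
qed

lemma quad_d_modes:
  fixes y1 y2 t :: real and C D C' D' :: complex and L L' :: "3 \<Rightarrow> complex"
  defines "L \<equiv> mode c d e f (C * cis (l/2 * t)) (D * cis (3*l/2 * t))"
    and "L' \<equiv> mode c d e f (C' * cis (l/2 * t)) (D' * cis (3*l/2 * t))"
  shows "quad_d1 (w_fun a \<alpha>) (p_fun a l c d e f C D) (p_fun a l c d e f C' D') (y1, y2, t) =
      vector [\<i> * cis (a$1 * t) * (y1 * s1 + L 1), cis (a$2 * t) * (y1 * s2 + L 2), cis (a$3 * t) * (y2 * s3 + L' 3)]"
    "quad_d2 (w_fun a \<alpha>) (p_fun a l c d e f C D) (p_fun a l c d e f C' D') (y1, y2, t) =
      vector [\<i> * cis (a$1 * t) * (y2 * s1 + L' 1), - (cis (a$2 * t) * (y2 * s2 + L' 2)), cis (a$3 * t) * (y1 * s3 + L 3)]"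
  unfolding quad_d1_def quad_d2_def w_fun_def p_fun_def lin_term_eq_mode L_def L'_def
  by (simp_all add: vec_eq_iff forall_3 algebra_simps)

lemma isotropic_quad_d:
  assumes "(C, D, C', D', E) \<in> param_space c d e f"
  shows "kaehler_form (quad_d1 (w_fun a \<alpha>) (p_fun a l c d e f C D) (p_fun a l c d e f C' D') x)
     (quad_d2 (w_fun a \<alpha>) (p_fun a l c d e f C D) (p_fun a l c d e f C' D') x) = 0"
proof -
  obtain y1 y2 t where x: "x = (y1, y2, t)" by (metis prod_cases3)
  have cc: "z * cis r * cnj (z' * cis r) = z * cnj z'" for z z' :: complex and r
    by (simp add: cis_cnj cis_mult mult_ac)
  have u: "cis r * z * cnj (cis r * z') = z * cnj z'" "\<i> * cis r * z * cnj (\<i> * cis r * z') = z * cnj z'"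
     "cis r * z * cnj (- (cis r * z')) = - (z * cnj z')" for z z' :: complex and r
    using cc[of z r z'] by (simp_all add: mult_ac)
  have key: "- complex_of_real (Im A + Im (- B) + Im (z' * cnj z)) = 0" if "Im A - Im B - Im (z * cnj z') = 0"
    for A B z z' using that by (simp add: algebra_simps)
  have "Im (C * cnj C') * K_const c d + Im (D * cnj D') * K_const e f = 0"
    using assms by (simp add: param_space_def)
  then show ?thesis
    unfolding kaehler_form_eq_sum_Im sum_3 x quad_d_modes vector_3 u
    using isotropic_modes[of y1 "C * cis (l/2 * t)" "D * cis (3*l/2 * t)" y2 "C' * cis (l/2 * t)" "D' * cis (3*l/2 * t)"]
    unfolding cc by (intro key) simp
qed

lemma evolving_quadrics_Phi:
  assumes "(C, D, C', D', E) \<in> param_space c d e f"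
  shows "evolving_quadrics (w_fun a \<alpha>) (p_fun a l c d e f C D) (p_fun a l c d e f C' D')
     (\<lambda>t. r_main a l c d e f C D C' D' E t + r_even a l c d e f C D C' D' t)"
proof
  show "w_fun a \<alpha> t $ j \<noteq> 0" for t j
    using exhaust_3[of j] s_pos by (auto simp: w_fun_def)
qed (rule smooth_w_fun smooth_p_fun smooth_r_fun w_fun_deriv p_fun_deriv r_fun_deriv isotropic_quad_d[OF assms])+

lemma special_Lagrangian_3fold_Phi:
  assumes "P \<in> param_space c d e f"
  shows "special_Lagrangian_3fold (Phi a l \<alpha> c d e f P)"
proof -
  obtain C D C' D' E where P: "P = (C, D, C', D', E)" by (metis prod_cases5)
  interpret evolving_quadrics "w_fun a \<alpha>" "p_fun a l c d e f C D" "p_fun a l c d e f C' D'"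
     "\<lambda>t. r_main a l c d e f C D C' D' E t + r_even a l c d e f C D C' D' t"
    using evolving_quadrics_Phi assms unfolding P .
  show ?thesis unfolding P Phi_eq_quad_map by (rule special_Lagrangian_3fold_quad_map)
qed

end

section \<open>Growth and closedness\<close>

lemma bounded_mult_comp:
  fixes f g :: "'a \<Rightarrow> 'b::real_normed_algebra"
  assumes "bounded (f ` S)" "bounded (g ` S)"
  shows "bounded ((\<lambda>x. f x * g x) ` S)"
proof -
  obtain B1 B2 where B: "\<And>x. x \<in> S \<Longrightarrow> norm (f x) \<le> B1" "\<And>x. x \<in> S \<Longrightarrow> norm (g x) \<le> B2"
    using assms unfolding bounded_iff by auto
  have "norm (f x * g x) \<le> \<bar>B1\<bar> * \<bar>B2\<bar>" if "x \<in> S" for x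
  proof -
    have "norm (f x * g x) \<le> norm (f x) * norm (g x)" by (rule norm_mult_ineq)
    also have "\<dots> \<le> \<bar>B1\<bar> * \<bar>B2\<bar>" using B[OF that] by (intro mult_mono) auto
    finally show ?thesis .
  qed
  then show ?thesis unfolding bounded_iff by blast
qed

lemma bounded_const_comp: "bounded ((\<lambda>x. k) ` S)"
  by (rule bounded_subset[of "{k}"]) auto

lemma bounded_cis_comp: "bounded ((\<lambda>x. cis (f x)) ` S)"
  by (auto simp: bounded_iff intro!: exI[of _ 1])

lemma bounded_vector3_comp:
  assumes "bounded (range x)" "bounded (range y)" "bounded (range z)"
  shows "bounded (range (\<lambda>t. vector [x t, y t, z t] :: complex^3))"
  unfolding vector3_eq_axis
  by (intro bounded_plus_comp bounded_linear_image[OF _ bounded_linear_axis, of "range _", unfolded image_image] assms)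

lemmas bounded_intros = bounded_const_comp bounded_plus_comp bounded_minus_comp bounded_mult_comp
  bounded_cis_comp bounded_vector3_comp

lemma bounded_p_fun: "bounded (range (p_fun a l c d e f C D))"
  unfolding p_fun_def lin_term_def by (intro bounded_intros)

lemma bounded_r_fun: "bounded (range (\<lambda>t. r_main a l c d e f C D C' D' E t + r_even a l c d e f C D C' D' t))"
  unfolding r_main_def r_even_def by (intro bounded_intros)

text \<open>The difference is affine in (y_1, y_2), with trigonometric sums as coefficients.\<close>

lemma norm_Phi_minus_Phi0_le:
  obtains B where "B > 0" "\<And>y1 y2 t. norm (Phi a l \<alpha> c d e f P (y1, y2, t) - Phi0 a \<alpha> (y1, y2, t)) \<le> B * (1 + \<bar>y1\<bar> + \<bar>y2\<bar>)"
proof -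
  obtain C D C' D' E where P: "P = (C, D, C', D', E)" by (metis prod_cases5)
  let ?p = "p_fun a l c d e f C D" and ?q = "p_fun a l c d e f C' D'"
  let ?r = "\<lambda>t. r_main a l c d e f C D C' D' E t + r_even a l c d e f C D C' D' t"
  obtain B1 B2 B3 where B: "\<And>t. norm (?p t) \<le> B1" "\<And>t. norm (?q t) \<le> B2" "\<And>t. norm (?r t) \<le> B3"
    using bounded_p_fun[of a l c d e f C D] bounded_p_fun[of a l c d e f C' D'] bounded_r_fun[of a l c d e f C D C' D' E]
    unfolding bounded_iff by auto
  define B0 where "B0 = max 1 (max B1 (max B2 B3))"
  have B0: "cmod (?p t $ j) \<le> B0" "cmod (?q t $ j) \<le> B0" "cmod (?r t $ j) \<le> B0" for t j
    using B[of t] Finite_Cartesian_Product.norm_nth_le[of "?p t" j] Finite_Cartesian_Product.norm_nth_le[of "?q t" j]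
      Finite_Cartesian_Product.norm_nth_le[of "?r t" j]
    unfolding B0_def by linarith+
  have tri: "cmod (of_real x * u + of_real y * v + w) \<le> B0 * (1 + \<bar>x\<bar> + \<bar>y\<bar>)"
    "cmod (of_real x * u - of_real y * v + w) \<le> B0 * (1 + \<bar>x\<bar> + \<bar>y\<bar>)"
    if "cmod u \<le> B0" "cmod v \<le> B0" "cmod w \<le> B0" for x y :: real and u v w
  proof -
    have m: "\<bar>x\<bar> * cmod u \<le> \<bar>x\<bar> * B0" "\<bar>y\<bar> * cmod v \<le> \<bar>y\<bar> * B0" using that by (auto intro: mult_left_mono)
    have "cmod (of_real x * u + of_real y * v + w) \<le> \<bar>x\<bar> * cmod u + \<bar>y\<bar> * cmod v + cmod w"
      by (intro norm_triangle_mono) (auto simp: norm_mult)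
    then show "cmod (of_real x * u + of_real y * v + w) \<le> B0 * (1 + \<bar>x\<bar> + \<bar>y\<bar>)"
      using m that(3) by (simp add: algebra_simps)
    have "cmod (of_real x * u - of_real y * v + w) \<le> cmod (of_real x * u - of_real y * v) + cmod w"
      by (rule norm_triangle_ineq)
    also have "\<dots> \<le> \<bar>x\<bar> * cmod u + \<bar>y\<bar> * cmod v + cmod w"
      using norm_triangle_ineq4[of "of_real x * u" "of_real y * v"] by (simp add: norm_mult)
    finally show "cmod (of_real x * u - of_real y * v + w) \<le> B0 * (1 + \<bar>x\<bar> + \<bar>y\<bar>)"
      using m that(3) by (simp add: algebra_simps)
  qed
  have "norm (Phi a l \<alpha> c d e f P (y1, y2, t) - Phi0 a \<alpha> (y1, y2, t)) \<le> (3 * B0) * (1 + \<bar>y1\<bar> + \<bar>y2\<bar>)" for y1 y2 t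
  proof -
    let ?D = "Phi a l \<alpha> c d e f P (y1, y2, t) - Phi0 a \<alpha> (y1, y2, t)"
    have D: "?D $ 1 = of_real y1 * ?p t $ 1 + of_real y2 * ?q t $ 1 + ?r t $ 1"
      "?D $ 2 = of_real y1 * ?p t $ 2 - of_real y2 * ?q t $ 2 + ?r t $ 2"
      "?D $ 3 = of_real y1 * ?q t $ 3 + of_real y2 * ?p t $ 3 + ?r t $ 3"
      unfolding P Phi_eq_quad_map by (simp_all add: quad_map_def Phi0_def w_fun_def)
    have "norm ?D \<le> (\<Sum>j\<in>UNIV. cmod (?D $ j))" unfolding norm_vec_def by (rule L2_set_le_sum) simp
    also have "\<dots> \<le> (3 * B0) * (1 + \<bar>y1\<bar> + \<bar>y2\<bar>)"
      unfolding sum_3 D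
      using tri(1)[OF B0(1)[of t 1] B0(2)[of t 1] B0(3)[of t 1], of y1 y2]
        tri(2)[OF B0(1)[of t 2] B0(2)[of t 2] B0(3)[of t 2], of y1 y2]
        tri(1)[OF B0(2)[of t 3] B0(1)[of t 3] B0(3)[of t 3], of y1 y2] by linarith
    finally show ?thesis .
  qed
  moreover have "3 * B0 > 0" unfolding B0_def by simp
  ultimately show ?thesis using that by blast
qed

context cone_data
begin

lemma norm_Phi0_ge: "norm (Phi0 a \<alpha> (y1, y2, t)) \<ge> s1 / 2 * (y1^2 + y2^2)"
proof -
  have "Phi0 a \<alpha> (y1, y2, t) $ 1 = \<i> * complex_of_real (s1 / 2 * (y1^2 + y2^2)) * cis (a$1 * t)"
    by (simp add: Phi0_def)
  then have "cmod (Phi0 a \<alpha> (y1, y2, t) $ 1) = \<bar>s1 / 2 * (y1^2 + y2^2)\<bar>"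
    by (simp only: norm_mult norm_ii norm_of_real norm_cis mult_1_left mult_1_right)
  then show ?thesis using Finite_Cartesian_Product.norm_nth_le[of "Phi0 a \<alpha> (y1, y2, t)" 1] by linarith
qed

end

lemma cis_pi_int: "cis (pi * of_int k) = (if even k then 1 else -1)"
proof (cases "even k")
  case True
  then obtain j where "k = 2 * j" by blast
  then show ?thesis using cis_multiple_2pi[of "of_int j"] by (simp add: mult_ac)
next
  case False
  then obtain j where j: "k = 2 * j + 1" by (metis oddE)
  have "cis (pi * of_int k) = cis (2 * pi * of_int j + pi)"
    by (simp add: j algebra_simps)
  also have "\<dots> = cis (2 * pi * of_int j) * cis pi" by (simp only: cis_mult)
  also have "\<dots> = - 1" using cis_multiple_2pi[of "of_int j"] by simp
  finally show ?thesis using False by simp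
qed

lemma cis_int_period: "cis (of_int k * (t + 2 * pi * of_int n)) = cis (of_int k * t)"
proof -
  have "cis (of_int k * (t + 2 * pi * of_int n)) = cis (of_int k * t) * cis (2 * pi * of_int (k * n))"
    by (simp add: cis_mult algebra_simps)
  then show ?thesis using cis_multiple_2pi[of "of_int (k * n)"] by simp
qed

lemma sign_powi: "(-1) powi n = (if even n then 1 else -1 :: real)"
  by (simp add: power_int_minus_left)

lemma cis_half_period:
  assumes "odd k"
  shows "cis (of_int k / 2 * (t + 2 * pi * of_int n)) = complex_of_real ((-1) powi n) * cis (of_int k / 2 * t)"
proof -
  have "cis (of_int k / 2 * (t + 2 * pi * of_int n)) = cis (of_int k / 2 * t) * cis (pi * of_int (k * n))"
    by (simp add: cis_mult algebra_simps add_divide_distrib)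
  then show ?thesis unfolding cis_pi_int sign_powi using assms by simp
qed

text \<open>For odd l the half-integer frequencies a_j + l/2 and a_j + 3l/2 make p and q change sign when
  t increases by 2 pi, as the deck transformations require.\<close>

locale integral_family = special_family +
  fixes b :: "3 \<Rightarrow> int" and m :: int
  assumes a_int: "\<And>j. a$j = of_int (b j)" and l_int: "l = of_int m" and m_odd: "odd m"
begin

lemma p_fun_deck: "p_fun a l c d e f C D (t + 2 * pi * of_int n) = of_real ((-1) powi n) *\<^sub>R p_fun a l c d e f C D t"
proof -
  have h: "cis (l/2 * (t + 2 * pi * of_int n)) = complex_of_real ((-1) powi n) * cis (l/2 * t)"
    "cis (3*l/2 * (t + 2 * pi * of_int n)) = complex_of_real ((-1) powi n) * cis (3*l/2 * t)"
    using cis_half_period[OF m_odd, of t n] cis_half_period[of "3 * m" t n] m_odd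
    by (simp_all add: l_int)
  have md: "mode c d e f (x * (complex_of_real r * u)) (y * (complex_of_real r * v)) j = complex_of_real r * mode c d e f (x * u) (y * v) j"
    for x y r u v j by (simp add: mode_def algebra_simps)
  have "lin_term a l c d e f C D j (t + 2 * pi * of_int n) = complex_of_real ((-1) powi n) * lin_term a l c d e f C D j t" for j
    unfolding lin_term_eq_mode h md unfolding a_int cis_int_period by simp
  then show ?thesis
    by (simp add: p_fun_def vec_eq_iff forall_3 scaleR_complex)
qed

lemma osc_deck: "osc a l c d e f j k i C D C' D' (t + 2 * pi * of_int n) = osc a l c d e f j k i C D C' D' t"
proof -
  have "cis ((a$j + of_int x * l) * (t + 2 * pi * of_int n)) = cis ((a$j + of_int x * l) * t)" for x
    using cis_int_period[of "b j + x * m" t n] by (simp add: a_int l_int)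
  from this[of 3] this[of "-3"] this[of 2] this[of "-2"] this[of 1] this[of "-1"] this[of 0]
  show ?thesis unfolding osc_def Let_def by simp
qed

lemma w_fun_deck: "w_fun a \<alpha> (t + 2 * pi * of_int n) = w_fun a \<alpha> t"
  unfolding w_fun_def a_int cis_int_period ..

lemma Phi_deck: "Phi a l \<alpha> c d e f P (deck n x) = Phi a l \<alpha> c d e f P x"
proof -
  obtain C D C' D' E where P: "P = (C, D, C', D', E)" by (metis prod_cases5)
  obtain y1 y2 t where x: "x = (y1, y2, t)" by (metis prod_cases3)
  show ?thesis unfolding P Phi_eq_quad_map x quad_map_def deck_def split_conv p_fun_deck w_fun_deck
      r_fun_eq_osc osc_deck
    by (simp add: vec_eq_iff forall_3 scaleR_complex sign_powi)
qed

lemma Phi0_deck: "Phi0 a \<alpha> (deck n x) = Phi0 a \<alpha> x"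
  unfolding Phi0_eq_Phi[of a \<alpha> l c d e f] by (rule Phi_deck)

text \<open>The difference is O(1 + |y|), while |y|^2 is O of the norm of \<open>Phi0\<close>.\<close>

lemma weakly_asymptotic_Phi: "weakly_asymptotic_half (Phi a l \<alpha> c d e f P) (Phi0 a \<alpha>)"
  unfolding weakly_asymptotic_half_def
proof (intro conjI allI)
  obtain B where B: "B > 0" "\<And>y1 y2 t. norm (Phi a l \<alpha> c d e f P (y1, y2, t) - Phi0 a \<alpha> (y1, y2, t)) \<le> B * (1 + \<bar>y1\<bar> + \<bar>y2\<bar>)"
    using norm_Phi_minus_Phi0_le[of a l \<alpha> c d e f P] by metis
  define k where "k = 1 / sqrt (s1 / 2)"
  have bd: "norm (Phi a l \<alpha> c d e f P x - Phi0 a \<alpha> x) \<le> (B * (1 + 2 * k)) * norm (Phi0 a \<alpha> x) powr (1/2)"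
    if ge1: "norm (Phi0 a \<alpha> x) \<ge> 1" for x
  proof -
    obtain y1 y2 t where x: "x = (y1, y2, t)" by (metis prod_cases3)
    define \<rho> where "\<rho> = norm (Phi0 a \<alpha> x)"
    have \<rho>: "\<rho> \<ge> 1" "s1 / 2 * (y1^2 + y2^2) \<le> \<rho>" using ge1 norm_Phi0_ge unfolding \<rho>_def x by auto
    have "\<bar>y\<bar> \<le> k * sqrt \<rho>" if "y^2 \<le> y1^2 + y2^2" for y
    proof -
      have "y^2 \<le> \<rho> / (s1/2)"
        using \<rho>(2) that s_pos(1) mult_left_mono[OF that, of "s1/2"] by (simp add: field_simps)
      then have "sqrt (y^2) \<le> sqrt (\<rho> / (s1/2))" by (rule real_sqrt_le_mono)
      then show ?thesis by (simp add: k_def real_sqrt_divide real_sqrt_mult mult.commute)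
    qed
    from this[of y1] this[of y2] have y: "\<bar>y1\<bar> \<le> k * sqrt \<rho>" "\<bar>y2\<bar> \<le> k * sqrt \<rho>" by simp_all
    have "1 \<le> sqrt \<rho>" using \<rho>(1) by simp
    moreover have "(1 + 2 * k) * sqrt \<rho> = sqrt \<rho> + k * sqrt \<rho> + k * sqrt \<rho>" by (simp add: algebra_simps)
    ultimately have "1 + \<bar>y1\<bar> + \<bar>y2\<bar> \<le> (1 + 2 * k) * sqrt \<rho>" using y by linarith
    then have "B * (1 + \<bar>y1\<bar> + \<bar>y2\<bar>) \<le> (B * (1 + 2 * k)) * sqrt \<rho>"
      using B(1) by (simp add: mult.assoc)
    then show ?thesis using B(2)[of y1 y2 t] \<rho>(1) unfolding x[symmetric] \<rho>_def[symmetric]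
      by (simp add: powr_half_sqrt)
  qed
  show "(\<lambda>x. norm (Phi a l \<alpha> c d e f P x - Phi0 a \<alpha> x))
       \<in> O[filtercomap (\<lambda>x. norm (Phi0 a \<alpha> x)) at_top](\<lambda>x. norm (Phi0 a \<alpha> x) powr (1/2))"
  proof (rule bigoI[where c = "B * (1 + 2 * k)"])
    have "\<forall>\<^sub>F x in filtercomap (\<lambda>x. norm (Phi0 a \<alpha> x)) at_top. norm (Phi0 a \<alpha> x) \<ge> 1"
      by (rule eventually_filtercomapI[OF eventually_ge_at_top])
    then show "\<forall>\<^sub>F x in filtercomap (\<lambda>x. norm (Phi0 a \<alpha> x)) at_top.
       norm (norm (Phi a l \<alpha> c d e f P x - Phi0 a \<alpha> x)) \<le> B * (1 + 2 * k) * norm (norm (Phi0 a \<alpha> x) powr (1/2))"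
      by (rule eventually_mono) (use bd in auto)
  qed
qed (simp_all add: Phi_deck Phi0_deck)

text \<open>Modulo deck transformations t lies in [0, 2 pi], and bounded values force bounded (y_1, y_2). So
  near any point the image agrees with the image of a compact set.\<close>

lemma closed_range_Phi:
  assumes "P \<in> param_space c d e f"
  shows "closed (range (Phi a l \<alpha> c d e f P))"
proof -
  let ?F = "Phi a l \<alpha> c d e f P"
  obtain B where B: "B > 0" "\<And>y1 y2 t. norm (?F (y1, y2, t) - Phi0 a \<alpha> (y1, y2, t)) \<le> B * (1 + \<bar>y1\<bar> + \<bar>y2\<bar>)"
    using norm_Phi_minus_Phi0_le[of a l \<alpha> c d e f P] by metis
  have cont: "continuous_on UNIV ?F"
    using special_Lagrangian_3fold_Phi[OF assms] unfolding special_Lagrangian_3fold_def smooth_map_def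
    by (metis Ck.simps(1))
  have "z \<in> range ?F" if z: "z \<in> closure (range ?F)" for z
  proof -
    define N where "N = norm z + 1"
    define \<beta> where "\<beta> = s1 / 2"
    have \<beta>: "\<beta> > 0" using s_pos by (simp add: \<beta>_def)
    define R where "R = (2 * B + B + N) / \<beta> + 1"
    have N: "N > 0" unfolding N_def by (simp add: add_nonneg_pos)
    have R: "R > 0" "\<beta> * R > 2 * B + B + N" using B(1) N \<beta> by (simp_all add: R_def add_pos_pos field_simps)
    have big: "\<bar>y1\<bar> \<le> R \<and> \<bar>y2\<bar> \<le> R" if F: "norm (?F (y1, y2, t)) \<le> N" for y1 y2 t
    proof -
      define M where "M = max \<bar>y1\<bar> \<bar>y2\<bar>"
      have "M \<le> R"
      proof (rule ccontr)
        assume "\<not> M \<le> R"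
        then have MR: "M > R" "M > 1" using R B N \<beta> by (auto simp: R_def add_pos_pos intro: less_trans[of 1])
           (smt (verit) B(1) divide_pos_pos)
        have "M^2 \<le> y1^2 + y2^2" unfolding M_def by (cases "\<bar>y1\<bar> \<le> \<bar>y2\<bar>") (auto simp: max_def)
        then have "\<beta> * M^2 \<le> \<beta> * (y1^2 + y2^2)" using \<beta> by simp
        also have "\<dots> \<le> norm (Phi0 a \<alpha> (y1, y2, t))" unfolding \<beta>_def by (rule norm_Phi0_ge)
        also have "\<dots> \<le> norm (?F (y1, y2, t)) + norm (?F (y1, y2, t) - Phi0 a \<alpha> (y1, y2, t))"
          by (metis norm_minus_commute norm_triangle_sub)
        also have "\<dots> \<le> N + B * (1 + 2 * M)"
          using F B(2)[of y1 y2 t] mult_left_mono[of "1 + \<bar>y1\<bar> + \<bar>y2\<bar>" "1 + 2 * M" B] B(1)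
          unfolding M_def by linarith
        also have "\<dots> \<le> (N + B + 2 * B) * M"
        proof -
          have "(N + B) * 1 \<le> (N + B) * M" using MR N B(1) by (intro mult_left_mono) auto
          then show ?thesis by (simp add: algebra_simps)
        qed
        also have "\<dots> < (\<beta> * R) * M" using R MR by (intro mult_strict_right_mono) auto
        also have "\<dots> \<le> (\<beta> * M) * M" using MR \<beta> by (intro mult_right_mono mult_left_mono) auto
        finally show False by (simp add: power2_eq_square mult.assoc)
      qed
      then show ?thesis by (simp add: M_def)
    qed
    define K where "K = {-R..R} \<times> {-R..R} \<times> {0..2*pi}"
    have "compact K" unfolding K_def by (intro compact_Times compact_Icc)
    then have "closed (?F ` K)"
      by (intro compact_imp_closed compact_continuous_image continuous_on_subset[OF cont]) auto
    moreover have "ball z 1 \<inter> range ?F \<subseteq> ?F ` K"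
    proof
      fix v assume v: "v \<in> ball z 1 \<inter> range ?F"
      then obtain y1 y2 t where vF: "v = ?F (y1, y2, t)" by (metis IntE imageE prod_cases3)
      define n where "n = - \<lfloor>t / (2 * pi)\<rfloor>"
      have "norm v \<le> N" using v norm_triangle_ineq2[of v z] by (simp add: N_def dist_norm norm_minus_commute)
      then have F: "norm (?F (deck n (y1, y2, t))) \<le> N" by (simp add: vF Phi_deck)
      have t: "t + 2 * pi * of_int n \<in> {0..2*pi}"
      proof -
        obtain k where k: "k = \<lfloor>t / (2 * pi)\<rfloor>" by simp
        then have "real_of_int k \<le> t / (2 * pi)" "t / (2 * pi) \<le> real_of_int k + 1" by linarith+
        then show ?thesis unfolding n_def k[symmetric] by (simp add: field_simps)
      qed
      have "deck n (y1, y2, t) \<in> K"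
        using big[of "(-1) powi n * y1" "(-1) powi n * y2" "t + 2 * pi * of_int n"] F t
        unfolding K_def deck_def by auto
      then show "v \<in> ?F ` K" using vF Phi_deck[of P n "(y1, y2, t)"] by (metis image_eqI)
    qed
    moreover have "z \<in> closure (ball z 1 \<inter> range ?F)"
      using open_Int_closure_subset[of "ball z 1" "range ?F"] z by auto
    ultimately have "z \<in> ?F ` K" using closure_minimal by blast
    then show ?thesis by blast
  qed
  then show ?thesis using closure_subset_eq by blast
qed

end

section \<open>The quotient of the parameter space\<close>

lemma deck_0: "deck 0 x = x"
  by (cases x) (simp add: deck_def)

lemma deck_deck: "deck n (deck k x) = deck (n + k) x"
proof -
  have "(-1) powi n * ((-1) powi k * y) = (-1) powi (n + k) * y" for y :: real
    by (simp add: power_int_add)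
  then show ?thesis by (cases x) (simp add: deck_def algebra_simps)
qed

lemma deck_orbit_eq_iff: "deck_orbit x = deck_orbit x' \<longleftrightarrow> (\<exists>n. x' = deck n x)"
proof
  assume "deck_orbit x = deck_orbit x'"
  moreover have "x' \<in> deck_orbit x'" unfolding deck_orbit_def by (metis deck_0 rangeI)
  ultimately show "\<exists>n. x' = deck n x" unfolding deck_orbit_def by auto
next
  assume "\<exists>n. x' = deck n x"
  then obtain n where n: "x' = deck n x" ..
  have "deck k x = deck (k - n) x'" "deck k x' = deck (k + n) x" for k
    by (simp_all add: n deck_deck)
  then have "deck k x \<in> deck_orbit x'" "deck k x' \<in> deck_orbit x" for k
    unfolding deck_orbit_def by (metis rangeI)+
  then show "deck_orbit x = deck_orbit x'" unfolding deck_orbit_def by blast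
qed

lemma cis_eq_iff: "cis t = cis t' \<longleftrightarrow> (\<exists>n::int. t' = t + 2 * pi * of_int n)"
proof
  assume "cis t = cis t'"
  then have "sin t' = sin t \<and> cos t' = cos t" by (simp add: complex_eq_iff)
  then show "\<exists>n::int. t' = t + 2 * pi * of_int n" unfolding sin_cos_eq_iff .
next
  assume "\<exists>n::int. t' = t + 2 * pi * of_int n"
  then obtain n :: int where n: "t' = t + 2 * pi * of_int n" ..
  show "cis t = cis t'" unfolding n using cis_int_period[of 1 t n] by simp
qed

lemma unit_eq_cis:
  assumes "cmod z = 1"
  obtains t where "z = cis t"
proof (rule that)
  have "z \<noteq> 0" using assms by auto
  then show "z = cis (Arg z)" using assms by (simp add: cis_Arg sgn_eq)
qed

text \<open>The factor cis (t/2) changes sign with t + 2 pi, which undoes the sign in the deck transformation.\<close>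

definition tube_coord :: "real \<times> real \<times> real \<Rightarrow> complex \<times> complex" where
  "tube_coord = (\<lambda>(y1, y2, t). (cis t, cis (t/2) * Complex y1 y2))"

lemma tube_coord_eq_iff: "tube_coord x = tube_coord x' \<longleftrightarrow> deck_orbit x = deck_orbit x'"
proof -
  obtain y1 y2 t where x: "x = (y1, y2, t)" by (metis prod_cases3)
  obtain y1' y2' t' where x': "x' = (y1', y2', t')" by (metis prod_cases3)
  have half: "cis ((t + 2 * pi * of_int n) / 2) = complex_of_real ((-1) powi n) * cis (t / 2)" for n
    using cis_half_period[of 1 t n] by simp
  have "tube_coord x = tube_coord x' \<longleftrightarrow> (\<exists>n::int. t' = t + 2 * pi * of_int n \<and>
      cis (t/2) * Complex y1 y2 = cis (t'/2) * Complex y1' y2')"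
    by (auto simp: tube_coord_def x x' cis_eq_iff)
  also have "\<dots> \<longleftrightarrow> (\<exists>n. x' = deck n x)"
  proof (intro ex_cong1 conj_cong refl)
    fix n :: int
    have "cis (t/2) * Complex y1 y2 = cis ((t + 2 * pi * of_int n)/2) * Complex y1' y2'
        \<longleftrightarrow> cis (t/2) * Complex y1 y2 = cis (t/2) * (of_real ((-1) powi n) * Complex y1' y2')"
      unfolding half by (simp add: mult_ac)
    also have "\<dots> \<longleftrightarrow> Complex y1 y2 = of_real ((-1) powi n) * Complex y1' y2'" by simp
    also have "\<dots> \<longleftrightarrow> y1' = (-1) powi n * y1 \<and> y2' = (-1) powi n * y2"
      by (auto simp: sign_powi complex_eq_iff)
    finally show "(t' = t + 2 * pi * of_int n \<and> cis (t/2) * Complex y1 y2 = cis (t'/2) * Complex y1' y2')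
        \<longleftrightarrow> x' = deck n x"
      by (auto simp: x x' deck_def)
  qed
  finally show ?thesis unfolding deck_orbit_eq_iff .
qed

lemma has_derivative_tube_coord:
  "(tube_coord has_derivative (\<lambda>(h1, h2, h3). (of_real h3 * (\<i> * cis t),
     cis (t/2) * Complex h1 h2 + of_real h3 * (\<i>/2 * cis (t/2) * Complex y1 y2)))) (at (y1, y2, t))"
proof -
  have e: "tube_coord = (\<lambda>x. (cis (snd (snd x)), cis (snd (snd x) / 2) * (of_real (fst x) + \<i> * of_real (fst (snd x)))))"
    by (auto simp: tube_coord_def fun_eq_iff complex_eq_iff)
  show ?thesis unfolding e
    apply (rule has_derivative_eq_rhs)
     apply (rule derivative_eq_intros refl | simp)+
    apply (auto simp: fun_eq_iff scaleR_complex complex_eq_iff field_simps)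
    done
qed

lemma exhibits_quotient_tube_coord: "exhibits_quotient tube_coord (sphere 0 1 \<times> UNIV)"
  unfolding exhibits_quotient_def
proof (intro conjI allI)
  have e: "tube_coord = (\<lambda>x. (cis (snd (snd x)), cis (1/2 * snd (snd x)) * (of_real (fst x) + \<i> * of_real (fst (snd x)))))"
    by (auto simp: tube_coord_def fun_eq_iff complex_eq_iff)
  show "smooth_map tube_coord" unfolding e by (intro smooth_intros)
  show "immersive_at tube_coord x" for x
  proof -
    obtain y1 y2 t where x: "x = (y1, y2, t)" by (metis prod_cases3)
    let ?D = "\<lambda>(h1, h2, h3). (of_real h3 * (\<i> * cis t),
     cis (t/2) * Complex h1 h2 + of_real h3 * (\<i>/2 * cis (t/2) * Complex y1 y2))"
    have D: "(tube_coord has_derivative ?D) (at x)" unfolding x by (rule has_derivative_tube_coord)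
    have fd: "frechet_derivative tube_coord (at x) = ?D" using frechet_derivative_at[OF D] by (rule sym)
    have lin: "linear ?D" using has_derivative_linear[OF D] .
    have "inj ?D"
    proof (rule linear_injective_0[THEN iffD2, rule_format])
      show "linear ?D" by (rule lin)
    next
      fix h assume z: "?D h = 0"
      obtain h1 h2 h3 where h: "h = (h1, h2, h3)" by (metis prod_cases3)
      from z have "h3 = 0" by (simp add: h zero_prod_def)
      with z have "Complex h1 h2 = 0" by (simp add: h zero_prod_def)
      with \<open>h3 = 0\<close> show "h = 0" by (simp add: h zero_prod_def complex_eq_iff)
    qed
    then show ?thesis using D unfolding immersive_at_def fd differentiable_def by blast
  qed
  show "range tube_coord = sphere 0 1 \<times> UNIV"
  proof
    show "range tube_coord \<subseteq> sphere 0 1 \<times> UNIV" by (auto simp: tube_coord_def)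
    show "sphere 0 1 \<times> UNIV \<subseteq> range tube_coord"
    proof clarify
      fix z w :: complex assume "z \<in> sphere 0 1"
      then obtain t where t: "z = cis t" using unit_eq_cis[of z] by auto
      define v where "v = cis (- (t/2)) * w"
      have "tube_coord (Re v, Im v, t) = (z, w)"
        unfolding tube_coord_def split_conv complex_surj
        by (simp add: t v_def cis_mult mult.assoc[symmetric])
      then show "(z, w) \<in> range tube_coord" by (metis rangeI)
    qed
  qed
  show "tube_coord x = tube_coord x' \<longleftrightarrow> deck_orbit x = deck_orbit x'" for x x'
    by (rule tube_coord_eq_iff)
qed

context integral_family
begin

lemma immersed_S1xR2_Phi:
  assumes P: "P \<in> param_space c d e f" and imm: "\<And>x. immersive_at (Phi a l \<alpha> c d e f P) x"
  shows "immersed_S1xR2 (Phi a l \<alpha> c d e f P)"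
  unfolding immersed_S1xR2_def
proof (intro conjI allI exI)
  let ?F = "Phi a l \<alpha> c d e f P"
  show "smooth_map ?F" using special_Lagrangian_3fold_Phi[OF P] by (simp add: special_Lagrangian_3fold_def)
  show "exhibits_quotient tube_coord (sphere 0 1 \<times> UNIV)" by (rule exhibits_quotient_tube_coord)
  show "?F x = (\<lambda>z. ?F (SOME x'. tube_coord x' = z)) (tube_coord x)" for x
  proof -
    have "tube_coord (SOME x'. tube_coord x' = tube_coord x) = tube_coord x" by (rule someI) (rule refl)
    then obtain n where "x = deck n (SOME x'. tube_coord x' = tube_coord x)"
      unfolding tube_coord_eq_iff deck_orbit_eq_iff by blast
    then show ?thesis using Phi_deck by metis
  qed
qed (rule imm)

end

section \<open>Dimension counts\<close>

lemma smooth_map_imp_differentiable_on: "smooth_map f \<Longrightarrow> f differentiable_on S"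
  unfolding smooth_map_def by (meson Ck.simps(2) differentiable_on_subset subset_UNIV)

text \<open>Precomposing with a linear isomorphism from a subspace of the target type turns the map into a
  self-map, defined on a set that is negligible because its dimension is too small.\<close>

lemma negligible_differentiable_image_dim:
  fixes f :: "'a::euclidean_space \<Rightarrow> 'b::euclidean_space"
  assumes dim: "dim S < DIM('b)" and diff: "f differentiable_on S"
  shows "negligible (f ` S)"
proof -
  have "dim S \<le> dim (UNIV :: 'b set)" using dim by simp
  then obtain T :: "'b set" where T: "subspace T" "dim T = dim S"
    by (rule choose_subspace_of_subspace)
  have "dim T = dim (span S)" using T by simp
  then obtain L :: "'b \<Rightarrow> 'a" and L' where L: "linear L" "L ` T = span S"
    by (rule isometries_subspaces[OF T(1) subspace_span])
  define T' where "T' = {x \<in> T. L x \<in> S}"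
  have "L ` T' = S"
  proof
    show "L ` T' \<subseteq> S" by (auto simp: T'_def)
    show "S \<subseteq> L ` T'"
    proof
      fix x assume x: "x \<in> S"
      then have "x \<in> L ` T" unfolding L(2) by (rule span_base)
      then obtain y where "y \<in> T" "x = L y" by blast
      with x show "x \<in> L ` T'" by (auto simp: T'_def)
    qed
  qed
  then have "f ` S = (f \<circ> L) ` T'" by (metis image_comp)
  moreover have "negligible ((f \<circ> L) ` T')"
  proof (rule negligible_differentiable_image_negligible)
    have "negligible T" using negligible_lowdim T(2) dim by metis
    then show "negligible T'" by (rule negligible_subset) (auto simp: T'_def)
    show "f \<circ> L differentiable_on T'"
      unfolding differentiable_on_def
    proof
      fix x assume x: "x \<in> T'"
      have "L differentiable (at x within T')" by (rule linear_imp_differentiable[OF L(1)])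
      moreover have "f differentiable (at (L x) within L ` T')"
        using diff x \<open>L ` T' = S\<close> unfolding differentiable_on_def by blast
      ultimately show "f \<circ> L differentiable (at x within T')" by (rule differentiable_chain_within)
    qed
  qed simp
  ultimately show ?thesis by simp
qed

lemma negligible_image_of_dim_at_most:
  fixes h :: "'a::euclidean_space \<Rightarrow> 'b::euclidean_space"
  assumes B: "dim_at_most k B" and k: "k < DIM('b)" and h: "smooth_map h"
  shows "negligible (h ` B)"
proof -
  from B obtain f :: "nat \<Rightarrow> 'a \<Rightarrow> 'a" and S where
    fS: "\<And>n. dim (S n) \<le> k" "\<And>n. f n differentiable_on S n" "B \<subseteq> (\<Union>n. f n ` S n)"
    unfolding dim_at_most_def by blast
  have "negligible ((h \<circ> f n) ` S n)" for n
  proof (rule negligible_differentiable_image_dim)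
    show "dim (S n) < DIM('b)" using fS(1) k by (rule le_less_trans)
    show "h \<circ> f n differentiable_on S n"
      unfolding differentiable_on_def
    proof
      fix x assume "x \<in> S n"
      then have "f n differentiable (at x within S n)" using fS(2) unfolding differentiable_on_def by blast
      moreover have "h differentiable (at (f n x) within f n ` S n)"
        using smooth_map_imp_differentiable_on[OF h, of UNIV] unfolding differentiable_on_def
        by (metis UNIV_I differentiable_within_subset subset_UNIV)
      ultimately show "h \<circ> f n differentiable (at x within S n)" by (rule differentiable_chain_within)
    qed
  qed
  then have "negligible (\<Union>n. (h \<circ> f n) ` S n)" by (rule negligible_Union_nat)
  moreover have "h ` B \<subseteq> (\<Union>n. (h \<circ> f n) ` S n)" using fS(3) by fastforce
  ultimately show ?thesis by (rule negligible_subset)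
qed

lemma smooth_divide_const: "smooth_map f \<Longrightarrow> smooth_map (\<lambda>x. f x / (k :: real))"
  unfolding divide_inverse by (intro smooth_intros)

context special_family
begin

text \<open>Where C is nonzero the equation of the parameter space can be solved for the imaginary part of
  C' cnj C, because K is nonzero. So the map \<open>h\<close> to a 13-dimensional space, which forgets that
  imaginary part, sends a neighbourhood in the parameter space onto a set with interior. Points
  with C = 0 are limits of such points.\<close>

lemma param_space_not_dim_12:
  assumes U: "open U" "U \<inter> param_space c d e f \<noteq> {}"
  shows "\<not> dim_at_most 12 (U \<inter> param_space c d e f)"
proof
  assume dim: "dim_at_most 12 (U \<inter> param_space c d e f)"
  define K K' where K: "K = K_const c d" "K' = K_const e f"
  have Kpos: "K > 0" using K1_pos by (simp add: K)
  define h :: "param \<Rightarrow> real \<times> complex \<times> complex \<times> complex \<times> (complex^3)" where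
    "h = (\<lambda>(C, D, C', D', E). (Re (C' * cnj C), C, D, D', E))"
  define g :: "real \<times> complex \<times> complex \<times> complex \<times> (complex^3) \<Rightarrow> param" where
    "g = (\<lambda>(\<rho>, C, D, D', E). (C, D, (of_real \<rho> + \<i> * of_real (K'/K * Im (D * cnj D'))) / cnj C, D', E))"
  define A :: "(real \<times> complex \<times> complex \<times> complex \<times> (complex^3)) set" where "A = {x. fst (snd x) \<noteq> 0}"
  have "h = (\<lambda>x. (Re (fst (snd (snd x)) * cnj (fst x)), fst x, fst (snd x), fst (snd (snd (snd x))), snd (snd (snd (snd x)))))"
    by (auto simp: h_def)
  then have "smooth_map h"
    by (simp only:) (intro smooth_intros smooth_linear_comp[OF bounded_linear_Re] smooth_linear_comp[OF bounded_linear_cnj])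
  then have neg: "negligible (h ` (U \<inter> param_space c d e f))"
    by (rule negligible_image_of_dim_at_most[OF dim, rotated]) simp
  have "open A" unfolding A_def by (intro open_Collect_neq continuous_intros)
  have geq: "g = (\<lambda>x. (fst (snd x), fst (snd (snd x)),
     (of_real (fst x) + \<i> * of_real (K'/K * Im (fst (snd (snd x)) * cnj (fst (snd (snd (snd x))))))) / cnj (fst (snd x)),
     fst (snd (snd (snd x))), snd (snd (snd (snd x)))))"
    by (auto simp: g_def)
  have "continuous_on A g" unfolding geq by (intro continuous_intros) (auto simp: A_def)
  then have op: "open (A \<inter> g -` U)" using \<open>open A\<close> U(1) by (rule continuous_open_preimage)
  have gP: "g x \<in> param_space c d e f" "h (g x) = x" if "x \<in> A" for x
  proof -
    obtain \<rho> C D D' E where x: "x = (\<rho>, C, D, D', E)" by (metis prod_cases5)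
    have C: "C \<noteq> 0" using that by (simp add: A_def x)
    let ?\<mu> = "K'/K * Im (D * cnj D')"
    define C' where "C' = (of_real \<rho> + \<i> * of_real ?\<mu>) / cnj C"
    have e: "C' * cnj C = of_real \<rho> + \<i> * of_real ?\<mu>" using C by (simp add: C'_def)
    have "C * cnj C' = cnj (C' * cnj C)" by (simp add: mult.commute)
    then have "Im (C * cnj C') = - ?\<mu>" unfolding e by simp
    then have "Im (C * cnj C') * K + Im (D * cnj D') * K' = 0" using Kpos by (simp add: field_simps)
    then show "g x \<in> param_space c d e f"
      unfolding g_def x param_space_def mem_Collect_eq split_conv C'_def[symmetric] K[symmetric] .
    have "Re (C' * cnj C) = \<rho>" unfolding e by simp
    then show "h (g x) = x" unfolding g_def h_def x split_conv C'_def[symmetric] by simp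
  qed
  have "A \<inter> g -` U \<subseteq> h ` (U \<inter> param_space c d e f)"
  proof
    fix x assume "x \<in> A \<inter> g -` U"
    with gP[of x] show "x \<in> h ` (U \<inter> param_space c d e f)" by (metis IntD1 IntD2 IntI image_eqI vimageD)
  qed
  with neg have "negligible (A \<inter> g -` U)" by (rule negligible_subset)
  moreover have "A \<inter> g -` U \<noteq> {}"
  proof -
    obtain C D C' D' E where P: "(C, D, C', D', E) \<in> U" "(C, D, C', D', E) \<in> param_space c d e f"
      using U(2) by (metis IntE ex_in_conv prod_cases5)
    obtain C1 where P1: "(C1, D, C', D', E) \<in> U" "(C1, D, C', D', E) \<in> param_space c d e f" "C1 \<noteq> 0"
    proof (cases "C = 0")
      case False with P that show ?thesis by blast
    next
      case True
      obtain \<epsilon> where \<epsilon>: "\<epsilon> > 0" "ball (C, D, C', D', E) \<epsilon> \<subseteq> U" using U(1) P(1) open_contains_ball by blast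
      \<comment> \<open>Moving C from 0 in the direction of C' keeps Im (C cnj C') = 0.\<close>
      define w where "w = (if C' = 0 then 1 else C')"
      define C1 where "C1 = of_real (\<epsilon> / (2 * cmod w)) * w"
      have w: "w \<noteq> 0" by (simp add: w_def)
      have "cmod C1 = \<epsilon> / 2" using w \<epsilon>(1) unfolding C1_def norm_mult norm_of_real by simp
      then have "(C1, D, C', D', E) \<in> U" using \<epsilon> True
        by (intro subsetD[OF \<epsilon>(2)]) (simp add: dist_Pair_Pair dist_norm)
      moreover have "Im (C1 * cnj C') = 0" by (simp add: C1_def w_def)
      then have "(C1, D, C', D', E) \<in> param_space c d e f" using P(2) True by (simp add: param_space_def)
      moreover have "C1 \<noteq> 0" using w \<epsilon>(1) by (simp add: C1_def)
      ultimately show ?thesis by (rule that)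
    qed
    define x where "x = h (C1, D, C', D', E)"
    have "g x = (C1, D, C', D', E)"
    proof -
      have "Im (C1 * cnj C') * K + Im (D * cnj D') * K' = 0" using P1(2) by (simp add: param_space_def K)
      then have "K'/K * Im (D * cnj D') = Im (C' * cnj C1)" using Kpos by (simp add: field_simps)
      then have "of_real (Re (C' * cnj C1)) + \<i> * of_real (K'/K * Im (D * cnj D')) = C' * cnj C1"
using complex_eq[of "C' * cnj C1"] by simp
      then show ?thesis using P1(3) unfolding x_def h_def g_def split_conv by (simp only:) simp
    qed
    then have "x \<in> A \<inter> g -` U" using P1 by (simp add: A_def x_def h_def)
    then show ?thesis by blast
  qed
  ultimately show False using open_not_negligible op by blast
qed

definition indef :: "real^3 \<Rightarrow> real^3 \<Rightarrow> real" where
  "indef u v = u$1 * v$1 - u$2 * v$2 - u$3 * v$3"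

text \<open>The coefficients of C and of D in given real parts \<open>u\<close> and imaginary parts \<open>v\<close> of the modes, by
  projection with the indefinite form. Real parts may contain a multiple of the vector of the
  sqrt (alpha_j): it is orthogonal to the differences, so the projection ignores it.\<close>

definition amp1 :: "real^3 \<Rightarrow> real^3 \<Rightarrow> complex" where
  "amp1 u v = of_real (indef (c - d) u / K_const c d) + \<i> * of_real (indef (c + d) v / K_const c d)"

definition amp3 :: "real^3 \<Rightarrow> real^3 \<Rightarrow> complex" where
  "amp3 u v = of_real (indef (e - f) u / K_const e f) + \<i> * of_real (indef (e + f) v / K_const e f)"

lemma amplitudes_of_values:
  assumes u: "\<And>j. u $ j = y * sqrt (\<alpha>$j) + Re (mode c d e f X Y j)"
    and v: "\<And>j. v $ j = Im (mode c d e f X Y j)"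
  shows "X = amp1 u v" "Y = amp3 u v"
proof -
  have pl: "indef (c - d) (\<chi> j. sqrt (\<alpha>$j)) = 0" "indef (e - f) (\<chi> j. sqrt (\<alpha>$j)) = 0"
    using eigenpair_plane[OF ep1] eigenpair_plane[OF ep3] l_pos by (simp_all add: indef_def mult_ac)
  have K: "indef (c - d) (c + d) = K_const c d" "indef (e - f) (e + f) = K_const e f"
    by (simp_all add: K_const_def indef_def algebra_simps power2_eq_square)
  have orth: "indef (c - d) (e + f) = 0" "indef (e - f) (c + d) = 0"
    using orthogonal_modes by (simp_all add: indef_def algebra_simps)
  have lin: "indef z (y1 *\<^sub>R p + y2 *\<^sub>R q + y3 *\<^sub>R r) = y1 * indef z p + y2 * indef z q + y3 * indef z r" for z y1 y2 y3 p q r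
    by (simp add: indef_def algebra_simps)
  have sym: "indef p q = indef q p" for p q by (simp add: indef_def mult_ac)
  have ue: "u = y *\<^sub>R (\<chi> j. sqrt (\<alpha>$j)) + Re X *\<^sub>R (c + d) + Re Y *\<^sub>R (e + f)"
    using u by (simp add: vec_eq_iff Re_mode)
  have ve: "v = 0 *\<^sub>R (\<chi> j. sqrt (\<alpha>$j)) + Im X *\<^sub>R (c - d) + Im Y *\<^sub>R (e - f)"
    using v by (simp add: vec_eq_iff Im_mode)
  show "X = amp1 u v" "Y = amp3 u v"
    unfolding amp1_def amp3_def ue ve lin pl orth K sym[of "c + d" "c - d"] sym[of "e + f" "e - f"]
      sym[of "c + d" "e - f"] sym[of "e + f" "c - d"]
    using K1_pos K3_pos by (simp_all add: complex_eq_iff)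
qed

text \<open>A form of all parameters for which m u + n v = 0 somewhere, with (m, n) = (cos, sin) of an angle. The
  real parts of u and v then have three free coefficients b_j; the imaginary parts lie in the plane
  of \<open>eigenpair_plane\<close>, which leaves a single coefficient kappa. The six real parameters are
  packed into three complex numbers, so that the relevant arguments form a 12-dimensional subspace of
  the parameter type itself.\<close>

definition degenerate :: "param \<Rightarrow> param" where
  "degenerate = (\<lambda>(z1, z2, z3, w, E).
     let t = Re z1; m = cos (Im z1); n = sin (Im z1); \<kappa> = Re z2; b1 = Im z2; b2 = Re z3; b3 = Im z3;
       u = vector [b1 * n, b2 * n, b3 * m];
       u' = vector [- (b1 * m), b2 * m, - (b3 * n)];
       v = vector [\<kappa> * n / s1, \<kappa> * (n^2 - m^2) * n / s2, \<kappa> * 2 * m^2 * n / s3];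
       v' = vector [- (\<kappa> * m / s1), \<kappa> * (n^2 - m^2) * m / s2, - (\<kappa> * 2 * n^2 * m / s3)]
     in (amp1 u v * cis (- (l/2 * t)), amp3 u v * cis (- (3*l/2 * t)),
         amp1 u' v' * cis (- (l/2 * t)), amp3 u' v' * cis (- (3*l/2 * t)), E))"

lemma smooth_degenerate: "smooth_map degenerate"
proof -
  note pr = smooth_linear_comp[OF bounded_linear_Re] smooth_linear_comp[OF bounded_linear_Im]
  have "degenerate = (\<lambda>x. degenerate (fst x, fst (snd x), fst (snd (snd x)), fst (snd (snd (snd x))), snd (snd (snd (snd x)))))"
    by simp
  then show ?thesis
    unfolding degenerate_def split_conv Let_def amp1_def amp3_def indef_def vector_3
    by (simp only:) (intro smooth_intros smooth_divide_const smooth_cos smooth_sin pr)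
qed

text \<open>If v = z u with complex z, then omega(u, v) is Im z times the squared norm of u.\<close>

lemma real_dependent_of_ccross_0:
  assumes "ccross u v = 0" "kaehler_form u v = 0"
  obtains m n :: real where "m^2 + n^2 = 1" "\<And>j. of_real m * u$j + of_real n * v$j = 0"
proof (cases "u = 0")
  case True
  show ?thesis by (rule that[of 1 0]) (simp_all add: True)
next
  case False
  then obtain j where j: "u $ j \<noteq> 0" by (auto simp: vec_eq_iff)
  define z where "z = v $ j / u $ j"
  have "u $ i * v $ k = u $ k * v $ i" for i k
    using assms(1) exhaust_3[of i] exhaust_3[of k] by (auto simp: ccross_def vec_eq_iff forall_3 mult_ac)
  then have v: "v $ k = z * u $ k" for k using j by (simp add: z_def field_simps)
  have "kaehler_form u v = of_real (Im z * (\<Sum>k\<in>UNIV. (cmod (u $ k))^2))"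
  proof -
    have "Im (u $ k * cnj (v $ k)) = - Im z * (cmod (u $ k))^2" for k
    proof -
      have "u $ k * cnj (v $ k) = of_real ((cmod (u $ k))^2) * cnj z"
        unfolding v complex_norm_square by (simp add: mult_ac)
      then show ?thesis by simp
    qed
    then show ?thesis unfolding kaehler_form_eq_sum_Im by (simp add: sum_distrib_left sum_negf)
  qed
  moreover have "(\<Sum>k\<in>UNIV. (cmod (u $ k))^2) \<noteq> 0"
    using j by (auto simp: sum_nonneg_eq_0_iff)
  ultimately have "Im z = 0" using assms(2) by (metis mult_eq_0_iff of_real_eq_0_iff)
  then have z: "z = of_real (Re z)" by (simp add: complex_eq_iff)
  define N where "N = sqrt ((Re z)^2 + 1)"
  have N: "N > 0" "N^2 = (Re z)^2 + 1" unfolding N_def by (auto simp: add_nonneg_pos)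
  show ?thesis
  proof (rule that[of "Re z / N" "- 1 / N"])
    show "(Re z / N)\<^sup>2 + (- 1 / N)\<^sup>2 = 1" using N(1) by (simp add: power_divide add_divide_distrib[symmetric] N(2)[symmetric])
    show "complex_of_real (Re z / N) * u $ k + complex_of_real (- 1 / N) * v $ k = 0" for k
      unfolding v by (subst (2) z) simp
  qed
qed

lemma degenerate_of_not_immersive:
  assumes P: "(C, D, C', D', E) \<in> param_space c d e f"
    and ni: "\<not> immersive_at (Phi a l \<alpha> c d e f (C, D, C', D', E)) x"
  shows "\<exists>z1 z2 z3. (C, D, C', D', E) = degenerate (z1, z2, z3, 0, E)"
proof -
  interpret evolving_quadrics "w_fun a \<alpha>" "p_fun a l c d e f C D" "p_fun a l c d e f C' D'"
     "\<lambda>t. r_main a l c d e f C D C' D' E t + r_even a l c d e f C D C' D' t"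
    using evolving_quadrics_Phi P .
  obtain y1 y2 t where x: "x = (y1, y2, t)" by (metis prod_cases3)
  have "ccross (quad_d1 (w_fun a \<alpha>) (p_fun a l c d e f C D) (p_fun a l c d e f C' D') x)
      (quad_d2 (w_fun a \<alpha>) (p_fun a l c d e f C D) (p_fun a l c d e f C' D') x) = 0"
    using ni immersive_at_quad_map_iff[of x] unfolding Phi_eq_quad_map by simp
  then obtain m n :: real where mn: "m^2 + n^2 = 1" and dep0:
    "\<And>j. of_real m * quad_d1 (w_fun a \<alpha>) (p_fun a l c d e f C D) (p_fun a l c d e f C' D') x $ j
     + of_real n * quad_d2 (w_fun a \<alpha>) (p_fun a l c d e f C D) (p_fun a l c d e f C' D') x $ j = 0"
    by (rule real_dependent_of_ccross_0[OF _ isotropic]) blast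
  define X Y X' Y' where X: "X = C * cis (l/2 * t)" "Y = D * cis (3*l/2 * t)"
    "X' = C' * cis (l/2 * t)" "Y' = D' * cis (3*l/2 * t)"
  define L L' where L: "L = mode c d e f X Y" "L' = mode c d e f X' Y'"
  have dep: "of_real m * (of_real (y1 * s1) + L 1) + of_real n * (of_real (y2 * s1) + L' 1) = 0"
    "of_real m * (of_real (y1 * s2) + L 2) - of_real n * (of_real (y2 * s2) + L' 2) = 0"
    "of_real m * (of_real (y2 * s3) + L' 3) + of_real n * (of_real (y1 * s3) + L 3) = 0"
  proof -
    note q = dep0[unfolded x quad_d_modes, folded X, folded L]
    have fac: "cis r * z = 0 \<Longrightarrow> z = 0" "\<i> * cis r * z = 0 \<Longrightarrow> z = 0" for r z by simp_all
    have "\<i> * cis (a$1 * t) * (of_real m * (of_real (y1 * s1) + L 1) + of_real n * (of_real (y2 * s1) + L' 1)) = 0"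
      using q[of 1] by (simp add: algebra_simps)
    moreover have "cis (a$2 * t) * (of_real m * (of_real (y1 * s2) + L 2) - of_real n * (of_real (y2 * s2) + L' 2)) = 0"
      using q[of 2] by (simp add: algebra_simps)
    moreover have "cis (a$3 * t) * (of_real m * (of_real (y2 * s3) + L' 3) + of_real n * (of_real (y1 * s3) + L 3)) = 0"
      using q[of 3] by (simp add: algebra_simps)
    ultimately show "of_real m * (of_real (y1 * s1) + L 1) + of_real n * (of_real (y2 * s1) + L' 1) = 0"
    "of_real m * (of_real (y1 * s2) + L 2) - of_real n * (of_real (y2 * s2) + L' 2) = 0"
    "of_real m * (of_real (y2 * s3) + L' 3) + of_real n * (of_real (y1 * s3) + L 3) = 0"
      using fac by blast+
  qed
  define u v u' v' :: "real^3" where uv: "u = (\<chi> j. y1 * sqrt (\<alpha>$j) + Re (L j))" "v = (\<chi> j. Im (L j))"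
    "u' = (\<chi> j. y2 * sqrt (\<alpha>$j) + Re (L' j))" "v' = (\<chi> j. Im (L' j))"
  have XY: "X = amp1 u v" "Y = amp3 u v" "X' = amp1 u' v'" "Y' = amp3 u' v'"
    using amplitudes_of_values[of u y1 X Y v] amplitudes_of_values[of u' y2 X' Y' v'] by (simp_all add: uv L)
  have re: "m * u$1 + n * u'$1 = 0" "m * u$2 - n * u'$2 = 0" "m * u'$3 + n * u$3 = 0"
    using arg_cong[OF dep(1), of Re] arg_cong[OF dep(2), of Re] arg_cong[OF dep(3), of Re] by (simp_all add: uv)
  have im: "m * v$1 + n * v'$1 = 0" "m * v$2 - n * v'$2 = 0" "m * v'$3 + n * v$3 = 0"
    using arg_cong[OF dep(1), of Im] arg_cong[OF dep(2), of Im] arg_cong[OF dep(3), of Im] by (simp_all add: uv)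
  have pl: "s1 * v$1 = s2 * v$2 + s3 * v$3" "s1 * v'$1 = s2 * v'$2 + s3 * v'$3"
  proof -
    have p: "s1 * (c - d)$1 = s2 * (c - d)$2 + s3 * (c - d)$3" "s1 * (e - f)$1 = s2 * (e - f)$2 + s3 * (e - f)$3"
      using eigenpair_plane[OF ep1] eigenpair_plane[OF ep3] l_pos by simp_all
    have "s1 * (y * (c - d)$1 + y' * (e - f)$1) = s2 * (y * (c - d)$2 + y' * (e - f)$2) + s3 * (y * (c - d)$3 + y' * (e - f)$3)" for y y'
      using arg_cong[OF p(1), of "\<lambda>q. y * q"] arg_cong[OF p(2), of "\<lambda>q. y' * q"] by (simp only: algebra_simps)
    then show "s1 * v$1 = s2 * v$2 + s3 * v$3" "s1 * v'$1 = s2 * v'$2 + s3 * v'$3"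
      by (simp_all add: uv L Im_mode del: vector_minus_component)
  qed
  \<comment> \<open>A solution of one linear equation in two unknowns is its component along the unit direction vector.\<close>
  have line: "p = (n * p - m * q) * n \<and> q = - ((n * p - m * q) * m)" if "m * p + n * q = 0" for p q
    using that mn by algebra
  have line': "p = (n * p + m * q) * n \<and> q = (n * p + m * q) * m" if "m * p - n * q = 0" for p q
    using that mn by algebra
  have line'': "q = (m * q - n * p) * m \<and> p = - ((m * q - n * p) * n)" if "m * p + n * q = 0" for p q
    using that mn by algebra
  define b1 b2 b3 g1 g2 g3 where b: "b1 = n * u$1 - m * u'$1" "b2 = n * u$2 + m * u'$2" "b3 = m * u$3 - n * u'$3"
    and g: "g1 = n * v$1 - m * v'$1" "g2 = n * v$2 + m * v'$2" "g3 = m * v$3 - n * v'$3"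
  have ub: "u$1 = b1 * n" "u'$1 = - (b1 * m)" "u$2 = b2 * n" "u'$2 = b2 * m" "u$3 = b3 * m" "u'$3 = - (b3 * n)"
    using line[OF re(1)] line'[OF re(2)] line''[OF re(3)] unfolding b by simp_all
  have vg: "v$1 = g1 * n" "v'$1 = - (g1 * m)" "v$2 = g2 * n" "v'$2 = g2 * m" "v$3 = g3 * m" "v'$3 = - (g3 * n)"
    using line[OF im(1)] line'[OF im(2)] line''[OF im(3)] unfolding g by simp_all
  define \<kappa> where "\<kappa> = s1 * g1"
  have "\<kappa> * n = (s2 * g2) * n + (s3 * g3) * m" "- (\<kappa> * m) = (s2 * g2) * m - (s3 * g3) * n"
    using pl unfolding vg \<kappa>_def by (simp_all add: algebra_simps)
  \<comment> \<open>The two plane equations are solved by rotating them through the angle of (m, n).\<close>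
  then have "s2 * g2 = \<kappa> * (n^2 - m^2)" "s3 * g3 = \<kappa> * 2 * m * n"
    using mn by algebra+
  then have "g1 = \<kappa> / s1" "g2 = \<kappa> * (n^2 - m^2) / s2" "g3 = \<kappa> * 2 * m * n / s3"
    using s_pos by (simp_all add: \<kappa>_def field_simps)
  note gv = vg[unfolded this]
  obtain \<theta> where \<theta>: "m = cos \<theta>" "n = sin \<theta>" using sincos_total_2pi[OF mn] by metis
  have u: "u = vector [b1 * n, b2 * n, b3 * m]" "u' = vector [- (b1 * m), b2 * m, - (b3 * n)]"
    by (simp_all add: vec_eq_iff forall_3 ub)
  have v: "v = vector [\<kappa> * n / s1, \<kappa> * (n^2 - m^2) * n / s2, \<kappa> * 2 * m^2 * n / s3]"
    "v' = vector [- (\<kappa> * m / s1), \<kappa> * (n^2 - m^2) * m / s2, - (\<kappa> * 2 * n^2 * m / s3)]"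
    by (simp_all add: vec_eq_iff forall_3 gv power2_eq_square)
  have CD: "C = X * cis (- (l/2 * t))" "D = Y * cis (- (3*l/2 * t))" "C' = X' * cis (- (l/2 * t))" "D' = Y' * cis (- (3*l/2 * t))"
    by (simp_all add: X cis_mult mult.assoc)
  have "(C, D, C', D', E) = degenerate (Complex t \<theta>, Complex \<kappa> b1, Complex b2 b3, 0, E)"
    unfolding degenerate_def split_conv Let_def complex.sel \<theta>[symmetric] u[symmetric] v[symmetric] XY[symmetric] CD[symmetric] ..
  then show ?thesis by blast
qed

end

context integral_family
begin

lemma generic_immersed:
  "positive_codim_in (param_space c d e f)
     {P \<in> param_space c d e f. \<not> immersed_S1xR2 (Phi a l \<alpha> c d e f P)}"
  unfolding positive_codim_in_def
proof (intro conjI exI[of _ 12] allI impI)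
  define S :: "param set" where "S = range (\<lambda>(z1, z2, z3, E). (z1, z2, z3, 0, E))"
  let ?B = "{P \<in> param_space c d e f. \<not> immersed_S1xR2 (Phi a l \<alpha> c d e f P)}"
  have sub: "?B \<subseteq> degenerate ` S"
  proof
    fix P assume P: "P \<in> ?B"
    then obtain x where x: "\<not> immersive_at (Phi a l \<alpha> c d e f P) x" using immersed_S1xR2_Phi by blast
    obtain C D C' D' E where e: "P = (C, D, C', D', E)" by (metis prod_cases5)
    obtain z1 z2 z3 where z: "P = degenerate (z1, z2, z3, 0, E)"
      using degenerate_of_not_immersive[of C D C' D' E x] x P unfolding e by blast
    have "(z1, z2, z3, 0, E) \<in> S" unfolding S_def by (auto intro!: image_eqI[of _ _ "(z1, z2, z3, E)"])
    then show "P \<in> degenerate ` S" unfolding z by (rule imageI)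
  qed
  have "linear (\<lambda>(z1, z2, z3, E). (z1, z2, z3, 0, E) :: param)"
    by (rule linearI) auto
  then have "dim S \<le> dim (UNIV :: (complex \<times> complex \<times> complex \<times> (complex^3)) set)"
    unfolding S_def by (rule dim_image_le)
  then have "dim S \<le> 12" by simp
  then show "dim_at_most 12 ?B"
    unfolding dim_at_most_def using sub smooth_map_imp_differentiable_on[OF smooth_degenerate]
    by (intro exI[of _ "\<lambda>n. degenerate"] exI[of _ "\<lambda>n. S"]) auto
  show "\<not> dim_at_most 12 (U \<inter> param_space c d e f)" if "open U \<and> U \<inter> param_space c d e f \<noteq> {}" for U
    using param_space_not_dim_12 that by blast
qed auto

end

section \<open>The cone\<close>

lemma norm_cone_point: "norm (cone_point a x t) = norm x"
  by (simp add: norm_vec_def L2_set_def sum_3 cone_point_def norm_mult)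

lemma scaleR_cone_point: "r *\<^sub>R cone_point a x t = cone_point a (r *\<^sub>R x) t"
  by (simp add: cone_point_def vec_eq_iff forall_3 scaleR_complex mult_ac)

lemma Phi0_eq_cone_point: "Phi0 a \<alpha> (y1, y2, t) = cone_point a (quad_point \<alpha> y1 y2) t"
  by (simp add: Phi0_def cone_point_def quad_point_def vec_eq_iff forall_3 mult_ac)

context cone_data
begin

lemma a_alpha: "a$1 * \<alpha>$1 = a$1 * a$2 * a$3" "a$2 * \<alpha>$2 = - (a$1 * a$2 * a$3)" "a$3 * \<alpha>$3 = - (a$1 * a$2 * a$3)"
  unfolding alpha_eq by simp_all

lemma s_sq: "s1^2 = \<alpha>$1" "s2^2 = \<alpha>$2" "s3^2 = \<alpha>$3"
  using alpha_pos by (simp_all add: less_imp_le)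

text \<open>Dividing each coordinate by sqrt (alpha_j) turns the quadric into a circular cone, since the
  products a_j alpha_j agree up to sign.\<close>

lemma quadric_cone_iff:
  "x \<in> quadric_cone a \<longleftrightarrow> 0 \<le> x$1 \<and> (x$1 / s1)^2 = (x$2 / s2)^2 + (x$3 / s3)^2"
proof -
  let ?a = "a$1 * a$2 * a$3"
  have e: "a$j * (x$j)^2 = (a$j * \<alpha>$j) * ((x$j)^2 / \<alpha>$j)" for j
    using alpha_pos[of j] by simp
  have "a$1 * (x$1)^2 = ?a * (x$1 / s1)^2" "a$2 * (x$2)^2 = - ?a * (x$2 / s2)^2" "a$3 * (x$3)^2 = - ?a * (x$3 / s3)^2"
    unfolding power_divide s_sq using e[of 1, unfolded a_alpha(1)] e[of 2, unfolded a_alpha(2)] e[of 3, unfolded a_alpha(3)] .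
  then have "a$1 * (x$1)^2 + a$2 * (x$2)^2 + a$3 * (x$3)^2 = ?a * ((x$1 / s1)^2 - ((x$2 / s2)^2 + (x$3 / s3)^2))"
    by (simp add: algebra_simps)
  moreover have "?a \<noteq> 0" using a_sign by simp
  ultimately show ?thesis by (simp add: quadric_cone_def)
qed

lemma quad_point_in_quadric_cone: "quad_point \<alpha> y1 y2 \<in> quadric_cone a"
  unfolding quadric_cone_iff
proof
  show "0 \<le> quad_point \<alpha> y1 y2 $ 1" using s_pos by (simp add: quad_point_def)
  show "(quad_point \<alpha> y1 y2 $ 1 / s1)^2 = (quad_point \<alpha> y1 y2 $ 2 / s2)^2 + (quad_point \<alpha> y1 y2 $ 3 / s3)^2"
    using s_pos by (simp add: quad_point_def) (simp add: power2_eq_square field_simps)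
qed

text \<open>Up to scaling, \<open>quad_point\<close> is squaring y_1 + i y_2 together with the modulus of the square, so a
  complex square root gives a preimage, and the preimages are its two signs.\<close>

lemma quad_point_surj:
  assumes "x \<in> quadric_cone a"
  obtains y1 y2 where "quad_point \<alpha> y1 y2 = x"
proof -
  from assms have x: "0 \<le> x$1" "(x$1 / s1)^2 = (x$2 / s2)^2 + (x$3 / s3)^2" unfolding quadric_cone_iff by auto
  define z where "z = Complex (2 * (x$2 / s2)) (2 * (x$3 / s3))"
  define y where "y = csqrt z"
  have "y^2 = z" by (simp add: y_def)
  then have re: "(Re y)^2 - (Im y)^2 = 2 * (x$2 / s2)" and im: "2 * Re y * Im y = 2 * (x$3 / s3)"
    using Re_power2[of y] Im_power2[of y] by (simp_all add: z_def)
  have "(Re y)^2 + (Im y)^2 = cmod z"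
    using \<open>y^2 = z\<close> by (metis cmod_power2 norm_power)
  also have "\<dots> = sqrt ((2 * (x$1 / s1))^2)"
    unfolding z_def complex_norm power_mult_distrib x(2) by (simp add: distrib_left)
  also have "\<dots> = 2 * (x$1 / s1)" using x(1) s_pos by simp
  finally have nm: "(Re y)^2 + (Im y)^2 = 2 * (x$1 / s1)" .
  have im': "Re y * Im y = x$3 / s3" using im by simp
  have "quad_point \<alpha> (Re y) (Im y) = x"
    unfolding quad_point_def nm re im' using s_pos by (simp add: vec_eq_iff forall_3)
  then show ?thesis by (rule that)
qed

lemma quad_point_eq_iff:
  "quad_point \<alpha> y1 y2 = quad_point \<alpha> z1 z2 \<longleftrightarrow> (y1 = z1 \<and> y2 = z2) \<or> (y1 = - z1 \<and> y2 = - z2)"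
proof
  assume "quad_point \<alpha> y1 y2 = quad_point \<alpha> z1 z2"
  then have "y1^2 - y2^2 = z1^2 - z2^2" "y1 * y2 = z1 * z2"
    using s_pos by (simp_all add: quad_point_def vec_eq_iff forall_3)
  then have "(Complex y1 y2)^2 = (Complex z1 z2)^2" by (simp add: complex_eq_iff power2_eq_square mult.commute)
  then have "Complex y1 y2 = Complex z1 z2 \<or> Complex y1 y2 = - Complex z1 z2" by (simp only: power2_eq_iff)
  then show "(y1 = z1 \<and> y2 = z2) \<or> (y1 = - z1 \<and> y2 = - z2)" by (auto simp: complex_eq_iff)
qed (auto simp: quad_point_def)

lemma range_Phi0: "range (Phi0 a \<alpha>) = T2_cone a"
proof
  show "range (Phi0 a \<alpha>) \<subseteq> T2_cone a"
  proof clarify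
    fix y1 y2 t
    show "Phi0 a \<alpha> (y1, y2, t) \<in> T2_cone a"
      unfolding Phi0_eq_cone_point T2_cone_def using quad_point_in_quadric_cone by blast
  qed
  show "T2_cone a \<subseteq> range (Phi0 a \<alpha>)"
    unfolding T2_cone_def by (auto elim!: quad_point_surj simp: Phi0_eq_cone_point[symmetric])
qed

lemma quadric_cone_nonzero:
  assumes "x \<in> quadric_cone a" "x \<noteq> 0"
  shows "x$1 > 0" "x$2 \<noteq> 0 \<or> x$3 \<noteq> 0"
proof -
  have x: "0 \<le> x$1" "(x$1 / s1)^2 = (x$2 / s2)^2 + (x$3 / s3)^2" using assms unfolding quadric_cone_iff by auto
  have "x$1 = 0 \<longleftrightarrow> x$2 = 0 \<and> x$3 = 0"
    using x(2) s_pos by (auto simp: sum_power2_eq_zero_iff)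
  then show "x$1 > 0" "x$2 \<noteq> 0 \<or> x$3 \<noteq> 0" using x(1) assms(2) by (auto simp: vec_eq_iff forall_3)
qed

text \<open>The two orbits are those of the two square roots; shifting t by 2 pi only permutes the
  representatives.\<close>

lemma card_orbits_over_point:
  assumes "x \<in> quadric_cone a - {0}"
  shows "card (deck_orbit ` {(y1, y2, t'). quad_point \<alpha> y1 y2 = x \<and> cis t' = cis t}) = 2"
proof -
  obtain z1 z2 where z: "quad_point \<alpha> z1 z2 = x" using quad_point_surj assms by blast
  let ?A = "{(y1, y2, t'). quad_point \<alpha> y1 y2 = x \<and> cis t' = cis t}"
  let ?o = "deck_orbit (z1, z2, t)" and ?o' = "deck_orbit (- z1, - z2, t)"
  have "deck_orbit ` ?A = {?o, ?o'}"
  proof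
    show "{?o, ?o'} \<subseteq> deck_orbit ` ?A"
      using z by (auto simp: quad_point_def intro!: imageI)
    show "deck_orbit ` ?A \<subseteq> {?o, ?o'}"
    proof
      fix o' assume "o' \<in> deck_orbit ` ?A"
      then obtain y1 y2 t' where y: "x = quad_point \<alpha> y1 y2" "cis t' = cis t" "o' = deck_orbit (y1, y2, t')" by auto
      obtain n :: int where n: "t = t' + 2 * pi * of_int n" using y(2) cis_eq_iff[of t' t] by auto
      have "(y1 = z1 \<and> y2 = z2) \<or> (y1 = - z1 \<and> y2 = - z2)"
        using y(1) z quad_point_eq_iff by metis
      then have "deck n (y1, y2, t') = (z1, z2, t) \<or> deck n (y1, y2, t') = (- z1, - z2, t)"
        by (auto simp: deck_def n sign_powi)
      then have "o' = ?o \<or> o' = ?o'" unfolding y(3) deck_orbit_eq_iff by metis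
      then show "o' \<in> {?o, ?o'}" by blast
    qed
  qed
  moreover have "?o \<noteq> ?o'"
  proof
    assume "?o = ?o'"
    then obtain n where "(- z1, - z2, t) = deck n (z1, z2, t)" unfolding deck_orbit_eq_iff ..
    then have "n = 0" "- z1 = (-1) powi n * z1" "- z2 = (-1) powi n * z2" by (auto simp: deck_def)
    then have "z1 = 0" "z2 = 0" by simp_all
    then have "x = 0" using z by (simp add: quad_point_def vec_eq_iff forall_3)
    then show False using assms by simp
  qed
  ultimately show ?thesis by simp
qed

lemma double_covers_Phi0: "double_covers_parametrised_cone a \<alpha>"
  unfolding double_covers_parametrised_cone_def
  using card_orbits_over_point by (auto simp: Phi0_eq_cone_point)

definition radius :: "real \<Rightarrow> real" where
  "radius \<phi> = (\<alpha>$1 + \<alpha>$2 * (cos \<phi>)^2 + \<alpha>$3 * (sin \<phi>)^2) powr (- 1/2)"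

text \<open>The curve in which the quadric cone meets the unit sphere.\<close>

definition conic :: "real \<Rightarrow> real^3" where
  "conic \<phi> = radius \<phi> *\<^sub>R vector [s1, s2 * cos \<phi>, s3 * sin \<phi>]"

lemma conic_norm_sq_pos: "\<alpha>$1 + \<alpha>$2 * (cos \<phi>)^2 + \<alpha>$3 * (sin \<phi>)^2 > 0"
  using alpha_pos by (intro add_pos_nonneg mult_nonneg_nonneg) (auto intro: less_imp_le)

lemma radius_pos: "radius \<phi> > 0"
  using conic_norm_sq_pos[of \<phi>] by (simp add: radius_def)

lemma norm_conic: "norm (conic \<phi>) = 1"
proof -
  let ?Q = "\<alpha>$1 + \<alpha>$2 * (cos \<phi>)^2 + \<alpha>$3 * (sin \<phi>)^2"
  have "norm (vector [s1, s2 * cos \<phi>, s3 * sin \<phi>] :: real^3) = sqrt ?Q"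
    by (simp add: norm_vec_def L2_set_def sum_3 power_mult_distrib s_sq)
  moreover have "radius \<phi> = 1 / sqrt ?Q"
    unfolding radius_def using conic_norm_sq_pos[of \<phi>] by (simp add: powr_minus_divide powr_half_sqrt less_imp_le)
  ultimately show ?thesis using conic_norm_sq_pos[of \<phi>] radius_pos[of \<phi>] by (simp add: conic_def)
qed

lemma quadric_cone_eq_conic: "quadric_cone a = {r *\<^sub>R conic \<phi> | r \<phi>. 0 \<le> r}"
proof
  show "{r *\<^sub>R conic \<phi> | r \<phi>. 0 \<le> r} \<subseteq> quadric_cone a"
  proof clarify
    fix r \<phi> :: real assume "0 \<le> r"
    then show "r *\<^sub>R conic \<phi> \<in> quadric_cone a"
      unfolding quadric_cone_iff using s_pos radius_pos[of \<phi>] 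
      by (simp add: conic_def power_mult_distrib distrib_left[symmetric])
  qed
  show "quadric_cone a \<subseteq> {r *\<^sub>R conic \<phi> | r \<phi>. 0 \<le> r}"
  proof
    fix x assume xq: "x \<in> quadric_cone a"
    show "x \<in> {r *\<^sub>R conic \<phi> | r \<phi>. 0 \<le> r}"
    proof (cases "x = 0")
      case True
      then have "x = 0 *\<^sub>R conic 0" by simp
      then show ?thesis by blast
    next
      case False
      define \<rho> where "\<rho> = x$1 / s1"
      have \<rho>: "\<rho> > 0" using quadric_cone_nonzero[OF xq False] s_pos by (simp add: \<rho>_def)
      have sq: "\<rho>^2 = (x$2 / s2)^2 + (x$3 / s3)^2" using xq unfolding quadric_cone_iff \<rho>_def by simp
      have "(x$2 / s2 / \<rho>)^2 + (x$3 / s3 / \<rho>)^2 = 1"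
        using \<rho> unfolding power_divide[of _ \<rho>] add_divide_distrib[symmetric] sq[symmetric] by simp
      then obtain \<phi> where \<phi>: "x$2 / s2 / \<rho> = cos \<phi>" "x$3 / s3 / \<rho> = sin \<phi>" using sincos_total_2pi by metis
      have "x = (\<rho> / radius \<phi>) *\<^sub>R conic \<phi>"
        using \<rho> s_pos radius_pos[of \<phi>] quadric_cone_nonzero(1)[OF xq False] unfolding conic_def vec_eq_iff forall_3 \<phi>[symmetric]
        by (simp add: \<rho>_def)
      moreover have "0 \<le> \<rho> / radius \<phi>" using \<rho> radius_pos[of \<phi>] by simp
      ultimately show ?thesis by blast
    qed
  qed
qed

lemma smooth_radius: "smooth_map radius"
  unfolding radius_def by (intro smooth_powr conic_norm_sq_pos smooth_intros smooth_cos smooth_sin)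

end

text \<open>A change of coordinates does not change the tangent space. Only the derivative of the composite
  is assumed, because the change of coordinates will be available on one side only.\<close>

lemma special_Lagrangian_at_compose:
  fixes f :: "'a::euclidean_space \<Rightarrow> complex^3" and h :: "'a \<Rightarrow> 'a"
  assumes f: "special_Lagrangian_at f (h x)"
    and F: "(F has_derivative (\<lambda>v. frechet_derivative f (at (h x)) (h' v))) (at x)"
    and h': "linear h'" "inj h'"
  shows "special_Lagrangian_at F x"
proof -
  have fd: "frechet_derivative F (at x) = (\<lambda>v. frechet_derivative f (at (h x)) (h' v))"
    using frechet_derivative_at[OF F] by simp
  have "surj h'" using h' by (rule linear_inj_imp_surj)
  then have "range (\<lambda>v. frechet_derivative f (at (h x)) (h' v)) = range (frechet_derivative f (at (h x)))"
    unfolding image_image[symmetric, of "frechet_derivative f (at (h x))" h'] by simp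
  moreover have "inj (\<lambda>v. frechet_derivative f (at (h x)) (h' v))"
    using f h'(2) unfolding special_Lagrangian_at_def immersive_at_def inj_def by blast
  ultimately show ?thesis
    using f F unfolding special_Lagrangian_at_def immersive_at_def fd differentiable_def by auto
qed

lemma coprime_int_period:
  fixes s :: real and b1 b2 :: int
  assumes "coprime b1 b2" "of_int b1 * s = r * of_int n1" "of_int b2 * s = r * of_int n2"
  obtains k :: int where "s = r * of_int k"
proof -
  obtain x y where xy: "x * b1 + y * b2 = 1" using assms(1) bezout_int[of b1 b2] by auto
  have "s = of_int (x * b1 + y * b2) * s" unfolding xy by simp
  also have "\<dots> = of_int x * (of_int b1 * s) + of_int y * (of_int b2 * s)" by (simp add: algebra_simps)
  also have "\<dots> = r * of_int (x * n1 + y * n2)" unfolding assms by (simp add: algebra_simps)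
  finally show ?thesis by (rule that)
qed

text \<open>Coprimality decides which points of the cone have several representations.\<close>

locale primitive_family = integral_family +
  assumes cop: "coprime (b 1) (b 2)"
begin

text \<open>Let s = t - t'. Comparing moduli and phases, cis (a_1 s) = 1 and cis (a_2 s) = cis (a_3 s) is 1 or
  -1. In the first case coprimality of a_1 and a_2 gives cis s = 1. In the second
  s is a multiple of pi, an odd one since cis (a_2 s) = -1, and this requires a_1 to be even.
  Conversely, for even a_1 the numbers a_2 and a_3 are odd, so that the shift by pi changes both signs.\<close>

lemma cone_point_eq_iff:
  assumes x: "x$1 > 0" "x$2 \<noteq> 0 \<or> x$3 \<noteq> 0" and x': "x'$1 > 0"
  shows "cone_point a x t = cone_point a x' t' \<longleftrightarrow>
     (x' = x \<and> cis t' = cis t) \<or> (even (b 1) \<and> x' = vector [x$1, - x$2, - x$3] \<and> cis t' = - cis t)"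
proof
  assume eq: "cone_point a x t = cone_point a x' t'"
  define s where "s = t - t'"
  have c: "cis (a$j * t) = cis (a$j * t') * cis (a$j * s)" for j
    by (simp add: s_def cis_mult algebra_simps)
  have e: "cis (a$j * s) * complex_of_real (x$j) = complex_of_real (x'$j)" for j
  proof -
    have "cone_point a x t $ j = cone_point a x' t' $ j" using eq by simp
    then have "cis (a$j * t) * complex_of_real (x$j) = cis (a$j * t') * complex_of_real (x'$j)"
      using exhaust_3[of j] by (auto simp: cone_point_def)
    then show ?thesis unfolding c by simp
  qed
  have nx: "\<bar>x$j\<bar> = \<bar>x'$j\<bar>" for j using arg_cong[OF e[of j], of cmod] by (simp add: norm_mult)
  then have x1: "x'$1 = x$1" using x(1) x' by (metis abs_of_pos)
  then have c1: "cis (a$1 * s) = 1" using e[of 1] x(1) by simp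
  have sgn: "\<exists>\<epsilon>::real. (\<epsilon> = 1 \<or> \<epsilon> = -1) \<and> cis (a$j * s) = of_real \<epsilon>" if "x$j \<noteq> 0" for j
  proof -
    have "cis (a$j * s) = of_real (x'$j / x$j)" using e[of j] that by (simp add: field_simps)
    moreover have "\<bar>x'$j / x$j\<bar> = 1" using nx[of j] that by (simp add: abs_divide)
    ultimately show ?thesis by (intro exI[of _ "x'$j / x$j"]) (auto simp: abs_if split: if_splits)
  qed
  have pr: "cis (a$2 * s) * cis (a$3 * s) = 1"
  proof -
    have "a$2 + a$3 = - a$1" using a_sum by simp
    then have "a$2 * s + a$3 * s = - (a$1 * s)" by (simp only: distrib_right[symmetric] mult_minus_left)
    then have "cis (a$2 * s) * cis (a$3 * s) = cnj (cis (a$1 * s))" by (simp add: cis_mult cis_cnj)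
    then show ?thesis using c1 by simp
  qed
  obtain \<epsilon> :: real where \<epsilon>: "\<epsilon> = 1 \<or> \<epsilon> = -1" "cis (a$2 * s) = of_real \<epsilon>" "cis (a$3 * s) = of_real \<epsilon>"
  proof -
    have inv: "z = of_real \<epsilon>" if "z * of_real \<epsilon> = 1" "\<epsilon> = 1 \<or> \<epsilon> = -1" for z :: complex and \<epsilon> :: real
    proof -
      have "z = (z * of_real \<epsilon>) * of_real \<epsilon>" using that(2) by auto
      then show ?thesis unfolding that(1) by simp
    qed
    from x(2) show ?thesis
    proof
      assume "x$2 \<noteq> 0"
      with sgn obtain \<epsilon> :: real where "\<epsilon> = 1 \<or> \<epsilon> = -1" "cis (a$2 * s) = of_real \<epsilon>" by blast
      then show ?thesis using pr inv[of "cis (a$3 * s)" \<epsilon>] by (intro that[of \<epsilon>]) (auto simp: mult.commute)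
    next
      assume "x$3 \<noteq> 0"
      with sgn obtain \<epsilon> :: real where "\<epsilon> = 1 \<or> \<epsilon> = -1" "cis (a$3 * s) = of_real \<epsilon>" by blast
      then show ?thesis using pr inv[of "cis (a$2 * s)" \<epsilon>] by (intro that[of \<epsilon>]) auto
    qed
  qed
  have x23: "x'$2 = \<epsilon> * x$2" "x'$3 = \<epsilon> * x$3"
    using e[of 2] e[of 3] unfolding \<epsilon> by (metis of_real_eq_iff of_real_mult)+
  obtain n1 :: int where n1: "a$1 * s = 2 * pi * of_int n1"
    using c1 cis_eq_iff[of 0 "a$1 * s"] by auto
  show "(x' = x \<and> cis t' = cis t) \<or> (even (b 1) \<and> x' = vector [x$1, - x$2, - x$3] \<and> cis t' = - cis t)"
  proof (cases "\<epsilon> = 1")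
    case True
    then obtain n2 :: int where n2: "a$2 * s = 2 * pi * of_int n2"
      using \<epsilon>(2) cis_eq_iff[of 0 "a$2 * s"] by auto
    obtain k :: int where "s = 2 * pi * of_int k"
      by (rule coprime_int_period[OF cop, of s "2 * pi" n1 n2]) (use n1 n2 a_int in simp_all)
    then have "cis t' = cis t" unfolding cis_eq_iff by (intro exI[of _ k]) (simp add: s_def algebra_simps)
    moreover have "x' = x" using x1 x23 True by (simp add: vec_eq_iff forall_3)
    ultimately show ?thesis by simp
  next
    case False
    with \<epsilon>(1) have em: "\<epsilon> = -1" by simp
    have "cis (2 * (a$2 * s)) = cis (a$2 * s) * cis (a$2 * s)" by (simp only: cis_mult mult_2)
    then have "cis (2 * (a$2 * s)) = 1" unfolding \<epsilon>(2) em by simp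
    then obtain n2 :: int where n2: "2 * (a$2 * s) = 2 * pi * of_int n2"
      using cis_eq_iff[of 0 "2 * (a$2 * s)"] by auto
    obtain k :: int where k: "s = pi * of_int k"
      by (rule coprime_int_period[OF cop, of s pi "2 * n1" n2]) (use n1 n2 a_int in simp_all)
    have ck: "cis (a$j * s) = (if even (b j * k) then 1 else -1)" for j
      using cis_pi_int[of "b j * k"] by (simp add: k a_int mult_ac)
    have "odd k" using ck[of 2] \<epsilon>(2) em by (auto split: if_splits)
    moreover have "even (b 1)" using ck[of 1] c1 \<open>odd k\<close> by (auto split: if_splits)
    moreover have "cis t = cis t' * cis s" by (simp add: s_def cis_mult)
    then have "cis t' = - cis t" using cis_pi_int[of k] \<open>odd k\<close> by (simp add: k)
    moreover have "x' = vector [x$1, - x$2, - x$3]" using x1 x23 em by (simp add: vec_eq_iff forall_3)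
    ultimately show ?thesis by simp
  qed
next
  assume "(x' = x \<and> cis t' = cis t) \<or> (even (b 1) \<and> x' = vector [x$1, - x$2, - x$3] \<and> cis t' = - cis t)"
  then show "cone_point a x t = cone_point a x' t'"
  proof
    assume h: "x' = x \<and> cis t' = cis t"
    then obtain n :: int where "t' = t + 2 * pi * of_int n" using cis_eq_iff[of t t'] by auto
    then have "cis (a$j * t') = cis (a$j * t)" for j using cis_int_period[of "b j" t n] by (simp add: a_int)
    then show ?thesis using h by (simp add: cone_point_def)
  next
    assume h: "even (b 1) \<and> x' = vector [x$1, - x$2, - x$3] \<and> cis t' = - cis t"
    then have "cis t' = cis (t + pi)" by (simp add: cis_mult[symmetric])
    then obtain n :: int where "t + pi = t' + 2 * pi * of_int n" using cis_eq_iff[of t' "t + pi"] by auto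
    then have t': "t' = t + pi * of_int (1 - 2 * n)" by (simp add: algebra_simps)
    have "cis (a$j * t') = cis (a$j * t) * cis (pi * of_int (b j * (1 - 2 * n)))" for j
      by (simp add: t' a_int cis_mult algebra_simps)
    then have ct: "cis (a$j * t') = (if even (b j) then cis (a$j * t) else - cis (a$j * t))" for j
      unfolding cis_pi_int by simp
    have "odd (b 2)" using h cop by (metis coprime_common_divisor_int odd_one coprime_common_divisor)
    moreover have "of_int (b 1 + b 2 + b 3) = (0::real)" using a_sum a_int by simp
    then have "b 1 + b 2 + b 3 = 0" by (simp only: of_int_eq_0_iff)
    then have "b 3 = - (b 1 + b 2)" by simp
    then have "odd (b 3)" using h \<open>odd (b 2)\<close> by simp
    ultimately show ?thesis using h by (simp add: cone_point_def ct)
  qed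
qed

lemma two_to_one_Phi0:
  assumes "odd (b 1)"
  shows "two_to_one_onto (Phi0 a \<alpha>) (T2_cone a)"
  unfolding two_to_one_onto_def
proof
  fix z assume "z \<in> T2_cone a - {0}"
  then obtain x t where z: "z = cone_point a x t" "x \<in> quadric_cone a" "z \<noteq> 0" by (auto simp: T2_cone_def)
  have x0: "x \<noteq> 0" using z norm_cone_point[of a x t] by auto
  have "Phi0 a \<alpha> (y1, y2, t') = z \<longleftrightarrow> quad_point \<alpha> y1 y2 = x \<and> cis t' = cis t" for y1 y2 t'
  proof (cases "quad_point \<alpha> y1 y2 = 0")
    case True
    then show ?thesis using z(3) x0 norm_cone_point[of a 0 t'] by (auto simp: Phi0_eq_cone_point)
  next
    case False
    then show ?thesis
      using cone_point_eq_iff[of x "quad_point \<alpha> y1 y2" t t'] quadric_cone_nonzero[OF z(2) x0]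
        quadric_cone_nonzero[OF quad_point_in_quadric_cone False] assms
      unfolding Phi0_eq_cone_point z(1) by auto
  qed
  then have "{v. Phi0 a \<alpha> v = z} = {(y1, y2, t'). quad_point \<alpha> y1 y2 = x \<and> cis t' = cis t}" by auto
  then show "card (deck_orbit ` {v. Phi0 a \<alpha> v = z}) = 2"
    using card_orbits_over_point[of x t] z(2) x0 by simp
qed

text \<open>With phi the angle on the conic, the shifts of (phi, t) that fix all points of the link are generated,
  for even a_1, by (2 pi, 0) and (pi, pi); the coordinates (u, v) straighten this lattice.\<close>

definition torus_map :: "real \<times> real \<Rightarrow> complex^3" where
  "torus_map = (\<lambda>(u, v). if even (b 1) then cone_point a (conic (u/2 + v)) (u/2) else cone_point a (conic v) u)"

lemma torus_map_eq:
  obtains \<tau> \<kappa> :: real where "\<tau> > 0" "\<And>u v. torus_map (u, v) = cone_point a (conic (\<kappa> * u + v)) (\<tau> * u)"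
    "\<tau> = 1 \<and> \<kappa> = 0 \<and> odd (b 1) \<or> \<tau> = 1/2 \<and> \<kappa> = 1/2 \<and> even (b 1)"
proof (cases "even (b 1)")
  case True
  then show ?thesis by (intro that[of "1/2" "1/2"]) (simp_all add: torus_map_def)
next
  case False
  then show ?thesis by (intro that[of 1 0]) (simp_all add: torus_map_def)
qed

lemma conic_flip: "vector [conic \<phi> $ 1, - conic \<phi> $ 2, - conic \<phi> $ 3] = conic (\<phi> + pi)"
  by (simp add: conic_def radius_def vec_eq_iff forall_3)

lemma conic_eq_iff: "conic \<phi> = conic \<phi>' \<longleftrightarrow> cis \<phi> = cis \<phi>'"
proof
  assume eq: "conic \<phi> = conic \<phi>'"
  then have "conic \<phi> $ j = conic \<phi>' $ j" for j by simp
  from this[of 1] this[of 2] this[of 3] show "cis \<phi> = cis \<phi>'"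
    using s_pos radius_pos[of \<phi>'] by (simp add: conic_def complex_eq_iff)
next
  assume "cis \<phi> = cis \<phi>'"
  then have "cos \<phi> = cos \<phi>'" "sin \<phi> = sin \<phi>'" by (simp_all add: complex_eq_iff)
  then show "conic \<phi> = conic \<phi>'" by (simp add: conic_def radius_def)
qed

lemma torus_map_eq_iff:
  "torus_map (u, v) = torus_map (u', v') \<longleftrightarrow> cis u = cis u' \<and> cis v = cis v'"
proof -
  have pos: "conic \<phi> $ 1 > 0" for \<phi> using radius_pos s_pos by (simp add: conic_def)
  have nz: "conic \<phi> $ 2 \<noteq> 0 \<or> conic \<phi> $ 3 \<noteq> 0" for \<phi>
  proof -
    have "cos \<phi> \<noteq> 0 \<or> sin \<phi> \<noteq> 0"
      using sin_cos_squared_add[of \<phi>] by (metis add.right_neutral power_zero_numeral zero_neq_one)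
    then show ?thesis using radius_pos[of \<phi>] s_pos by (auto simp: conic_def)
  qed
  have key: "cone_point a (conic \<phi>) t = cone_point a (conic \<phi>') t' \<longleftrightarrow>
     (cis \<phi>' = cis \<phi> \<and> cis t' = cis t) \<or> (even (b 1) \<and> cis \<phi>' = - cis \<phi> \<and> cis t' = - cis t)" for \<phi> t \<phi>' t'
    unfolding cone_point_eq_iff[OF pos nz pos] conic_flip conic_eq_iff by (simp add: cis_mult[symmetric])
  show ?thesis
  proof (cases "even (b 1)")
    case False
    then show ?thesis by (auto simp: torus_map_def key)
  next
    case True
    have d: "cis (u/2 + v) = cis (u/2) * cis v" for u v by (simp add: cis_mult)
    have sq: "cis u = cis u' \<longleftrightarrow> cis (u/2) = cis (u'/2) \<or> cis (u/2) = - cis (u'/2)"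
    proof -
      have dbl: "cis x = (cis (x/2))^2" for x by (simp add: power2_eq_square cis_mult)
      show ?thesis unfolding dbl[of u] dbl[of u'] by (rule power2_eq_iff)
    qed
    have gen: "(p' * q' = p * q \<and> p' = p \<or> p' * q' = - (p * q) \<and> p' = - p) \<longleftrightarrow> (p = p' \<or> p = - p') \<and> q = q'"
      if "p \<noteq> 0" for p p' q q' :: complex
    proof (cases "p' = p \<or> p' = - p")
      case True
      then show ?thesis using that by auto
    next
      case False
      then have "p \<noteq> p'" "p \<noteq> - p'" by auto
      then show ?thesis using False by blast
    qed
    show ?thesis unfolding torus_map_def split_conv if_P[OF True] key d sq
      using gen[of "cis (u/2)" "cis (u'/2)" "cis v'" "cis v"] True by auto
  qed
qed

text \<open>For r > 0 the cone over the link is \<open>Phi0\<close> in other coordinates, namely polar coordinates in the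
  (y_1, y_2) plane with half the angle, and \<open>Phi0\<close> is immersed away from y = 0.\<close>

lemma special_Lagrangian_at_cone:
  assumes r: "r > 0"
  shows "special_Lagrangian_at (\<lambda>(r, x). r *\<^sub>R torus_map x) (r, x)"
proof -
  obtain u v where x: "x = (u, v)" by (metis surj_pair)
  obtain \<tau> \<kappa> :: real where \<tau>: "\<tau> > 0" and tm: "\<And>u v. torus_map (u, v) = cone_point a (conic (\<kappa> * u + v)) (\<tau> * u)"
    using torus_map_eq by metis
  define S where "S = (\<lambda>(r, u, v). sqrt (2 * r * radius (\<kappa> * u + v)))"
  define H :: "real \<times> real \<times> real \<Rightarrow> real \<times> real \<times> real" where
    "H = (\<lambda>z. (S z * cos ((\<kappa> * fst (snd z) + snd (snd z)) / 2), S z * sin ((\<kappa> * fst (snd z) + snd (snd z)) / 2), \<tau> * fst (snd z)))"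
  have H: "Phi0 a \<alpha> (H z) = (case z of (r, x) \<Rightarrow> r *\<^sub>R torus_map x)" if "fst z > 0" for z
  proof -
    obtain r u v where z: "z = (r, u, v)" by (metis prod_cases3)
    let ?\<phi> = "\<kappa> * u + v"
    have S2: "(S z)^2 = 2 * r * radius ?\<phi>"
      using that radius_pos[of ?\<phi>] by (simp add: S_def z less_imp_le)
    have "quad_point \<alpha> (S z * cos (?\<phi>/2)) (S z * sin (?\<phi>/2)) = r *\<^sub>R conic ?\<phi>"
    proof -
      have c: "cos ?\<phi> = (cos (?\<phi>/2))^2 - (sin (?\<phi>/2))^2" "sin ?\<phi> = 2 * sin (?\<phi>/2) * cos (?\<phi>/2)"
      proof -
        have "cos x = (cos (x/2))^2 - (sin (x/2))^2" "sin x = 2 * sin (x/2) * cos (x/2)" for x :: real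
          using cos_double[of "x/2"] sin_double[of "x/2"] by simp_all
        then show "cos ?\<phi> = (cos (?\<phi>/2))^2 - (sin (?\<phi>/2))^2" "sin ?\<phi> = 2 * sin (?\<phi>/2) * cos (?\<phi>/2)" .
      qed
      have p: "(S z * x)^2 = 2 * r * radius ?\<phi> * x^2" "(S z * x) * (S z * y) = 2 * r * radius ?\<phi> * (x * y)" for x y
        using S2 by (simp_all add: power2_eq_square algebra_simps)
      have cs: "2 * r * radius ?\<phi> * (cos (?\<phi>/2))^2 + 2 * r * radius ?\<phi> * (sin (?\<phi>/2))^2 = 2 * r * radius ?\<phi>"
        by (simp only: distrib_left[symmetric] sin_cos_squared_add2 mult_1_right)
      show ?thesis unfolding quad_point_def conic_def p cs c
        by (simp add: vec_eq_iff forall_3 algebra_simps)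
    qed
    then show ?thesis by (simp add: z H_def Phi0_eq_cone_point tm scaleR_cone_point)
  qed
  define \<phi> where "\<phi> = \<kappa> * u + v"
  obtain W' where W': "(radius has_derivative W') (at \<phi>)"
    using smooth_radius unfolding smooth_map_def by (metis Ck_Suc_has_derivative)
  have linW: "W' 0 = 0" using has_derivative_linear[OF W'] by (rule linear_0)
  let ?z = "(r, u, v)"
  have Spos: "S ?z > 0" using r radius_pos by (simp add: S_def)
  define S' where "S' = (\<lambda>h. (2 * r * W' (\<kappa> * fst (snd h) + snd (snd h)) + 2 * fst h * radius \<phi>) * (inverse (S ?z) / 2))"
  have "((\<lambda>z :: real \<times> real \<times> real. \<kappa> * fst (snd z) + snd (snd z)) has_derivative
      (\<lambda>h. \<kappa> * fst (snd h) + snd (snd h))) (at ?z)"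
    by (auto intro!: derivative_eq_intros)
  moreover have "(radius has_derivative W') (at (\<kappa> * fst (snd ?z) + snd (snd ?z)))"
    using W' by (simp add: \<phi>_def)
  ultimately have "((\<lambda>z. radius (\<kappa> * fst (snd z) + snd (snd z))) has_derivative
      (\<lambda>h. W' (\<kappa> * fst (snd h) + snd (snd h)))) (at ?z)"
    by (rule has_derivative_compose)
  then have dS: "(S has_derivative S') (at ?z)"
    unfolding S_def S'_def case_prod_beta'
    using r radius_pos[of \<phi>]
    by (auto intro!: derivative_eq_intros simp: \<phi>_def fun_eq_iff)
  define H' where "H' = (\<lambda>h :: real \<times> real \<times> real.
     (S' h * cos (\<phi>/2) - S ?z * (sin (\<phi>/2) * ((\<kappa> * fst (snd h) + snd (snd h)) / 2)),
      S' h * sin (\<phi>/2) + S ?z * (cos (\<phi>/2) * ((\<kappa> * fst (snd h) + snd (snd h)) / 2)), \<tau> * fst (snd h)))"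
  have dH: "(H has_derivative H') (at ?z)"
    unfolding H_def H'_def
    apply (rule has_derivative_eq_rhs)
     apply (rule dS derivative_eq_intros refl | simp)+
    apply (simp add: fun_eq_iff \<phi>_def)
    done
  have "inj H'"
  proof (rule linear_injective_0[OF has_derivative_linear[OF dH], THEN iffD2, rule_format])
    fix h assume h: "H' h = 0"
    obtain h1 h2 h3 where hh: "h = (h1, h2, h3)" by (metis prod_cases3)
    define k where "k = (\<kappa> * h2 + h3) / 2"
    have e: "S' h * cos (\<phi>/2) - S ?z * (sin (\<phi>/2) * k) = 0" "S' h * sin (\<phi>/2) + S ?z * (cos (\<phi>/2) * k) = 0" "h2 = 0"
    proof -
      have "H' h = (S' h * cos (\<phi>/2) - S ?z * (sin (\<phi>/2) * k), S' h * sin (\<phi>/2) + S ?z * (cos (\<phi>/2) * k), \<tau> * h2)"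
        by (simp add: H'_def hh k_def)
      with h \<tau> show "S' h * cos (\<phi>/2) - S ?z * (sin (\<phi>/2) * k) = 0"
        "S' h * sin (\<phi>/2) + S ?z * (cos (\<phi>/2) * k) = 0" "h2 = 0"
        by (simp_all add: zero_prod_def)
    qed
    have "S ?z * k = 0" "S' h = 0"
      using e(1,2) sin_cos_squared_add[of "\<phi>/2"] by algebra+
    then have "h3 = 0" using e(3) Spos by (simp add: k_def)
    then have "h1 = 0" using \<open>S' h = 0\<close> e(3) Spos radius_pos[of \<phi>] linW by (simp add: S'_def hh)
    then show "h = 0" using e(3) \<open>h3 = 0\<close> by (simp add: hh zero_prod_def)
  qed
  interpret Q: evolving_quadrics "w_fun a \<alpha>" "\<lambda>t. 0" "\<lambda>t. 0" "\<lambda>t. 0"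
    using evolving_quadrics_Phi[OF zero_in_param_space] unfolding p_fun_0 r_fun_0 .
  have PQ: "Phi0 a \<alpha> = quad_map (w_fun a \<alpha>) (\<lambda>t. 0) (\<lambda>t. 0) (\<lambda>t. 0)"
    unfolding Phi0_eq_Phi[of a \<alpha> l c d e f] Phi_eq_quad_map p_fun_0 r_fun_0 ..
  have "immersive_at (Phi0 a \<alpha>) (H ?z)"
  proof -
    obtain y1 y2 t where y: "H ?z = (y1, y2, t)" by (metis prod_cases3)
    have "y1 = S ?z * cos (\<phi>/2)" "y2 = S ?z * sin (\<phi>/2)" using y by (simp_all add: H_def \<phi>_def)
    then have "y1^2 + y2^2 = (S ?z)^2" by (simp add: power_mult_distrib distrib_left[symmetric])
    then have "y1^2 + y2^2 \<noteq> 0" using Spos by simp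
    then have "complex_of_real (y1^2 + y2^2) \<noteq> 0" by (simp only: of_real_eq_0_iff not_False_eq_True)
    moreover have "Q.normal_at (y1, y2, t) $ 1 = complex_of_real (y1^2 + y2^2) * (w_fun a \<alpha> t $ 2 * w_fun a \<alpha> t $ 3)"
      by (simp add: ccross_def quad_d1_def quad_d2_def power2_eq_square algebra_simps)
    ultimately have "Q.normal_at (y1, y2, t) $ 1 \<noteq> 0" using Q.w_nz by simp
    then have "Q.normal_at (y1, y2, t) \<noteq> 0" by (metis zero_index)
    then show ?thesis unfolding y PQ Q.immersive_at_quad_map_iff .
  qed
  then have sl: "special_Lagrangian_at (Phi0 a \<alpha>) (H ?z)"
    unfolding PQ by (rule Q.special_Lagrangian_at_quad_map)
  have "((\<lambda>z. Phi0 a \<alpha> (H z)) has_derivative (\<lambda>h. frechet_derivative (Phi0 a \<alpha>) (at (H ?z)) (H' h))) (at ?z)"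
    unfolding PQ Q.frechet_derivative_quad_map
    by (rule has_derivative_compose[OF dH Q.has_derivative_quad_map])
  then have dF: "((\<lambda>(r, x). r *\<^sub>R torus_map x) has_derivative
      (\<lambda>h. frechet_derivative (Phi0 a \<alpha>) (at (H ?z)) (H' h))) (at ?z)"
  proof (rule has_derivative_transform_within_open)
    show "open {z :: real \<times> real \<times> real. 0 < fst z}" by (intro open_Collect_less continuous_intros)
  qed (use r H in auto)
  show ?thesis unfolding x
    by (rule special_Lagrangian_at_compose[of "Phi0 a \<alpha>" H ?z _ H', OF sl dF has_derivative_linear[OF dH] \<open>inj H'\<close>])
qed

lemma special_Lagrangian_T2_cone: "special_Lagrangian_T2_cone (T2_cone a)"
  unfolding special_Lagrangian_T2_cone_def
proof (intro exI[of _ torus_map] conjI allI impI)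
  obtain \<tau> \<kappa> :: real where \<tau>: "\<tau> > 0" and tm: "\<And>u v. torus_map (u, v) = cone_point a (conic (\<kappa> * u + v)) (\<tau> * u)"
    using torus_map_eq by metis
  have sr: "smooth_map (\<lambda>x. radius (\<kappa> * fst x + snd x))"
    by (rule smooth_comp_linear[OF _ smooth_radius])
       (intro bounded_linear_add bounded_linear_mult_right[THEN bounded_linear_compose] bounded_linear_fst bounded_linear_snd
         bounded_linear_const_mult)
  have "torus_map = (\<lambda>x. vector [\<i> * cis (a$1 * (\<tau> * fst x)) * of_real (radius (\<kappa> * fst x + snd x) * s1),
     cis (a$2 * (\<tau> * fst x)) * of_real (radius (\<kappa> * fst x + snd x) * (s2 * cos (\<kappa> * fst x + snd x))),
     cis (a$3 * (\<tau> * fst x)) * of_real (radius (\<kappa> * fst x + snd x) * (s3 * sin (\<kappa> * fst x + snd x)))])"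
    by (auto simp: fun_eq_iff tm cone_point_def conic_def)
  then show "smooth_map torus_map"
    by (simp only:) (intro smooth_intros smooth_cos smooth_sin sr)
  show "norm (torus_map x) = 1" for x
    by (cases x) (simp add: tm norm_cone_point norm_conic)
  show "torus_map (u, v) = torus_map (u', v') \<longleftrightarrow> cis u = cis u' \<and> cis v = cis v'" for u v u' v'
    by (rule torus_map_eq_iff)
  show "T2_cone a = {r *\<^sub>R torus_map x | r x. 0 \<le> r}"
  proof
    show "T2_cone a \<subseteq> {r *\<^sub>R torus_map x | r x. 0 \<le> r}"
    proof
      fix z assume "z \<in> T2_cone a"
      then obtain r \<phi> t where z: "z = cone_point a (r *\<^sub>R conic \<phi>) t" "0 \<le> r"
        by (auto simp: T2_cone_def quadric_cone_eq_conic)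
      have "z = r *\<^sub>R torus_map (t / \<tau>, \<phi> - \<kappa> * (t / \<tau>))"
        using \<tau> by (simp add: z tm scaleR_cone_point)
      with z(2) show "z \<in> {r *\<^sub>R torus_map x | r x. 0 \<le> r}" by blast
    qed
    show "{r *\<^sub>R torus_map x | r x. 0 \<le> r} \<subseteq> T2_cone a"
      by (fastforce simp: T2_cone_def quadric_cone_eq_conic tm scaleR_cone_point)
  qed
  show "special_Lagrangian_at (\<lambda>(r, x). r *\<^sub>R torus_map x) (r, x)" if "r > 0" for r x
    by (rule special_Lagrangian_at_cone[OF that])
qed

end

section \<open>The integers attached to a fraction\<close>

text \<open>Multiplying by k = 1 or k = 3 removes the division, so that both cases can be treated together.\<close>

lemma a_const_cases:
  fixes p q :: int
  obtains k :: int where "k = 1 \<or> k = 3" "k = 3 \<longleftrightarrow> 3 dvd p + q"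
    "k * a_const p q $ 1 = p^2 - q^2" "k * a_const p q $ 2 = q^2 - 2*p*q" "k * a_const p q $ 3 = 2*p*q - p^2"
    "k * lam_const p q = p^2 - p*q + q^2"
proof (cases "3 dvd p + q")
  case True
  then obtain j where "p + q = 3 * j" by blast
  then have q: "q = 3 * j - p" by simp
  have "p^2 - q^2 = 3 * (j * (2*p - 3*j))" "q^2 - 2*p*q = 3 * (q * (j - p))" "2*p*q - p^2 = 3 * (p * (2 * j - p))"
    "p^2 - p*q + q^2 = 3 * (p^2 - 3*p*j + 3*j^2)"
    by (simp_all add: q power2_eq_square algebra_simps)
  then have "3 dvd p^2 - q^2" "3 dvd q^2 - 2*p*q" "3 dvd 2*p*q - p^2" "3 dvd p^2 - p*q + q^2"
    by (metis dvd_triv_left)+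
  then show ?thesis using True by (intro that[of 3]) (simp_all add: a_const_def lam_const_def)
next
  case False
  then show ?thesis by (intro that[of 1]) (simp_all add: a_const_def lam_const_def)
qed

lemma a_const_sum: "a_const p q $ 1 + a_const p q $ 2 + a_const p q $ 3 = 0"
proof -
  obtain k :: int where k: "k = 1 \<or> k = 3"
    "k * a_const p q $ 1 = p^2 - q^2" "k * a_const p q $ 2 = q^2 - 2*p*q" "k * a_const p q $ 3 = 2*p*q - p^2"
    by (rule a_const_cases[of p q])
  have "k * (a_const p q $ 1 + a_const p q $ 2 + a_const p q $ 3) = 0"
    unfolding distrib_left k by simp
  then show ?thesis using k(1) by auto
qed

lemma lam_const_sq: "(lam_const p q)^2 = (a_const p q $ 2)^2 + a_const p q $ 2 * a_const p q $ 3 + (a_const p q $ 3)^2"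
proof -
  obtain k :: int where k: "k = 1 \<or> k = 3" "k * a_const p q $ 2 = q^2 - 2*p*q" "k * a_const p q $ 3 = 2*p*q - p^2"
    "k * lam_const p q = p^2 - p*q + q^2"
    by (rule a_const_cases[of p q])
  have "k^2 * ((lam_const p q)^2 - ((a_const p q $ 2)^2 + a_const p q $ 2 * a_const p q $ 3 + (a_const p q $ 3)^2))
     = (k * lam_const p q)^2 - ((k * a_const p q $ 2)^2 + (k * a_const p q $ 2) * (k * a_const p q $ 3) + (k * a_const p q $ 3)^2)"
    by (simp add: power2_eq_square algebra_simps)
  also have "\<dots> = 0" unfolding k by (simp add: power2_eq_square algebra_simps)
  finally show ?thesis using k(1) by auto
qed

lemma lam_const_pos:
  assumes "0 < 2 * p" "2 * p < q"
  shows "lam_const p q > 0"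
proof -
  obtain k :: int where k: "k = 1 \<or> k = 3" "k * lam_const p q = p^2 - p*q + q^2" by (rule a_const_cases[of p q])
  have "p^2 - p*q + q^2 = p^2 + q * (q - p)" by (simp add: power2_eq_square algebra_simps)
  moreover have "\<dots> > 0" using assms by (intro add_pos_pos mult_pos_pos) auto
  ultimately show ?thesis using k by auto
qed

lemma odd_lam_const:
  assumes "coprime p q"
  shows "odd (lam_const p q)"
proof -
  obtain k :: int where k: "k = 1 \<or> k = 3" "k * lam_const p q = p^2 - p*q + q^2" by (rule a_const_cases[of p q])
  have "odd p \<or> odd q" using assms by (metis coprime_common_divisor odd_one)
  then have "odd (p^2 - p*q + q^2)" by auto
  then show ?thesis unfolding k(2)[symmetric] by simp
qed

lemma odd_a_const_1:
  assumes "odd (p + q)"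
  shows "odd (a_const p q $ 1)"
proof -
  obtain k :: int where k: "k = 1 \<or> k = 3" "k * a_const p q $ 1 = p^2 - q^2" by (rule a_const_cases[of p q])
  have "odd (p^2 - q^2)" using assms by auto
  then show ?thesis unfolding k(2)[symmetric] by simp
qed

text \<open>A common prime divisor r also divides p^2 - q^2 and q^2 - 2pq, but not q. So q = 2p and
  then 0 = 3 p^2 modulo r, which leaves r = 3. Then 3 divides p + q, the original numbers
  are divisible by 9, and this forces 3 to divide p.\<close>

lemma coprime_a_const:
  assumes cop: "coprime p q"
  shows "coprime (a_const p q $ 1) (a_const p q $ 2)"
proof (rule ccontr)
  assume "\<not> coprime (a_const p q $ 1) (a_const p q $ 2)"
  then have nu: "\<not> is_unit (gcd (a_const p q $ 1) (a_const p q $ 2))" by (simp only: is_unit_gcd not_False_eq_True)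
  have "\<exists>r::int. r dvd gcd (a_const p q $ 1) (a_const p q $ 2) \<and> prime r"
  proof (cases "gcd (a_const p q $ 1) (a_const p q $ 2) = 0")
    case True
    have "prime (2::int)" by simp
    then show ?thesis unfolding True by (intro exI[of _ 2]) simp
  next
    case False
    then show ?thesis using nu by (rule prime_divisor_exists)
  qed
  then obtain r where r: "prime r" "r dvd a_const p q $ 1" "r dvd a_const p q $ 2" by auto
  obtain k :: int where k: "k = 1 \<or> k = 3" "k = 3 \<longleftrightarrow> 3 dvd p + q"
    "k * a_const p q $ 1 = p^2 - q^2" "k * a_const p q $ 2 = q^2 - 2*p*q"
    by (rule a_const_cases[of p q])
  have "k * r dvd k * a_const p q $ 1" "k * r dvd k * a_const p q $ 2" using r(2,3) by (auto intro: mult_dvd_mono)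
  moreover have "k * a_const p q $ 1 = (p - q) * (p + q)" "k * a_const p q $ 2 = q * (q - 2 * p)"
    by (simp_all add: k power2_eq_square algebra_simps)
  ultimately have g: "k * r dvd (p - q) * (p + q)" and h: "k * r dvd q * (q - 2 * p)" by simp_all
  have nodvd: "\<not> (s dvd p \<and> s dvd q)" if "prime s" for s
    using cop that by (metis coprime_common_divisor not_prime_unit)
  have nq: "\<not> s dvd q" if s: "prime s" "s dvd (p - q) * (p + q)" for s
  proof
    assume q: "s dvd q"
    from s have "s dvd p - q \<or> s dvd p + q" by (simp add: prime_dvd_mult_iff)
    then have "s dvd (p - q) + q \<or> s dvd (p + q) - q" using q by (blast intro: dvd_add dvd_diff)
    then have "s dvd p" by simp
    with q nodvd s(1) show False by blast
  qed
  have rg: "r dvd (p - q) * (p + q)" and rh: "r dvd q * (q - 2 * p)" using dvd_mult_right[OF g] dvd_mult_right[OF h] by simp_all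
  have rq: "\<not> r dvd q" using nq[OF r(1) rg] .
  then have r2: "r dvd q - 2 * p" using rh r(1) by (simp add: prime_dvd_mult_iff)
  have "r dvd (p - q) * (p + q) + (q + 2 * p) * (q - 2 * p)" by (rule dvd_add[OF rg dvd_mult[OF r2]])
  also have "(p - q) * (p + q) + (q + 2 * p) * (q - 2 * p) = - 3 * (p * p)" by (simp add: algebra_simps)
  finally have "r dvd 3 \<or> r dvd p" using r(1) by (auto simp: prime_dvd_mult_iff)
  moreover have "\<not> r dvd p"
  proof
    assume "r dvd p"
    then have "r dvd (q - 2 * p) + 2 * p" using r2 by (intro dvd_add dvd_mult)
    then show False using rq by simp
  qed
  ultimately have "r dvd 3" by blast
  then have r3: "r = 3" using r(1) by (simp add: primes_dvd_imp_eq prime_int_numeral_eq)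
  have "(3::int) dvd q - 2 * p + 3 * p" using r2 unfolding r3 by (intro dvd_add dvd_triv_left)
  then have pq: "3 dvd p + q" by (simp add: algebra_simps)
  then have k3: "k = 3" using k(2) by simp
  have p3: "prime (3::int)" using r(1) r3 by simp
  have "\<not> 3 dvd p - q"
  proof
    assume "3 dvd p - q"
    then have "3 dvd (p + q) - (p - q)" using pq by (rule dvd_diff[rotated])
    then have "3 dvd 2 * q" by (simp add: algebra_simps)
    then show False using rq p3 r3 by (simp add: prime_dvd_mult_iff)
  qed
  then have "coprime (3 * 3) (p - q)" using p3 by (metis coprime_mult_left_iff prime_imp_coprime)
  then have d1: "3 * 3 dvd p + q" using g unfolding k3 r3 by (metis coprime_dvd_mult_right_iff)
  have "coprime (3 * 3) q" using p3 rq unfolding r3 by (metis coprime_mult_left_iff prime_imp_coprime)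
  then have d2: "3 * 3 dvd q - 2 * p" using h unfolding k3 r3 by (metis coprime_dvd_mult_right_iff)
  have "3 * 3 dvd (p + q) - (q - 2 * p)" using d1 d2 by (rule dvd_diff)
  then have "3 * 3 dvd 3 * p" by (simp add: algebra_simps)
  then have "3 dvd p" by presburger
  then show False using \<open>\<not> r dvd p\<close> r3 by simp
qed

theorem theorem11p6:
  fixes s :: real and p q :: int and a \<alpha> c d e f :: "real^3" and l :: real
  assumes "s \<in> {0<..<1/2} \<inter> \<rat>"
    and "s = real_of_int p / real_of_int q" and "coprime p q" and "0 < 2 * p" and "2 * p < q"
    and "a = (\<chi> j. real_of_int (a_const p q $ j))"
    and "l = real_of_int (lam_const p q)"
    and "alpha_rel a \<alpha>"
    and "c \<noteq> 0" and "d \<noteq> 0" and "e \<noteq> 0" and "f \<noteq> 0"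
    and "eigenvector_of (M_mat a \<alpha>) (join6 c d) l"
    and "eigenvector_of (M_mat a \<alpha>) (join6 e f) (3 * l)"
  shows
    "(\<forall>P \<in> param_space c d e f.
        closed (range (Phi a l \<alpha> c d e f P)) \<and>
        special_Lagrangian_3fold (Phi a l \<alpha> c d e f P)) \<and>
     positive_codim_in (param_space c d e f)
       {P \<in> param_space c d e f. \<not> immersed_S1xR2 (Phi a l \<alpha> c d e f P)} \<and>
     special_Lagrangian_T2_cone (T2_cone a) \<and>
     range (Phi0 a \<alpha>) = T2_cone a \<and>
     double_covers_parametrised_cone a \<alpha> \<and>
     (odd (p + q) \<longrightarrow> two_to_one_onto (Phi0 a \<alpha>) (T2_cone a)) \<and>
     (\<forall>P \<in> param_space c d e f. weakly_asymptotic_half (Phi a l \<alpha> c d e f P) (Phi0 a \<alpha>))"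
proof -
  note a = \<open>a = (\<chi> j. real_of_int (a_const p q $ j))\<close> and l = \<open>l = real_of_int (lam_const p q)\<close>
  interpret primitive_family a \<alpha> l c d e f "\<lambda>j. a_const p q $ j" "lam_const p q"
  proof
    have "real_of_int (a_const p q $ 1 + a_const p q $ 2 + a_const p q $ 3) = 0"
      by (simp only: a_const_sum of_int_0)
    then show "a$1 + a$2 + a$3 = 0" by (simp add: a)
    have "real_of_int ((lam_const p q)^2) =
        real_of_int ((a_const p q $ 2)^2 + a_const p q $ 2 * a_const p q $ 3 + (a_const p q $ 3)^2)"
      by (simp only: lam_const_sq)
    then show "l^2 = (a$2)^2 + a$2 * a$3 + (a$3)^2" by (simp add: a l)
    show "l > 0" using lam_const_pos assms by (simp add: l)
  qed (use assms eigenvector_of_M_matD odd_lam_const coprime_a_const in \<open>auto simp: a l\<close>)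
  show ?thesis
    using closed_range_Phi special_Lagrangian_3fold_Phi generic_immersed special_Lagrangian_T2_cone
      range_Phi0 double_covers_Phi0 two_to_one_Phi0 odd_a_const_1 weakly_asymptotic_Phi
    by blast
qed

end
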